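(* Let $Y$ be a triangulation of the real line and $f : X \to Y$ a simplicial map. Then $$H_k(X) \cong \bigoplus_{p+q=k} H_p(Y; L_q^f),$$ where $L_q^f$ is the $q$-th Leray cosheaf of $f$.
   Context: Fix a field $K$; $H_k(X)$ is simplicial homology in degree $k$ with coefficients in $K$. The simplicial complexes $X$ and $Y$ need not be finite, and $X$ need not be of bounded dimension. Simplices are open. $C_d(X)$ is the $K$-vector space generated by the oriented $d$-simplices of $X$ (each element is non-zero on only finitely many $d$-simplices), with boundary $\partial[u_0,\dots,u_d]=\sum_{i=0}^d(-1)^i[u_0,\dots,\hat u_i,\dots,u_d]$, where the hat indicates deletion. Cosheaves. The entrance path category $\mathsf{Ent}(Y)$ is the poset with an object for each simplex $\tau\in Y$ and a morphism $\tau\to\tau'$ for every face relation $\tau'\le\tau$. A cosheaf of vector spaces over $Y$ is a functor $L:\mathsf{Ent}(Y)\to\mathsf{Vec}$, where $\mathsf{Vec}$ is the category of $K$-vector spaces; $L(\tau'\le\tau):L(\tau)\to L(\tau')$ is its value on a morphism. Cosheaf homology. Let $Y^p$ be the $p$-skeleton of $Y$ and $C_p(Y;L)=\bigoplus_{\tau\in Y^p\setminus Y^{p-1}}L(\tau)$. The boundary map $\partial:C_p(Y;L)\to C_{p-1}(Y;L)$ is generated by the following assignment: for an oriented $p$-simplex $\tau=[v_0,\dots,v_p]$ in $Y$ and $a\in L(\tau)$, $$\partial(a)=\sum_{i=0}^p(-1)^iL([v_0,\dots,\hat v_i,\dots,v_p]\le\tau)(a)\in C_{p-1}(Y;L).$$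 $H_p(Y;L)$ is the $p$-th homology of this chain complex. Leray cosheaves. For $\tau\in Y$, $f^{-1}(\tau)$ consists of the simplices $\sigma$ of $X$ with $f(\sigma)=\tau$, and $F_q(\tau)\subseteq C_{\dim\tau+q}(X)$ is the subspace generated by the simplices $\sigma\in f^{-1}(\tau)$ with $\dim\sigma=\dim\tau+q$. The boundary $\partial:F_q(\tau)\to F_{q-1}(\tau)$ takes $\sigma$ to the signed sum of those simplices in its simplicial boundary that lie in $f^{-1}(\tau)$; this gives a chain complex $F_\bullet(\tau)$. For $\tau'\le\tau$, a chain map $F_\bullet(\tau'\le\tau):F_\bullet(\tau)\to F_\bullet(\tau')$ is defined as follows. Every $\sigma\in f^{-1}(\tau)$ has a maximal face $\sigma'\le\sigma$ with $f(\sigma')=\tau'$. If $\dim\sigma-\dim\tau\ne\dim\sigma'-\dim\tau'$, send $\sigma$ to $0$. Otherwise send $\sigma$ to $\sigma'$ with the following sign. Call a vertex $u_i$ of $\sigma$ alone if it is the only vertex of $\sigma$ that maps to $f(u_i)$. Choose the orientation $\sigma=[u_0,\dots,u_{\dim\tau+q}]$ so that if $u_i$ is alone, then $u_j$ is also alone for all $j\ge i$; that is, push all alone vertices to the end of the ordering. Exactly $\dim\tau-\dim\tau'$ vertices of $\sigma$ are removed to get $\sigma'$, and all of these are alone. $F_q(\tau'\le\tau)$ is the map generated by sending $[u_0,\dots,u_{\dim\tau+q}]$ to the oriented simplex $\sigma'$ obtained by deleting these vertices. These assignments form a functor $F_\bullet$ from $\mathsf{Ent}(Y)$ to chain complexes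 of $K$-vector spaces, and the $q$-th Leray cosheaf of $f$ is $L_q^f=H_q\circ F_\bullet:\mathsf{Ent}(Y)\to\mathsf{Vec}$, where $H_q$ is the $q$-th homology functor. *)

theory Defs
  imports
    "HOL-Analysis.Analysis"
    "HOL-Algebra.Module"
    "HOL-Algebra.AbelCoset"
    "HOL-Combinatorics.Permutations"
begin

section \<open>Vector spaces\<close>

text \<open>A vector space over a field \<open>K\<close> is a \<open>module\<close> record of HOL-Algebra. Such a record
  inherits the fields \<open>mult\<close> and \<open>one\<close> from \<open>ring\<close>; no module axiom mentions them and they are left
  \<open>undefined\<close> here.\<close>

definition vs_iso :: "('k, 'r) ring_scheme \<Rightarrow> ('k, 'a) module \<Rightarrow> ('k, 'b) module \<Rightarrow> bool" where
  "vs_iso K M N \<longleftrightarrow>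
    (\<exists>h. bij_betw h (carrier M) (carrier N) \<and>
      (\<forall>x\<in>carrier M. \<forall>y\<in>carrier M. h (x \<oplus>\<^bsub>M\<^esub> y) = h x \<oplus>\<^bsub>N\<^esub> h y) \<and>
      (\<forall>a\<in>carrier K. \<forall>x\<in>carrier M. h (a \<odot>\<^bsub>M\<^esub> x) = a \<odot>\<^bsub>N\<^esub> h x))"

definition quotient_space :: "('k, 'a) module \<Rightarrow> 'a set \<Rightarrow> ('k, 'a set) module" where
  "quotient_space M B =
    \<lparr>carrier = a_rcosets\<^bsub>M\<^esub> B, mult = undefined, one = undefined, zero = B, add = set_add M,
     smult = (\<lambda>a A. \<Union>x\<in>A. B +>\<^bsub>M\<^esub> (a \<odot>\<^bsub>M\<^esub> x))\<rparr>"

definition direct_sum :: "'i set \<Rightarrow> ('i \<Rightarrow> ('k, 'a) module) \<Rightarrow> ('k, 'i \<Rightarrow> 'a) module" where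
  "direct_sum I M =
    \<lparr>carrier = {x \<in> \<Pi>\<^sub>E i\<in>I. carrier (M i). finite {i \<in> I. x i \<noteq> \<zero>\<^bsub>M i\<^esub>}},
     mult = undefined, one = undefined,
     zero = (\<lambda>i\<in>I. \<zero>\<^bsub>M i\<^esub>), add = (\<lambda>x y. \<lambda>i\<in>I. x i \<oplus>\<^bsub>M i\<^esub> y i),
     smult = (\<lambda>a x. \<lambda>i\<in>I. a \<odot>\<^bsub>M i\<^esub> x i)\<rparr>"

definition summand :: "'i set \<Rightarrow> ('i \<Rightarrow> ('k, 'a) module) \<Rightarrow> 'i \<Rightarrow> 'a \<Rightarrow> 'i \<Rightarrow> 'a" where
  "summand I M i a = (\<lambda>j\<in>I. if j = i then a else \<zero>\<^bsub>M j\<^esub>)"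

text \<open>The vector space with basis \<open>S\<close>, as finitely supported functions vanishing outside \<open>S\<close>.\<close>

definition free_space :: "('k, 'r) ring_scheme \<Rightarrow> 'b set \<Rightarrow> ('k, 'b \<Rightarrow> 'k) module" where
  "free_space K S =
    \<lparr>carrier = {c. (\<forall>b. c b \<in> carrier K) \<and> finite {b. c b \<noteq> \<zero>\<^bsub>K\<^esub>} \<and> {b. c b \<noteq> \<zero>\<^bsub>K\<^esub>} \<subseteq> S},
     mult = undefined, one = undefined,
     zero = (\<lambda>b. \<zero>\<^bsub>K\<^esub>), add = (\<lambda>c d b. c b \<oplus>\<^bsub>K\<^esub> d b),
     smult = (\<lambda>a c b. a \<otimes>\<^bsub>K\<^esub> c b)\<rparr>"

definition linear_extension ::
    "('k, 'r) ring_scheme \<Rightarrow> ('k, 'a) module \<Rightarrow> ('b \<Rightarrow> 'a) \<Rightarrow> ('b \<Rightarrow> 'k) \<Rightarrow> 'a" where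
  "linear_extension K M g c = (\<Oplus>\<^bsub>M\<^esub>b\<in>{b. c b \<noteq> \<zero>\<^bsub>K\<^esub>}. c b \<odot>\<^bsub>M\<^esub> g b)"


section \<open>Homology of chain complexes\<close>

text \<open>A chain complex consists of spaces \<open>C n\<close> for \<open>n \<ge> 0\<close> and maps \<open>d n\<close> from \<open>C n\<close> to
  \<open>C (n - 1)\<close>. The complex vanishes in negative degrees, so every chain of degree \<open>0\<close> is a cycle
  and \<open>d 0\<close> is irrelevant.\<close>

definition cycles :: "(nat \<Rightarrow> ('k, 'a) module) \<Rightarrow> (nat \<Rightarrow> 'a \<Rightarrow> 'a) \<Rightarrow> nat \<Rightarrow> 'a set" where
  "cycles C d n =
    (if n = 0 then carrier (C 0) else {z \<in> carrier (C n). d n z = \<zero>\<^bsub>C (n - 1)\<^esub>})"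

definition boundaries :: "(nat \<Rightarrow> ('k, 'a) module) \<Rightarrow> (nat \<Rightarrow> 'a \<Rightarrow> 'a) \<Rightarrow> nat \<Rightarrow> 'a set" where
  "boundaries C d n = d (Suc n) ` carrier (C (Suc n))"

definition homology ::
    "(nat \<Rightarrow> ('k, 'a) module) \<Rightarrow> (nat \<Rightarrow> 'a \<Rightarrow> 'a) \<Rightarrow> nat \<Rightarrow> ('k, 'a set) module" where
  "homology C d n = quotient_space ((C n)\<lparr>carrier := cycles C d n\<rparr>) (boundaries C d n)"

text \<open>The map on \<open>n\<close>-th homology induced by \<open>\<phi>\<close>, with target the homology of \<open>C\<close>, \<open>d\<close>: it sends
  the class of \<open>z\<close> to the class of \<open>\<phi> z\<close>.\<close>

definition homology_map ::
    "(nat \<Rightarrow> ('k, 'b) module) \<Rightarrow> (nat \<Rightarrow> 'b \<Rightarrow> 'b) \<Rightarrow> nat \<Rightarrow> ('a \<Rightarrow> 'b) \<Rightarrow> 'a set \<Rightarrow> 'b set" where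
  "homology_map C d n \<phi> A = (\<Union>z\<in>A. boundaries C d n +>\<^bsub>C n\<^esub> \<phi> z)"


section \<open>Simplicial complexes\<close>

text \<open>Complexes are abstract: a simplex is its nonempty finite set of vertices, and the
  face relation is inclusion.\<close>

definition is_complex :: "'v set set \<Rightarrow> bool" where
  "is_complex X \<longleftrightarrow>
    (\<forall>\<sigma>\<in>X. finite \<sigma> \<and> \<sigma> \<noteq> {}) \<and> (\<forall>\<sigma>\<in>X. \<forall>\<rho>. \<rho> \<subseteq> \<sigma> \<and> \<rho> \<noteq> {} \<longrightarrow> \<rho> \<in> X)"

definition simplicial_map :: "'v set set \<Rightarrow> 'w set set \<Rightarrow> ('v \<Rightarrow> 'w) \<Rightarrow> bool" where
  "simplicial_map X Y f \<longleftrightarrow> (\<forall>\<sigma>\<in>X. f ` \<sigma> \<in> Y)"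

definition sdim :: "'v set \<Rightarrow> nat" where
  "sdim \<sigma> = card \<sigma> - 1"

definition simplices :: "'v set set \<Rightarrow> nat \<Rightarrow> 'v set set" where
  "simplices X d = {\<sigma>\<in>X. sdim \<sigma> = d}"

text \<open>The geometric realization, by barycentric coordinates, with the weak topology: a set is open
  iff its intersection with every closed simplex is open there. The topology on functions is the
  product topology, which on a closed simplex is the Euclidean one.\<close>

definition closed_simplex :: "'w set set \<Rightarrow> 'w set \<Rightarrow> ('w \<Rightarrow> real) set" where
  "closed_simplex Y \<tau> =
    {\<alpha>. (\<forall>v. 0 \<le> \<alpha> v) \<and> {v. \<alpha> v \<noteq> 0} \<in> Y \<and> {v. \<alpha> v \<noteq> 0} \<subseteq> \<tau> \<and> sum \<alpha> {v. \<alpha> v \<noteq> 0} = 1}"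

definition realization :: "'w set set \<Rightarrow> ('w \<Rightarrow> real) topology" where
  "realization Y = topology (\<lambda>U. U \<subseteq> (\<Union>\<tau>\<in>Y. closed_simplex Y \<tau>) \<and>
     (\<forall>\<tau>\<in>Y. openin (top_of_set (closed_simplex Y \<tau>)) (U \<inter> closed_simplex Y \<tau>)))"

lemma openin_realization:
  "openin (realization Y) U \<longleftrightarrow> U \<subseteq> (\<Union>\<tau>\<in>Y. closed_simplex Y \<tau>) \<and>
     (\<forall>\<tau>\<in>Y. openin (top_of_set (closed_simplex Y \<tau>)) (U \<inter> closed_simplex Y \<tau>))"
proof -
  have "istopology (\<lambda>U. U \<subseteq> (\<Union>\<tau>\<in>Y. closed_simplex Y \<tau>) \<and>
     (\<forall>\<tau>\<in>Y. openin (top_of_set (closed_simplex Y \<tau>)) (U \<inter> closed_simplex Y \<tau>)))"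
    unfolding istopology_def
  proof (intro conjI allI impI ballI)
    fix S T \<tau>
    assume "S \<subseteq> (\<Union>\<tau>\<in>Y. closed_simplex Y \<tau>) \<and>
        (\<forall>\<tau>\<in>Y. openin (top_of_set (closed_simplex Y \<tau>)) (S \<inter> closed_simplex Y \<tau>))"
      and "T \<subseteq> (\<Union>\<tau>\<in>Y. closed_simplex Y \<tau>) \<and>
        (\<forall>\<tau>\<in>Y. openin (top_of_set (closed_simplex Y \<tau>)) (T \<inter> closed_simplex Y \<tau>))"
      and "\<tau> \<in> Y"
    then have "openin (top_of_set (closed_simplex Y \<tau>)) (S \<inter> closed_simplex Y \<tau>)"
      and "openin (top_of_set (closed_simplex Y \<tau>)) (T \<inter> closed_simplex Y \<tau>)"
      by blast+
    from openin_Int[OF this]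
    show "openin (top_of_set (closed_simplex Y \<tau>)) (S \<inter> T \<inter> closed_simplex Y \<tau>)"
      by (simp add: Int_assoc Int_left_commute)
  next
    fix \<U> \<tau>
    assume "\<forall>U\<in>\<U>. U \<subseteq> (\<Union>\<tau>\<in>Y. closed_simplex Y \<tau>) \<and>
        (\<forall>\<tau>\<in>Y. openin (top_of_set (closed_simplex Y \<tau>)) (U \<inter> closed_simplex Y \<tau>))"
      and "\<tau> \<in> Y"
    then have "openin (top_of_set (closed_simplex Y \<tau>))
        (\<Union>((\<lambda>U. U \<inter> closed_simplex Y \<tau>) ` \<U>))"
      by (intro openin_Union) auto
    moreover have "\<Union>((\<lambda>U. U \<inter> closed_simplex Y \<tau>) ` \<U>) = \<Union>\<U> \<inter> closed_simplex Y \<tau>"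
      by blast
    ultimately show "openin (top_of_set (closed_simplex Y \<tau>)) (\<Union>\<U> \<inter> closed_simplex Y \<tau>)"
      by simp
  qed blast+
  then show ?thesis
    unfolding realization_def by (simp add: topology_inverse')
qed

definition triangulates_real_line :: "'w set set \<Rightarrow> bool" where
  "triangulates_real_line Y \<longleftrightarrow>
    is_complex Y \<and> realization Y homeomorphic_space euclideanreal"


section \<open>Oriented simplices and simplicial homology\<close>

text \<open>An orientation picks a reference ordering \<open>ori \<sigma>\<close> of the vertices of every simplex. Chains
  are written in the basis of simplices carrying their reference orientations; for an arbitrary
  ordering \<open>us\<close> of \<open>\<sigma>\<close>, the oriented simplex \<open>[us]\<close> is \<open>[ori \<sigma>]\<close> times the sign of the
  permutation that takes one ordering to the other.\<close>

definition orientation :: "'v set set \<Rightarrow> ('v set \<Rightarrow> 'v list) \<Rightarrow> bool" where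
  "orientation X ori \<longleftrightarrow> (\<forall>\<sigma>\<in>X. distinct (ori \<sigma>) \<and> set (ori \<sigma>) = \<sigma>)"

definition reorder_sign :: "'v list \<Rightarrow> 'v list \<Rightarrow> int" where
  "reorder_sign us vs = sign (permutation_of_list (zip us vs))"

definition oriented_simplex ::
    "('k, 'r) ring_scheme \<Rightarrow> ('v set \<Rightarrow> 'v list) \<Rightarrow> 'v list \<Rightarrow> 'v set \<Rightarrow> 'k" where
  "oriented_simplex K ori us =
    (\<lambda>\<sigma>. if \<sigma> = set us then [(reorder_sign (ori \<sigma>) us)] \<cdot>\<^bsub>K\<^esub> \<one>\<^bsub>K\<^esub> else \<zero>\<^bsub>K\<^esub>)"

definition delete_nth :: "nat \<Rightarrow> 'v list \<Rightarrow> 'v list" where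
  "delete_nth i us = take i us @ drop (Suc i) us"

definition chains :: "('k, 'r) ring_scheme \<Rightarrow> 'v set set \<Rightarrow> nat \<Rightarrow> ('k, 'v set \<Rightarrow> 'k) module" where
  "chains K X d = free_space K (simplices X d)"

definition boundary ::
    "('k, 'r) ring_scheme \<Rightarrow> 'v set set \<Rightarrow> ('v set \<Rightarrow> 'v list) \<Rightarrow> nat \<Rightarrow>
      ('v set \<Rightarrow> 'k) \<Rightarrow> 'v set \<Rightarrow> 'k" where
  "boundary K X ori d =
    linear_extension K (chains K X (d - 1))
      (\<lambda>\<sigma>. \<Oplus>\<^bsub>chains K X (d - 1)\<^esub>i\<in>{..d}.
        [((-1) ^ i :: int)] \<cdot>\<^bsub>chains K X (d - 1)\<^esub> oriented_simplex K ori (delete_nth i (ori \<sigma>)))"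

definition simplicial_homology ::
    "('k, 'r) ring_scheme \<Rightarrow> 'v set set \<Rightarrow> ('v set \<Rightarrow> 'v list) \<Rightarrow> nat \<Rightarrow>
      ('k, ('v set \<Rightarrow> 'k) set) module" where
  "simplicial_homology K X ori = homology (chains K X) (boundary K X ori)"


section \<open>Cosheaf homology\<close>

text \<open>The data of a functor from the entrance path category of a complex to vector spaces;
  \<open>cmor L \<tau> \<tau>'\<close> is the map \<open>L(\<tau>) \<Rightarrow> L(\<tau>')\<close> for a face \<open>\<tau>'\<close> of \<open>\<tau>\<close>.\<close>

record ('w, 'k, 'a) cosheaf =
  cobj :: "'w set \<Rightarrow> ('k, 'a) module"
  cmor :: "'w set \<Rightarrow> 'w set \<Rightarrow> 'a \<Rightarrow> 'a"

definition cosheaf_chains ::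
    "'w set set \<Rightarrow> ('w, 'k, 'a) cosheaf \<Rightarrow> nat \<Rightarrow> ('k, 'w set \<Rightarrow> 'a) module" where
  "cosheaf_chains Y L p = direct_sum (simplices Y p) (cobj L)"

text \<open>The summand of a simplex \<open>\<tau>\<close> refers to its reference orientation, so the term of a face
  carries an additional sign comparing the induced with the reference orientation of the face.\<close>

definition cosheaf_boundary ::
    "'w set set \<Rightarrow> ('w set \<Rightarrow> 'w list) \<Rightarrow> ('w, 'k, 'a) cosheaf \<Rightarrow> nat \<Rightarrow>
      ('w set \<Rightarrow> 'a) \<Rightarrow> 'w set \<Rightarrow> 'a" where
  "cosheaf_boundary Y ori L p c =
    (\<Oplus>\<^bsub>cosheaf_chains Y L (p - 1)\<^esub>\<tau>\<in>{\<tau> \<in> simplices Y p. c \<tau> \<noteq> \<zero>\<^bsub>cobj L \<tau>\<^esub>}.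
      \<Oplus>\<^bsub>cosheaf_chains Y L (p - 1)\<^esub>i\<in>{..p}.
        (let vs = delete_nth i (ori \<tau>) in
          [((-1) ^ i * reorder_sign (ori (set vs)) vs)] \<cdot>\<^bsub>cosheaf_chains Y L (p - 1)\<^esub>
            summand (simplices Y (p - 1)) (cobj L) (set vs) (cmor L \<tau> (set vs) (c \<tau>))))"

definition cosheaf_homology ::
    "'w set set \<Rightarrow> ('w set \<Rightarrow> 'w list) \<Rightarrow> ('w, 'k, 'a) cosheaf \<Rightarrow> nat \<Rightarrow>
      ('k, ('w set \<Rightarrow> 'a) set) module" where
  "cosheaf_homology Y ori L = homology (cosheaf_chains Y L) (cosheaf_boundary Y ori L)"


section \<open>Leray cosheaves\<close>

definition fiber :: "'v set set \<Rightarrow> ('v \<Rightarrow> 'w) \<Rightarrow> 'w set \<Rightarrow> 'v set set" where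
  "fiber X f \<tau> = {\<sigma>\<in>X. f ` \<sigma> = \<tau>}"

definition fiber_chains ::
    "('k, 'r) ring_scheme \<Rightarrow> 'v set set \<Rightarrow> ('v \<Rightarrow> 'w) \<Rightarrow> 'w set \<Rightarrow> nat \<Rightarrow>
      ('k, 'v set \<Rightarrow> 'k) module" where
  "fiber_chains K X f \<tau> q =
    (chains K X (sdim \<tau> + q))\<lparr>carrier :=
      {c \<in> carrier (chains K X (sdim \<tau> + q)). {\<sigma>. c \<sigma> \<noteq> \<zero>\<^bsub>K\<^esub>} \<subseteq> fiber X f \<tau>}\<rparr>"

definition fiber_boundary ::
    "('k, 'r) ring_scheme \<Rightarrow> 'v set set \<Rightarrow> ('v set \<Rightarrow> 'v list) \<Rightarrow> ('v \<Rightarrow> 'w) \<Rightarrow> 'w set \<Rightarrow> nat \<Rightarrow>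
      ('v set \<Rightarrow> 'k) \<Rightarrow> 'v set \<Rightarrow> 'k" where
  "fiber_boundary K X ori f \<tau> q c =
    (\<lambda>\<sigma>. if \<sigma> \<in> fiber X f \<tau> then boundary K X ori (sdim \<tau> + q) c \<sigma> else \<zero>\<^bsub>K\<^esub>)"

definition alone :: "('v \<Rightarrow> 'w) \<Rightarrow> 'v set \<Rightarrow> 'v \<Rightarrow> bool" where
  "alone f \<sigma> u \<longleftrightarrow> (\<forall>u'\<in>\<sigma>. f u' = f u \<longrightarrow> u' = u)"

definition maximal_face :: "('v \<Rightarrow> 'w) \<Rightarrow> 'w set \<Rightarrow> 'v set \<Rightarrow> 'v set" where
  "maximal_face f \<tau>' \<sigma> = {u\<in>\<sigma>. f u \<in> \<tau>'}"

text \<open>The vertices that are alone go to the end of the ordering. When several vertices are alone,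
  the sign of the deletion map depends on their order; those about to be deleted go last, which
  makes deletion commute with the boundary maps.\<close>

definition alone_last :: "('v \<Rightarrow> 'w) \<Rightarrow> 'w set \<Rightarrow> 'v list \<Rightarrow> 'v list" where
  "alone_last f \<tau>' us =
    filter (\<lambda>u. \<not> alone f (set us) u) us @
    filter (\<lambda>u. alone f (set us) u \<and> f u \<in> \<tau>') us @
    filter (\<lambda>u. alone f (set us) u \<and> f u \<notin> \<tau>') us"

definition fiber_map ::
    "('k, 'r) ring_scheme \<Rightarrow> 'v set set \<Rightarrow> ('v set \<Rightarrow> 'v list) \<Rightarrow> ('v \<Rightarrow> 'w) \<Rightarrow>
      'w set \<Rightarrow> 'w set \<Rightarrow> nat \<Rightarrow> ('v set \<Rightarrow> 'k) \<Rightarrow> 'v set \<Rightarrow> 'k" where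
  "fiber_map K X ori f \<tau> \<tau>' q =
    linear_extension K (fiber_chains K X f \<tau>' q)
      (\<lambda>\<sigma>.
        if int (sdim \<sigma>) - int (sdim \<tau>) \<noteq> int (sdim (maximal_face f \<tau>' \<sigma>)) - int (sdim \<tau>')
        then \<zero>\<^bsub>fiber_chains K X f \<tau>' q\<^esub>
        else
          let us = alone_last f \<tau>' (ori \<sigma>) in
            [(reorder_sign (ori \<sigma>) us)] \<cdot>\<^bsub>fiber_chains K X f \<tau>' q\<^esub>
              oriented_simplex K ori (filter (\<lambda>u. f u \<in> \<tau>') us))"

definition leray_cosheaf ::
    "('k, 'r) ring_scheme \<Rightarrow> 'v set set \<Rightarrow> ('v set \<Rightarrow> 'v list) \<Rightarrow> ('v \<Rightarrow> 'w) \<Rightarrow> nat \<Rightarrow>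
      ('w, 'k, ('v set \<Rightarrow> 'k) set) cosheaf" where
  "leray_cosheaf K X ori f q =
    \<lparr>cobj = (\<lambda>\<tau>. homology (fiber_chains K X f \<tau>) (fiber_boundary K X ori f \<tau>) q),
     cmor = (\<lambda>\<tau> \<tau>'. homology_map (fiber_chains K X f \<tau>') (fiber_boundary K X ori f \<tau>') q
               (fiber_map K X ori f \<tau> \<tau>' q))\<rparr>"

end

theory Submission
  imports Defs
begin

text \<open>
  A triangulation of the line is a graph, so every simplex of \<open>X\<close> lies over a vertex or over an edge
  of \<open>Y\<close>. The chains over the vertices form a subcomplex of the chains of \<open>X\<close>, and the quotient
  complex consists of the chains over the edges. Both decompose over the simplices of \<open>Y\<close>: the
  homology of the subcomplex in degree \<open>k\<close> is the sum of the spaces \<open>L\<^sub>k(v)\<close> over the vertices \<open>v\<close>,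
  which is \<open>C\<^sub>0(Y; L\<^sub>k)\<close>, and that of the quotient in degree \<open>k\<close> is the sum of the spaces
  \<open>L\<^sub>q(e)\<close> over the edges \<open>e\<close>, which is \<open>C\<^sub>1(Y; L\<^sub>q)\<close> with \<open>q = k - 1\<close>, since an edge shifts
  degrees by one. If the connecting map of the long exact sequence is the boundary map of the
  cosheaf, the sequence presents \<open>H\<^sub>k(X)\<close> as an extension of \<open>H\<^sub>1(Y; L\<^sub>q)\<close> by \<open>H\<^sub>0(Y; L\<^sub>k)\<close>. Over a
  field an extension splits (\<open>split_quotient\<close>), and the other summands vanish. The long exact
  sequence itself does not appear below. The lemmas \<open>vertex_class_zero_iff\<close>, \<open>edge_class_surj\<close> and
  \<open>edge_class_zero_iff\<close> express in terms of cycles the part of it that is needed.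

  The connecting map is compared with the cosheaf boundary in \<open>cosheaf_boundary_class_chain\<close>, and
  here signs need care. A transition map from an edge to either of its ends is \<open>(-1)^(q + 1)\<close> times
  the corresponding piece of the boundary of \<open>X\<close> (\<open>fiber_map_eq\<close>), with the same sign at both
  ends, but the cosheaf boundary takes the ends of an edge with opposite signs. The comparison
  therefore multiplies the summand of each simplex \<open>\<tau>\<close> of \<open>Y\<close> by a sign \<open>s \<tau>\<close> with opposite values
  at the two ends of every edge. A 2-colouring of the vertices of \<open>Y\<close> provides such signs.

  What is used about the line is thus that \<open>Y\<close> is a graph with a 2-colouring. Both facts follow
  from the intermediate value theorem: no vertex lies strictly between the ends of an edge
  (\<open>no_vertex_inside_edge\<close>). Three vertices of a single simplex would violate this, so the
  dimension is at most 1. Moreover, edges join consecutive vertices, and there are only finitely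
  many vertices in a bounded interval because every set of vertices is closed. Hence the parity of
  the number of vertices between the origin and a vertex is a 2-colouring (\<open>vertex_parity\<close>).
\<close>

section \<open>Linear maps, quotients and direct sums\<close>

definition linear_map ::
    "('k, 'r) ring_scheme \<Rightarrow> ('k, 'a) module \<Rightarrow> ('k, 'b) module \<Rightarrow> ('a \<Rightarrow> 'b) \<Rightarrow> bool" where
  "linear_map K M N h \<longleftrightarrow>
    (\<forall>x\<in>carrier M. h x \<in> carrier N) \<and>
    (\<forall>x\<in>carrier M. \<forall>y\<in>carrier M. h (x \<oplus>\<^bsub>M\<^esub> y) = h x \<oplus>\<^bsub>N\<^esub> h y) \<and>
    (\<forall>a\<in>carrier K. \<forall>x\<in>carrier M. h (a \<odot>\<^bsub>M\<^esub> x) = a \<odot>\<^bsub>N\<^esub> h x)"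

lemma linear_mapI:
  assumes "\<And>x. x \<in> carrier M \<Longrightarrow> h x \<in> carrier N"
    and "\<And>x y. x \<in> carrier M \<Longrightarrow> y \<in> carrier M \<Longrightarrow> h (x \<oplus>\<^bsub>M\<^esub> y) = h x \<oplus>\<^bsub>N\<^esub> h y"
    and "\<And>a x. a \<in> carrier K \<Longrightarrow> x \<in> carrier M \<Longrightarrow> h (a \<odot>\<^bsub>M\<^esub> x) = a \<odot>\<^bsub>N\<^esub> h x"
  shows "linear_map K M N h"
  using assms by (auto simp: linear_map_def)

lemma linear_map_closed: "linear_map K M N h \<Longrightarrow> x \<in> carrier M \<Longrightarrow> h x \<in> carrier N"
  and linear_map_add: "linear_map K M N h \<Longrightarrow> x \<in> carrier M \<Longrightarrow> y \<in> carrier M \<Longrightarrow>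
    h (x \<oplus>\<^bsub>M\<^esub> y) = h x \<oplus>\<^bsub>N\<^esub> h y"
  and linear_map_smult: "linear_map K M N h \<Longrightarrow> a \<in> carrier K \<Longrightarrow> x \<in> carrier M \<Longrightarrow>
    h (a \<odot>\<^bsub>M\<^esub> x) = a \<odot>\<^bsub>N\<^esub> h x"
  by (auto simp: linear_map_def)

lemma linear_map_comp:
  "linear_map K M N h \<Longrightarrow> linear_map K N P g \<Longrightarrow> linear_map K M P (\<lambda>x. g (h x))"
  by (auto simp: linear_map_def)

lemma linear_map_corestrict:
  "linear_map K M N h \<Longrightarrow> (\<And>x. x \<in> carrier M \<Longrightarrow> h x \<in> H) \<Longrightarrow>
    linear_map K M (N\<lparr>carrier := H\<rparr>) h"
  by (auto simp: linear_map_def)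

lemma linear_map_cong:
  assumes "Module.module K M" and "linear_map K M N h" "\<And>x. x \<in> carrier M \<Longrightarrow> h x = g x"
  shows "linear_map K M N g"
proof -
  interpret M: Module.module K M by fact
  show ?thesis using assms(2,3) by (auto simp: linear_map_def)
qed

lemma (in abelian_group) add_minus_eq_zero_iff:
  assumes "x \<in> carrier G" "y \<in> carrier G"
  shows "x \<oplus> \<ominus> y = \<zero> \<longleftrightarrow> x = y"
proof
  assume "x \<oplus> \<ominus> y = \<zero>"
  then have "\<ominus> (\<ominus> y) = x" using assms by (intro minus_equality) auto
  then show "x = y" using assms by simp
qed (use assms in \<open>simp add: r_neg\<close>)

context cring
begin

lemma minus_one_smult:
  assumes "Module.module R M" "x \<in> carrier M"
  shows "(\<ominus> \<one>) \<odot>\<^bsub>M\<^esub> x = \<ominus>\<^bsub>M\<^esub> x"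
proof -
  interpret M: Module.module R M by fact
  show ?thesis using M.smult_l_minus[of "\<one>" x] assms(2) by simp
qed

text \<open>Closure under additive inverses is part of closure under scalars.\<close>

lemma submodule_criterion:
  assumes "Module.module R M" "H \<subseteq> carrier M" "\<zero>\<^bsub>M\<^esub> \<in> H"
    and "\<And>x y. x \<in> H \<Longrightarrow> y \<in> H \<Longrightarrow> x \<oplus>\<^bsub>M\<^esub> y \<in> H"
    and "\<And>a x. a \<in> carrier R \<Longrightarrow> x \<in> H \<Longrightarrow> a \<odot>\<^bsub>M\<^esub> x \<in> H"
  shows "submodule H R M"
proof -
  interpret M: Module.module R M by fact
  show ?thesis
  proof (rule M.submoduleI)
    fix x assume x: "x \<in> H"
    then have "(\<ominus> \<one>) \<odot>\<^bsub>M\<^esub> x \<in> H" using assms(5) by simp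
    then show "\<ominus>\<^bsub>M\<^esub> x \<in> H"
      using minus_one_smult[OF assms(1)] x assms(2) by auto
  qed (use assms in auto)
qed

lemma submodule_subset: "submodule H R M \<Longrightarrow> x \<in> H \<Longrightarrow> x \<in> carrier M"
  and submodule_zero: "submodule H R M \<Longrightarrow> \<zero>\<^bsub>M\<^esub> \<in> H"
  and submodule_add: "submodule H R M \<Longrightarrow> x \<in> H \<Longrightarrow> y \<in> H \<Longrightarrow> x \<oplus>\<^bsub>M\<^esub> y \<in> H"
  and submodule_smult: "submodule H R M \<Longrightarrow> a \<in> carrier R \<Longrightarrow> x \<in> H \<Longrightarrow> a \<odot>\<^bsub>M\<^esub> x \<in> H"
proof -
  assume H: "submodule H R M"
  interpret H: submodule H R M by fact
  show "x \<in> H \<Longrightarrow> x \<in> carrier M" using H.subset by auto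
  show "\<zero>\<^bsub>M\<^esub> \<in> H" using H.one_closed by simp
  show "x \<in> H \<Longrightarrow> y \<in> H \<Longrightarrow> x \<oplus>\<^bsub>M\<^esub> y \<in> H" using H.m_closed by simp
  show "a \<in> carrier R \<Longrightarrow> x \<in> H \<Longrightarrow> a \<odot>\<^bsub>M\<^esub> x \<in> H" by simp
qed

lemma submodule_minus:
  assumes "Module.module R M" "submodule H R M" "x \<in> H"
  shows "\<ominus>\<^bsub>M\<^esub> x \<in> H"
proof -
  have "(\<ominus> \<one>) \<odot>\<^bsub>M\<^esub> x \<in> H" using assms(2,3) by (simp add: submodule_smult)
  then show ?thesis
    using minus_one_smult[OF assms(1) submodule_subset[OF assms(2,3)]] by simp
qed

lemma submodule_module:
  "Module.module R M \<Longrightarrow> submodule H R M \<Longrightarrow> Module.module R (M\<lparr>carrier := H\<rparr>)"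
  by (rule submodule.submodule_is_module)

lemma submodule_restrict:
  assumes "Module.module R M" "submodule H R M" "submodule B R M" "B \<subseteq> H"
  shows "submodule B R (M\<lparr>carrier := H\<rparr>)"
  by (rule submodule_criterion)
    (use assms in \<open>auto simp: submodule_module submodule_zero submodule_add submodule_smult\<close>)

lemma linear_map_zero:
  assumes "Module.module R M" "Module.module R N" "linear_map R M N h"
  shows "h \<zero>\<^bsub>M\<^esub> = \<zero>\<^bsub>N\<^esub>"
proof -
  interpret M: Module.module R M by fact
  interpret N: Module.module R N by fact
  have "h (\<zero> \<odot>\<^bsub>M\<^esub> \<zero>\<^bsub>M\<^esub>) = \<zero> \<odot>\<^bsub>N\<^esub> h \<zero>\<^bsub>M\<^esub>"
    by (rule linear_map_smult[OF assms(3)]) auto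
  then show ?thesis using linear_map_closed[OF assms(3), of "\<zero>\<^bsub>M\<^esub>"] by simp
qed

lemma linear_map_minus:
  assumes "Module.module R M" "Module.module R N" "linear_map R M N h" "x \<in> carrier M"
  shows "h (\<ominus>\<^bsub>M\<^esub> x) = \<ominus>\<^bsub>N\<^esub> h x"
  using linear_map_smult[OF assms(3), of "\<ominus> \<one>" x] assms
  by (simp add: minus_one_smult linear_map_closed)

lemma linear_map_finsum:
  assumes "Module.module R M" "Module.module R N" "linear_map R M N h"
    and "finite A" "\<And>i. i \<in> A \<Longrightarrow> g i \<in> carrier M"
  shows "h (\<Oplus>\<^bsub>M\<^esub>i\<in>A. g i) = (\<Oplus>\<^bsub>N\<^esub>i\<in>A. h (g i))"
proof -
  interpret M: Module.module R M by fact
  interpret N: Module.module R N by fact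
  show ?thesis using assms(4,5)
  proof (induction A)
    case empty
    then show ?case using linear_map_zero[OF assms(1-3)] by simp
  next
    case (insert i A)
    then show ?case
      using linear_map_add[OF assms(3), of "g i" "finsum M g A"] linear_map_closed[OF assms(3)]
      by (simp add: Pi_def)
  qed
qed

lemma linear_map_kernel:
  assumes "Module.module R M" "Module.module R N" "linear_map R M N h"
  shows "submodule {x \<in> carrier M. h x = \<zero>\<^bsub>N\<^esub>} R M"
proof -
  interpret M: Module.module R M by fact
  interpret N: Module.module R N by fact
  show ?thesis
    by (rule submodule_criterion)
      (use assms linear_map_zero[OF assms] in \<open>auto simp: linear_map_add linear_map_smult\<close>)
qed

lemma linear_map_image:
  assumes "Module.module R M" "Module.module R N" "linear_map R M N h" "submodule H R M"
  shows "submodule (h ` H) R N"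
proof (rule submodule_criterion[OF assms(2)])
  note H = submodule_subset[OF assms(4)]
  show "h ` H \<subseteq> carrier N" using linear_map_closed[OF assms(3)] H by auto
  show "\<zero>\<^bsub>N\<^esub> \<in> h ` H"
    using linear_map_zero[OF assms(1-3)] submodule_zero[OF assms(4)] by (metis imageI)
  show "x \<oplus>\<^bsub>N\<^esub> y \<in> h ` H" if xy: "x \<in> h ` H" "y \<in> h ` H" for x y
  proof -
    obtain u v where "u \<in> H" "v \<in> H" "x = h u" "y = h v" using xy by blast
    then have "x \<oplus>\<^bsub>N\<^esub> y = h (u \<oplus>\<^bsub>M\<^esub> v)" "u \<oplus>\<^bsub>M\<^esub> v \<in> H"
      by (simp_all add: linear_map_add[OF assms(3)] submodule_add[OF assms(4)] H)
    then show ?thesis by blast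
  qed
  show "a \<odot>\<^bsub>N\<^esub> x \<in> h ` H" if a: "a \<in> carrier R" and x: "x \<in> h ` H" for a x
  proof -
    obtain u where "u \<in> H" "x = h u" using x by blast
    with a have "a \<odot>\<^bsub>N\<^esub> x = h (a \<odot>\<^bsub>M\<^esub> u)" "a \<odot>\<^bsub>M\<^esub> u \<in> H"
      by (simp_all add: linear_map_smult[OF assms(3)] submodule_smult[OF assms(4)] H)
    then show ?thesis by blast
  qed
qed

lemma submodule_carrier: "Module.module R M \<Longrightarrow> submodule (carrier M) R M"
  by (rule Module.module.carrier_is_submodule)

text \<open>The module axioms pass to images because they only assert equations and inverses.
  Applied to the map taking a vector to its coset, this spares a verification of the axioms for
  operations on sets.\<close>

lemma module_transfer:
  assumes "Module.module R M" "linear_map R M N h" "h ` carrier M = carrier N"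
    and zero: "h \<zero>\<^bsub>M\<^esub> = \<zero>\<^bsub>N\<^esub>"
  shows "Module.module R N"
proof -
  interpret M: Module.module R M by fact
  note add = linear_map_add[OF assms(2), symmetric]
  note smult = linear_map_smult[OF assms(2), symmetric]
  have surj: "\<exists>x'\<in>carrier M. x = h x'" if "x \<in> carrier N" for x
    using that assms(3) by (metis imageE)
  have cl: "h x \<in> carrier N" if "x \<in> carrier M" for x
    using that linear_map_closed[OF assms(2)] by simp
  show ?thesis
  proof (rule moduleI)
    show "cring R" ..
    show "abelian_group N"
    proof (rule abelian_groupI)
      show "\<zero>\<^bsub>N\<^esub> \<in> carrier N" using cl[of "\<zero>\<^bsub>M\<^esub>"] zero by simp
    next
      fix x y assume "x \<in> carrier N" "y \<in> carrier N"
      then obtain x' y' where *: "x' \<in> carrier M" "y' \<in> carrier M" "x = h x'" "y = h y'"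
        using surj by metis
      then show "x \<oplus>\<^bsub>N\<^esub> y \<in> carrier N" "x \<oplus>\<^bsub>N\<^esub> y = y \<oplus>\<^bsub>N\<^esub> x"
        by (simp_all add: add cl M.a_comm)
      fix z assume "z \<in> carrier N"
      then obtain z' where "z' \<in> carrier M" "z = h z'" using surj by metis
      with * show "x \<oplus>\<^bsub>N\<^esub> y \<oplus>\<^bsub>N\<^esub> z = x \<oplus>\<^bsub>N\<^esub> (y \<oplus>\<^bsub>N\<^esub> z)"
        by (simp add: add M.a_assoc)
    next
      fix x assume "x \<in> carrier N"
      then obtain x' where *: "x' \<in> carrier M" "x = h x'" using surj by metis
      then show "\<zero>\<^bsub>N\<^esub> \<oplus>\<^bsub>N\<^esub> x = x" by (simp add: zero[symmetric] add)
      show "\<exists>y\<in>carrier N. y \<oplus>\<^bsub>N\<^esub> x = \<zero>\<^bsub>N\<^esub>"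
        using * by (intro bexI[of _ "h (\<ominus>\<^bsub>M\<^esub> x')"]) (simp_all add: zero[symmetric] add cl M.l_neg)
    qed
  next
    fix a x assume a: "a \<in> carrier R" and "x \<in> carrier N"
    then obtain x' where *: "x' \<in> carrier M" "x = h x'" using surj by metis
    with a show "a \<odot>\<^bsub>N\<^esub> x \<in> carrier N" by (simp add: smult cl)
    fix b assume "b \<in> carrier R"
    with a * show "(a \<oplus> b) \<odot>\<^bsub>N\<^esub> x = a \<odot>\<^bsub>N\<^esub> x \<oplus>\<^bsub>N\<^esub> b \<odot>\<^bsub>N\<^esub> x"
      and "(a \<otimes> b) \<odot>\<^bsub>N\<^esub> x = a \<odot>\<^bsub>N\<^esub> (b \<odot>\<^bsub>N\<^esub> x)"
      by (simp_all add: smult add M.smult_l_distr M.smult_assoc1)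
  next
    fix a x y assume a: "a \<in> carrier R" and "x \<in> carrier N" "y \<in> carrier N"
    then obtain x' y' where "x' \<in> carrier M" "y' \<in> carrier M" "x = h x'" "y = h y'"
      using surj by metis
    with a show "a \<odot>\<^bsub>N\<^esub> (x \<oplus>\<^bsub>N\<^esub> y) = a \<odot>\<^bsub>N\<^esub> x \<oplus>\<^bsub>N\<^esub> a \<odot>\<^bsub>N\<^esub> y"
      by (simp add: smult add M.smult_r_distr)
  next
    fix x assume "x \<in> carrier N"
    then obtain x' where "x' \<in> carrier M" "x = h x'" using surj by metis
    then show "\<one> \<odot>\<^bsub>N\<^esub> x = x" by (simp add: smult)
  qed
qed

lemma a_r_coset_restrict: "a_r_coset (M\<lparr>carrier := H\<rparr>) B x = a_r_coset M B x"
  by (auto simp: a_r_coset_def')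

lemma mem_coset_iff: "y \<in> B +>\<^bsub>M\<^esub> x \<longleftrightarrow> (\<exists>b\<in>B. y = b \<oplus>\<^bsub>M\<^esub> x)"
  by (auto simp: a_r_coset_def')

lemma coset_eq_iff:
  assumes "Module.module R M" "submodule B R M" "x \<in> carrier M" "y \<in> carrier M"
  shows "B +>\<^bsub>M\<^esub> x = B +>\<^bsub>M\<^esub> y \<longleftrightarrow> (\<exists>b\<in>B. x = b \<oplus>\<^bsub>M\<^esub> y)"
proof -
  interpret M: Module.module R M by fact
  have ab: "subgroup B (add_monoid M)" using assms(2) by (simp add: submodule_def)
  show ?thesis
  proof
    assume "B +>\<^bsub>M\<^esub> x = B +>\<^bsub>M\<^esub> y"
    moreover have "x \<in> B +>\<^bsub>M\<^esub> x"
      using M.a_rcosI[OF submodule_zero[OF assms(2)] _ assms(3)] assms(3) submodule_subset[OF assms(2)]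
      by auto
    ultimately show "\<exists>b\<in>B. x = b \<oplus>\<^bsub>M\<^esub> y" by (auto simp: a_r_coset_def')
  next
    assume "\<exists>b\<in>B. x = b \<oplus>\<^bsub>M\<^esub> y"
    then have "x \<in> B +>\<^bsub>M\<^esub> y" by (auto simp: a_r_coset_def')
    from M.a_repr_independence[OF this assms(4) ab] show "B +>\<^bsub>M\<^esub> x = B +>\<^bsub>M\<^esub> y" by simp
  qed
qed

lemma coset_zero_iff:
  assumes "Module.module R M" "submodule B R M" "x \<in> carrier M"
  shows "B +>\<^bsub>M\<^esub> x = B \<longleftrightarrow> x \<in> B"
proof -
  interpret M: Module.module R M by fact
  have "B +>\<^bsub>M\<^esub> \<zero>\<^bsub>M\<^esub> = B"
    by (intro M.a_coset_add_zero subsetI) (rule submodule_subset[OF assms(2)])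
  with coset_eq_iff[OF assms(1-3) M.zero_closed] submodule_subset[OF assms(2)] show ?thesis
    by auto
qed

lemma mem_coset:
  assumes "Module.module R M" "submodule B R M" "x \<in> carrier M"
  shows "x \<in> B +>\<^bsub>M\<^esub> x"
proof -
  interpret M: Module.module R M by fact
  show ?thesis
    using M.a_rcosI[OF submodule_zero[OF assms(2)] _ assms(3)] assms(3) submodule_subset[OF assms(2)]
    by auto
qed

lemma carrier_quotient_space:
  "carrier (quotient_space M B) = (\<lambda>x. B +>\<^bsub>M\<^esub> x) ` carrier M"
  by (auto simp: quotient_space_def A_RCOSETS_def')

lemma zero_quotient_space: "\<zero>\<^bsub>quotient_space M B\<^esub> = B"
  by (simp add: quotient_space_def)

lemma linear_map_coset:
  assumes "Module.module R M" "submodule B R M"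
  shows "linear_map R M (quotient_space M B) (\<lambda>x. B +>\<^bsub>M\<^esub> x)"
proof -
  interpret M: Module.module R M by fact
  have B: "abelian_subgroup B M"
    by (intro abelian_subgroupI3 additive_subgroupI M.abelian_group_axioms
      submodule.axioms(1)[OF assms(2)])
  show ?thesis
  proof (rule linear_mapI)
    fix x y assume "x \<in> carrier M" "y \<in> carrier M"
    then show "B +>\<^bsub>M\<^esub> (x \<oplus>\<^bsub>M\<^esub> y) = (B +>\<^bsub>M\<^esub> x) \<oplus>\<^bsub>quotient_space M B\<^esub> (B +>\<^bsub>M\<^esub> y)"
      by (simp add: quotient_space_def abelian_subgroup.a_rcos_sum[OF B])
  next
    fix a x assume a: "a \<in> carrier R" and x: "x \<in> carrier M"
    have "B +>\<^bsub>M\<^esub> (a \<odot>\<^bsub>M\<^esub> y) = B +>\<^bsub>M\<^esub> (a \<odot>\<^bsub>M\<^esub> x)" if y: "y \<in> B +>\<^bsub>M\<^esub> x" for y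
    proof -
      obtain b where b: "b \<in> B" "y = b \<oplus>\<^bsub>M\<^esub> x" using y unfolding mem_coset_iff by blast
      then have bc: "b \<in> carrier M" using submodule_subset[OF assms(2)] by blast
      have "a \<odot>\<^bsub>M\<^esub> y = a \<odot>\<^bsub>M\<^esub> b \<oplus>\<^bsub>M\<^esub> a \<odot>\<^bsub>M\<^esub> x"
        unfolding b(2) by (rule M.smult_r_distr[OF a bc x])
      moreover have "a \<odot>\<^bsub>M\<^esub> b \<in> B" using submodule_smult[OF assms(2) a b(1)] .
      moreover have "y \<in> carrier M" unfolding b(2) by (rule M.a_closed[OF bc x])
      ultimately show ?thesis
        unfolding coset_eq_iff[OF assms M.smult_closed[OF a \<open>y \<in> carrier M\<close>] M.smult_closed[OF a x]]
        by blast
    qed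
    then have "(\<Union>y\<in>B +>\<^bsub>M\<^esub> x. B +>\<^bsub>M\<^esub> (a \<odot>\<^bsub>M\<^esub> y)) = B +>\<^bsub>M\<^esub> (a \<odot>\<^bsub>M\<^esub> x)"
      using mem_coset[OF assms x] by (intro SUP_eq_const) blast+
    then show "B +>\<^bsub>M\<^esub> (a \<odot>\<^bsub>M\<^esub> x) = a \<odot>\<^bsub>quotient_space M B\<^esub> (B +>\<^bsub>M\<^esub> x)"
      by (simp add: quotient_space_def)
  qed (simp add: carrier_quotient_space)
qed

lemma module_quotient_space:
  assumes "Module.module R M" "submodule B R M"
  shows "Module.module R (quotient_space M B)"
proof (rule module_transfer[OF assms(1) linear_map_coset[OF assms]])
  interpret M: Module.module R M by fact
  show "B +>\<^bsub>M\<^esub> \<zero>\<^bsub>M\<^esub> = \<zero>\<^bsub>quotient_space M B\<^esub>"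
    using coset_zero_iff[OF assms M.zero_closed] submodule_zero[OF assms(2)]
    by (simp add: zero_quotient_space)
qed (simp add: carrier_quotient_space)

lemma first_isomorphism:
  assumes M: "Module.module R M" and N: "Module.module R N" and B: "submodule B R M"
    and h: "linear_map R M N h" "h ` carrier M = carrier N"
    and ker: "\<And>x. x \<in> carrier M \<Longrightarrow> h x = \<zero>\<^bsub>N\<^esub> \<longleftrightarrow> x \<in> B"
  shows "vs_iso R (quotient_space M B) N"
proof -
  interpret M: Module.module R M by fact
  interpret N: Module.module R N by fact
  \<comment> \<open>The isomorphism evaluates the linear map at a chosen representative; by the
    kernel condition the choice does not matter.\<close>
  define g where "g A = h (SOME x. x \<in> carrier M \<and> A = B +>\<^bsub>M\<^esub> x)" for A
  have eq: "h x = h y \<longleftrightarrow> B +>\<^bsub>M\<^esub> x = B +>\<^bsub>M\<^esub> y" if "x \<in> carrier M" "y \<in> carrier M" for x y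
  proof -
    have "h x = h y \<longleftrightarrow> h (x \<ominus>\<^bsub>M\<^esub> y) = \<zero>\<^bsub>N\<^esub>"
      using that linear_map_add[OF h(1)] linear_map_minus[OF M N h(1)] linear_map_closed[OF h(1)]
      by (simp add: M.minus_eq N.add_minus_eq_zero_iff)
    also have "\<dots> \<longleftrightarrow> x \<ominus>\<^bsub>M\<^esub> y \<in> B" using that by (simp add: ker)
    also have "\<dots> \<longleftrightarrow> (\<exists>b\<in>B. x = b \<oplus>\<^bsub>M\<^esub> y)"
    proof
      assume "x \<ominus>\<^bsub>M\<^esub> y \<in> B"
      then show "\<exists>b\<in>B. x = b \<oplus>\<^bsub>M\<^esub> y"
        using that by (intro bexI[of _ "x \<ominus>\<^bsub>M\<^esub> y"]) (simp add: M.minus_eq M.a_assoc M.l_neg)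
    next
      assume "\<exists>b\<in>B. x = b \<oplus>\<^bsub>M\<^esub> y"
      then show "x \<ominus>\<^bsub>M\<^esub> y \<in> B"
        using that submodule_subset[OF B] by (auto simp: M.minus_eq M.a_assoc M.r_neg)
    qed
    finally show ?thesis using coset_eq_iff[OF M B that] by simp
  qed
  have g: "g (B +>\<^bsub>M\<^esub> x) = h x" if "x \<in> carrier M" for x
  proof -
    have "(SOME y. y \<in> carrier M \<and> B +>\<^bsub>M\<^esub> x = B +>\<^bsub>M\<^esub> y) \<in> carrier M \<and>
      B +>\<^bsub>M\<^esub> x = B +>\<^bsub>M\<^esub> (SOME y. y \<in> carrier M \<and> B +>\<^bsub>M\<^esub> x = B +>\<^bsub>M\<^esub> y)"
      by (rule someI[of _ x]) (use that in simp)
    then show ?thesis unfolding g_def using eq that by metis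
  qed
  note c = linear_map_coset[OF M B]
  show ?thesis
    unfolding vs_iso_def
  proof (intro exI[of _ g] conjI ballI)
    show "bij_betw g (carrier (quotient_space M B)) (carrier N)"
      unfolding bij_betw_def
    proof
      show "inj_on g (carrier (quotient_space M B))"
        by (auto simp: inj_on_def carrier_quotient_space g eq)
      show "g ` carrier (quotient_space M B) = carrier N"
        unfolding carrier_quotient_space image_image using h(2) g by auto
    qed
  next
    fix A A' assume "A \<in> carrier (quotient_space M B)" "A' \<in> carrier (quotient_space M B)"
    then obtain x y where *: "x \<in> carrier M" "y \<in> carrier M" "A = B +>\<^bsub>M\<^esub> x" "A' = B +>\<^bsub>M\<^esub> y"
      by (auto simp: carrier_quotient_space)
    then show "g (A \<oplus>\<^bsub>quotient_space M B\<^esub> A') = g A \<oplus>\<^bsub>N\<^esub> g A'"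
      by (simp add: linear_map_add[OF c, symmetric] g linear_map_add[OF h(1)])
  next
    fix a A assume "a \<in> carrier R" "A \<in> carrier (quotient_space M B)"
    then obtain x where "a \<in> carrier R" "x \<in> carrier M" "A = B +>\<^bsub>M\<^esub> x"
      by (auto simp: carrier_quotient_space)
    then show "g (a \<odot>\<^bsub>quotient_space M B\<^esub> A) = a \<odot>\<^bsub>N\<^esub> g A"
      by (simp add: linear_map_smult[OF c, symmetric] g linear_map_smult[OF h(1)])
  qed
qed

lemma direct_sum_simps:
  "\<zero>\<^bsub>direct_sum I M\<^esub> = (\<lambda>i\<in>I. \<zero>\<^bsub>M i\<^esub>)"
  "x \<oplus>\<^bsub>direct_sum I M\<^esub> y = (\<lambda>i\<in>I. x i \<oplus>\<^bsub>M i\<^esub> y i)"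
  "a \<odot>\<^bsub>direct_sum I M\<^esub> x = (\<lambda>i\<in>I. a \<odot>\<^bsub>M i\<^esub> x i)"
  by (simp_all add: direct_sum_def)

lemma direct_sumD:
  assumes "x \<in> carrier (direct_sum I M)"
  shows "x \<in> extensional I" "\<And>i. i \<in> I \<Longrightarrow> x i \<in> carrier (M i)" "finite {i \<in> I. x i \<noteq> \<zero>\<^bsub>M i\<^esub>}"
  using assms by (auto simp: direct_sum_def PiE_iff)

lemma direct_sumI:
  assumes "finite A" "\<And>i. i \<in> I \<Longrightarrow> x i \<in> carrier (M i)" "x \<in> extensional I"
    and "\<And>i. i \<in> I \<Longrightarrow> i \<notin> A \<Longrightarrow> x i = \<zero>\<^bsub>M i\<^esub>"
  shows "x \<in> carrier (direct_sum I M)"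
proof -
  have "finite {i \<in> I. x i \<noteq> \<zero>\<^bsub>M i\<^esub>}"
    by (rule finite_subset[OF _ assms(1)]) (use assms(4) in blast)
  then show ?thesis using assms(2,3) by (simp add: direct_sum_def PiE_iff)
qed

lemma direct_sum_eqI:
  assumes "x \<in> extensional I" "y \<in> extensional I" "\<And>i. i \<in> I \<Longrightarrow> x i = y i"
  shows "x = y"
  by (rule extensionalityI[OF assms(1,2)]) (rule assms(3))

lemma module_direct_sum:
  assumes M: "\<And>i. i \<in> I \<Longrightarrow> Module.module R (M i)"
  shows "Module.module R (direct_sum I M)"
proof -
  have ab: "abelian_group (M i)" if "i \<in> I" for i
    using M[OF that] by (rule Module.module.axioms)
  have mo: "abelian_monoid (M i)" if "i \<in> I" for i
    using ab[OF that] by (rule abelian_group.axioms)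
  note mm = abelian_monoid.zero_closed[OF mo] abelian_monoid.a_closed[OF mo]
    abelian_monoid.l_zero[OF mo] abelian_monoid.r_zero[OF mo] abelian_monoid.a_assoc[OF mo]
    abelian_group.l_neg[OF ab] abelian_group.a_inv_closed[OF ab]
  note md = Module.module.smult_closed[OF M] Module.module.smult_l_distr[OF M]
    Module.module.smult_r_distr[OF M] Module.module.smult_assoc1[OF M]
    Module.module.smult_one[OF M] Module.module.smult_r_null[OF M]
  note [simp] = direct_sum_simps
  note D = direct_sumD
  show ?thesis
  proof (rule moduleI)
    show "cring R" ..
    show "abelian_group (direct_sum I M)"
    proof (rule abelian_groupI)
      fix x y assume x: "x \<in> carrier (direct_sum I M)" and y: "y \<in> carrier (direct_sum I M)"
      show "x \<oplus>\<^bsub>direct_sum I M\<^esub> y \<in> carrier (direct_sum I M)"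
        by (rule direct_sumI[where I = I and A = "{i \<in> I. x i \<noteq> \<zero>\<^bsub>M i\<^esub>} \<union> {i \<in> I. y i \<noteq> \<zero>\<^bsub>M i\<^esub>}"])
          (use D[OF x] D[OF y] mm in simp_all)
      show "x \<oplus>\<^bsub>direct_sum I M\<^esub> y = y \<oplus>\<^bsub>direct_sum I M\<^esub> x"
        by (rule direct_sum_eqI[where I = I]) (use D[OF x] D[OF y] abelian_monoid.a_comm[OF mo] in simp_all)
      fix w assume w: "w \<in> carrier (direct_sum I M)"
      show "x \<oplus>\<^bsub>direct_sum I M\<^esub> y \<oplus>\<^bsub>direct_sum I M\<^esub> w =
          x \<oplus>\<^bsub>direct_sum I M\<^esub> (y \<oplus>\<^bsub>direct_sum I M\<^esub> w)"
        by (rule direct_sum_eqI[where I = I]) (use D[OF x] D[OF y] D[OF w] mm in simp_all)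
    next
      show "\<zero>\<^bsub>direct_sum I M\<^esub> \<in> carrier (direct_sum I M)"
        by (rule direct_sumI[where I = I and A = "{}"]) (use mm in simp_all)
    next
      fix x assume x: "x \<in> carrier (direct_sum I M)"
      show "\<zero>\<^bsub>direct_sum I M\<^esub> \<oplus>\<^bsub>direct_sum I M\<^esub> x = x"
        by (rule direct_sum_eqI[where I = I]) (use D[OF x] mm in simp_all)
      let ?y = "\<lambda>i\<in>I. \<ominus>\<^bsub>M i\<^esub> x i"
      have "\<ominus>\<^bsub>M i\<^esub> \<zero>\<^bsub>M i\<^esub> = \<zero>\<^bsub>M i\<^esub>" if "i \<in> I" for i
        using mm(6)[OF that mm(1)[OF that]] mm(4)[OF that mm(7)[OF that mm(1)[OF that]]] by simp
      then have "?y \<in> carrier (direct_sum I M)"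
        by (intro direct_sumI[where I = I and A = "{i \<in> I. x i \<noteq> \<zero>\<^bsub>M i\<^esub>}"]) (use D[OF x] mm in simp_all)
      moreover have "?y \<oplus>\<^bsub>direct_sum I M\<^esub> x = \<zero>\<^bsub>direct_sum I M\<^esub>"
        by (rule direct_sum_eqI[where I = I]) (use D[OF x] mm in simp_all)
      ultimately show "\<exists>y\<in>carrier (direct_sum I M).
          y \<oplus>\<^bsub>direct_sum I M\<^esub> x = \<zero>\<^bsub>direct_sum I M\<^esub>" by blast
    qed
  next
    fix a x assume a: "a \<in> carrier R" and x: "x \<in> carrier (direct_sum I M)"
    show "a \<odot>\<^bsub>direct_sum I M\<^esub> x \<in> carrier (direct_sum I M)"
      by (rule direct_sumI[where I = I and A = "{i \<in> I. x i \<noteq> \<zero>\<^bsub>M i\<^esub>}"]) (use D[OF x] a md in simp_all)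
    fix b assume b: "b \<in> carrier R"
    show "(a \<oplus> b) \<odot>\<^bsub>direct_sum I M\<^esub> x =
        a \<odot>\<^bsub>direct_sum I M\<^esub> x \<oplus>\<^bsub>direct_sum I M\<^esub> b \<odot>\<^bsub>direct_sum I M\<^esub> x"
      by (rule direct_sum_eqI[where I = I]) (use D[OF x] a b md in simp_all)
    show "(a \<otimes> b) \<odot>\<^bsub>direct_sum I M\<^esub> x = a \<odot>\<^bsub>direct_sum I M\<^esub> (b \<odot>\<^bsub>direct_sum I M\<^esub> x)"
      by (rule direct_sum_eqI[where I = I]) (use D[OF x] a b md in simp_all)
  next
    fix a x y
    assume a: "a \<in> carrier R" and x: "x \<in> carrier (direct_sum I M)"
      and y: "y \<in> carrier (direct_sum I M)"
    show "a \<odot>\<^bsub>direct_sum I M\<^esub> (x \<oplus>\<^bsub>direct_sum I M\<^esub> y) =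
        a \<odot>\<^bsub>direct_sum I M\<^esub> x \<oplus>\<^bsub>direct_sum I M\<^esub> a \<odot>\<^bsub>direct_sum I M\<^esub> y"
      by (rule direct_sum_eqI[where I = I]) (use D[OF x] D[OF y] a md in simp_all)
  next
    fix x assume x: "x \<in> carrier (direct_sum I M)"
    show "\<one> \<odot>\<^bsub>direct_sum I M\<^esub> x = x"
      by (rule direct_sum_eqI[where I = I]) (use D[OF x] md in simp_all)
  qed
qed

end

section \<open>Splitting over a field\<close>

context field
begin

text \<open>Zorn's lemma gives a largest subspace \<open>W\<close> that contains \<open>B\<close>
  and meets \<open>Z\<close> only inside \<open>B\<close>. If a vector \<open>x\<close> is not in
  \<open>W\<close>, then by maximality some \<open>y \<in> Z\<close> outside \<open>B\<close> has
  the form \<open>a x + w\<close>. Here \<open>a\<close> is not zero, and dividing by it exhibits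
  \<open>x\<close> as an element of \<open>Z + W\<close>. This division is the point where
  coefficients in a field matter.\<close>

lemma submodule_complement_over:
  assumes M: "Module.module R M" and Z: "submodule Z R M" and B: "submodule B R M"
  obtains W where "submodule W R M" "B \<subseteq> W" "Z \<inter> W \<subseteq> B"
    "\<And>x. x \<in> carrier M \<Longrightarrow> \<exists>z\<in>Z. \<exists>w\<in>W. x = z \<oplus>\<^bsub>M\<^esub> w"
proof -
  interpret M: Module.module R M by fact
  let ?A = "{W. submodule W R M \<and> B \<subseteq> W \<and> Z \<inter> W \<subseteq> B}"
  have "\<exists>W\<in>?A. \<forall>X\<in>?A. W \<subseteq> X \<longrightarrow> X = W"
  proof (rule subset_Zorn_nonempty)
    show "?A \<noteq> {}" using B by blast
    fix C assume C: "C \<noteq> {}" "subset.chain ?A C"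
    then have mem: "submodule W R M" "B \<subseteq> W" "Z \<inter> W \<subseteq> B" if "W \<in> C" for W
      using that C(2) unfolding subset_chain_def by blast+
    have comp: "W \<subseteq> W' \<or> W' \<subseteq> W" if "W \<in> C" "W' \<in> C" for W W'
      using C(2) that unfolding subset_chain_def by blast
    have "submodule (\<Union>C) R M"
    proof (rule submodule_criterion[OF M])
      show "\<Union>C \<subseteq> carrier M" using submodule_subset[OF mem(1)] by blast
      show "\<zero>\<^bsub>M\<^esub> \<in> \<Union>C" using C(1) submodule_zero[OF mem(1)] by blast
      show "x \<oplus>\<^bsub>M\<^esub> y \<in> \<Union>C" if xy: "x \<in> \<Union>C" "y \<in> \<Union>C" for x y
      proof -
        obtain W W' where "W \<in> C" "x \<in> W" "W' \<in> C" "y \<in> W'" using xy by blast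
        with comp[of W W'] obtain W'' where "W'' \<in> C" "x \<in> W''" "y \<in> W''" by blast
        then show ?thesis using submodule_add[OF mem(1)[OF \<open>W'' \<in> C\<close>]] by blast
      qed
      show "a \<odot>\<^bsub>M\<^esub> x \<in> \<Union>C" if a: "a \<in> carrier R" and x: "x \<in> \<Union>C" for a x
      proof -
        obtain W where "W \<in> C" "x \<in> W" using x by blast
        then show ?thesis using submodule_smult[OF mem(1) a] by blast
      qed
    qed
    moreover have "B \<subseteq> \<Union>C" "Z \<inter> \<Union>C \<subseteq> B" using C(1) mem(2,3) by blast+
    ultimately show "\<Union>C \<in> ?A" by blast
  qed
  then obtain W where "W \<in> ?A" and maxA: "\<forall>X\<in>?A. W \<subseteq> X \<longrightarrow> X = W" by (rule bexE)
  then have W: "submodule W R M" "B \<subseteq> W" "Z \<inter> W \<subseteq> B" by simp_all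
  have max: "X = W" if "submodule X R M" "B \<subseteq> X" "Z \<inter> X \<subseteq> B" "W \<subseteq> X" for X
    using bspec[OF maxA, of X] that by simp
  note Wc = submodule_subset[OF W(1)] and Zc = submodule_subset[OF Z]
  have "\<exists>z\<in>Z. \<exists>w\<in>W. x = z \<oplus>\<^bsub>M\<^esub> w" if x: "x \<in> carrier M" for x
  proof (cases "x \<in> W")
    case True
    then show ?thesis using submodule_zero[OF Z] x by (intro bexI[of _ "\<zero>\<^bsub>M\<^esub>"] bexI[of _ x]) auto
  next
    case False
    define X where "X = {a \<odot>\<^bsub>M\<^esub> x \<oplus>\<^bsub>M\<^esub> w | a w. a \<in> carrier R \<and> w \<in> W}"
    have XI: "a \<odot>\<^bsub>M\<^esub> x \<oplus>\<^bsub>M\<^esub> w \<in> X" if "a \<in> carrier R" "w \<in> W" for a w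
      using that by (auto simp: X_def)
    have XE: "\<exists>a w. a \<in> carrier R \<and> w \<in> W \<and> y = a \<odot>\<^bsub>M\<^esub> x \<oplus>\<^bsub>M\<^esub> w" if "y \<in> X" for y
      using that by (auto simp: X_def)
    have "submodule X R M"
    proof (rule submodule_criterion[OF M])
      show "X \<subseteq> carrier M" using x Wc by (auto simp: X_def)
      show "\<zero>\<^bsub>M\<^esub> \<in> X" using XI[of \<zero> "\<zero>\<^bsub>M\<^esub>"] submodule_zero[OF W(1)] x by simp
      show "y \<oplus>\<^bsub>M\<^esub> y' \<in> X" if y: "y \<in> X" "y' \<in> X" for y y'
      proof -
        obtain a w where 1: "a \<in> carrier R" "w \<in> W" "y = a \<odot>\<^bsub>M\<^esub> x \<oplus>\<^bsub>M\<^esub> w" using XE[OF y(1)] by blast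
        obtain a' w' where 2: "a' \<in> carrier R" "w' \<in> W" "y' = a' \<odot>\<^bsub>M\<^esub> x \<oplus>\<^bsub>M\<^esub> w'"
          using XE[OF y(2)] by blast
        have "y \<oplus>\<^bsub>M\<^esub> y' = (a \<oplus> a') \<odot>\<^bsub>M\<^esub> x \<oplus>\<^bsub>M\<^esub> (w \<oplus>\<^bsub>M\<^esub> w')"
          using 1 2 x Wc by (simp add: M.smult_l_distr M.a_ac)
        then show ?thesis using XI[of "a \<oplus> a'" "w \<oplus>\<^bsub>M\<^esub> w'"] 1 2 submodule_add[OF W(1)] by simp
      qed
      show "b \<odot>\<^bsub>M\<^esub> y \<in> X" if b: "b \<in> carrier R" and y: "y \<in> X" for b y
      proof -
        obtain a w where 1: "a \<in> carrier R" "w \<in> W" "y = a \<odot>\<^bsub>M\<^esub> x \<oplus>\<^bsub>M\<^esub> w" using XE[OF y] by blast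
        have "b \<odot>\<^bsub>M\<^esub> y = (b \<otimes> a) \<odot>\<^bsub>M\<^esub> x \<oplus>\<^bsub>M\<^esub> b \<odot>\<^bsub>M\<^esub> w"
          using 1 b x Wc by (simp add: M.smult_r_distr M.smult_assoc1)
        then show ?thesis using XI[of "b \<otimes> a" "b \<odot>\<^bsub>M\<^esub> w"] 1 b submodule_smult[OF W(1)] by simp
      qed
    qed
    moreover have WX: "W \<subseteq> X"
    proof
      fix w assume "w \<in> W"
      then show "w \<in> X" using XI[of \<zero> w] x Wc by simp
    qed
    moreover have "x \<in> X" using XI[of \<one> "\<zero>\<^bsub>M\<^esub>"] submodule_zero[OF W(1)] x by simp
    ultimately have "\<not> Z \<inter> X \<subseteq> B" using max[of X] W(2) False by blast
    then obtain y where y: "y \<in> Z" "y \<in> X" "y \<notin> B" by blast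
    obtain a w where *: "a \<in> carrier R" "w \<in> W" "y = a \<odot>\<^bsub>M\<^esub> x \<oplus>\<^bsub>M\<^esub> w" using XE[OF y(2)] by blast
    have "a \<noteq> \<zero>"
    proof
      assume "a = \<zero>"
      then have "y = w" using * x Wc by simp
      then show False using * y W(3) by blast
    qed
    then have a: "inv a \<in> carrier R" "inv a \<otimes> a = \<one>"
      using * by (simp_all add: field_Units)
    have "a \<odot>\<^bsub>M\<^esub> x = y \<oplus>\<^bsub>M\<^esub> \<ominus>\<^bsub>M\<^esub> w"
      using * x Wc[of w] by (simp add: M.a_assoc M.r_neg)
    then have "inv a \<odot>\<^bsub>M\<^esub> (a \<odot>\<^bsub>M\<^esub> x) = inv a \<odot>\<^bsub>M\<^esub> y \<oplus>\<^bsub>M\<^esub> inv a \<odot>\<^bsub>M\<^esub> (\<ominus>\<^bsub>M\<^esub> w)"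
      using M.smult_r_distr[OF a(1) Zc[OF y(1)] M.a_inv_closed[OF Wc[OF *(2)]]] by simp
    moreover have "inv a \<odot>\<^bsub>M\<^esub> (a \<odot>\<^bsub>M\<^esub> x) = x"
      using a x *(1) by (simp add: M.smult_assoc1[symmetric])
    moreover have "inv a \<odot>\<^bsub>M\<^esub> y \<in> Z" "inv a \<odot>\<^bsub>M\<^esub> (\<ominus>\<^bsub>M\<^esub> w) \<in> W"
      using a(1) y(1) *(2) by (simp_all add: submodule_smult[OF Z] submodule_smult[OF W(1)]
          submodule_minus[OF M W(1)])
    ultimately show ?thesis by metis
  qed
  with W that show thesis by blast
qed

text \<open>The extension sends \<open>z + w\<close> to \<open>\<alpha> z\<close>, where
  \<open>w\<close> runs over a complement of \<open>Z\<close> as in the preceding lemma. Two such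
  decompositions of a vector differ by an element of \<open>Z \<inter> W \<subseteq> B\<close>, on
  which \<open>\<alpha>\<close> vanishes.\<close>

lemma extend_linear_map_vanishing:
  assumes M: "Module.module R M" and P: "Module.module R P"
    and Z: "submodule Z R M" and B: "submodule B R M"
    and \<alpha>: "linear_map R (M\<lparr>carrier := Z\<rparr>) P \<alpha>"
    and vanish: "\<And>z. z \<in> Z \<Longrightarrow> z \<in> B \<Longrightarrow> \<alpha> z = \<zero>\<^bsub>P\<^esub>"
  obtains \<gamma> where "linear_map R M P \<gamma>" "\<And>z. z \<in> Z \<Longrightarrow> \<gamma> z = \<alpha> z" "\<And>b. b \<in> B \<Longrightarrow> \<gamma> b = \<zero>\<^bsub>P\<^esub>"
proof -
  interpret M: Module.module R M by fact
  interpret P: Module.module R P by fact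
  obtain W where W: "submodule W R M" "B \<subseteq> W" "Z \<inter> W \<subseteq> B"
    and split: "\<And>x. x \<in> carrier M \<Longrightarrow> \<exists>z\<in>Z. \<exists>w\<in>W. x = z \<oplus>\<^bsub>M\<^esub> w"
    using submodule_complement_over[OF M Z B] by metis
  note Wc = submodule_subset[OF W(1)] and Zc = submodule_subset[OF Z]
  note MZ = submodule_module[OF M Z]
  note \<alpha>_add = linear_map_add[OF \<alpha>, simplified]
    and \<alpha>_smult = linear_map_smult[OF \<alpha>, simplified]
    and \<alpha>_closed = linear_map_closed[OF \<alpha>, simplified]
    and \<alpha>_zero = linear_map_zero[OF MZ P \<alpha>, simplified]
  have \<alpha>_minus: "\<alpha> (\<ominus>\<^bsub>M\<^esub> z) = \<ominus>\<^bsub>P\<^esub> \<alpha> z" if "z \<in> Z" for z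
    using \<alpha>_smult[of "\<ominus> \<one>" z] that Zc[OF that] \<alpha>_closed[OF that]
    by (simp add: minus_one_smult[OF M] minus_one_smult[OF P])
  define \<gamma> where "\<gamma> x = \<alpha> (SOME z. z \<in> Z \<and> (\<exists>w\<in>W. x = z \<oplus>\<^bsub>M\<^esub> w))" for x
  have \<gamma>: "\<gamma> (z \<oplus>\<^bsub>M\<^esub> w) = \<alpha> z" if z: "z \<in> Z" and w: "w \<in> W" for z w
  proof -
    let ?P = "\<lambda>y. y \<in> Z \<and> (\<exists>w'\<in>W. z \<oplus>\<^bsub>M\<^esub> w = y \<oplus>\<^bsub>M\<^esub> w')"
    define y where "y = (SOME y. ?P y)"
    have "?P y" unfolding y_def by (rule someI[of ?P z]) (use z w in blast)
    then obtain w' where y: "y \<in> Z" "w' \<in> W" "z \<oplus>\<^bsub>M\<^esub> w = y \<oplus>\<^bsub>M\<^esub> w'" by blast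
    note c = Zc[OF z] Zc[OF y(1)] Wc[OF w] Wc[OF y(2)]
    have "w' \<oplus>\<^bsub>M\<^esub> \<ominus>\<^bsub>M\<^esub> w = (\<ominus>\<^bsub>M\<^esub> y \<oplus>\<^bsub>M\<^esub> (y \<oplus>\<^bsub>M\<^esub> w')) \<oplus>\<^bsub>M\<^esub> \<ominus>\<^bsub>M\<^esub> w"
      using c by (simp add: M.r_neg1)
    also have "\<dots> = \<ominus>\<^bsub>M\<^esub> y \<oplus>\<^bsub>M\<^esub> (z \<oplus>\<^bsub>M\<^esub> (w \<oplus>\<^bsub>M\<^esub> \<ominus>\<^bsub>M\<^esub> w))"
      unfolding y(3)[symmetric] using c by (simp add: M.a_assoc)
    also have "\<dots> = z \<oplus>\<^bsub>M\<^esub> \<ominus>\<^bsub>M\<^esub> y" using c by (simp add: M.r_neg M.a_comm)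
    finally have e: "z \<oplus>\<^bsub>M\<^esub> \<ominus>\<^bsub>M\<^esub> y = w' \<oplus>\<^bsub>M\<^esub> \<ominus>\<^bsub>M\<^esub> w" by (rule sym)
    have zy: "z \<oplus>\<^bsub>M\<^esub> \<ominus>\<^bsub>M\<^esub> y \<in> Z"
      using z y(1) by (simp add: submodule_add[OF Z] submodule_minus[OF M Z])
    moreover have "z \<oplus>\<^bsub>M\<^esub> \<ominus>\<^bsub>M\<^esub> y \<in> W"
      unfolding e using w y(2) by (simp add: submodule_add[OF W(1)] submodule_minus[OF M W(1)])
    ultimately have "\<alpha> (z \<oplus>\<^bsub>M\<^esub> \<ominus>\<^bsub>M\<^esub> y) = \<zero>\<^bsub>P\<^esub>" using W(3) vanish by blast
    then have "\<alpha> z \<oplus>\<^bsub>P\<^esub> \<ominus>\<^bsub>P\<^esub> \<alpha> y = \<zero>\<^bsub>P\<^esub>"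
      using z y(1) by (simp add: \<alpha>_add \<alpha>_minus submodule_minus[OF M Z])
    then have "\<alpha> z = \<alpha> y" using \<alpha>_closed[OF z] \<alpha>_closed[OF y(1)] by (simp add: P.add_minus_eq_zero_iff)
    then show ?thesis by (simp add: \<gamma>_def y_def)
  qed
  show thesis
  proof
    show "linear_map R M P \<gamma>"
    proof (rule linear_mapI)
      fix x assume "x \<in> carrier M"
      then obtain z w where x: "z \<in> Z" "w \<in> W" "x = z \<oplus>\<^bsub>M\<^esub> w" using split by blast
      then show "\<gamma> x \<in> carrier P" by (simp add: \<gamma> \<alpha>_closed)
      fix y assume "y \<in> carrier M"
      then obtain z' w' where y: "z' \<in> Z" "w' \<in> W" "y = z' \<oplus>\<^bsub>M\<^esub> w'" using split by blast
      have "x \<oplus>\<^bsub>M\<^esub> y = (z \<oplus>\<^bsub>M\<^esub> z') \<oplus>\<^bsub>M\<^esub> (w \<oplus>\<^bsub>M\<^esub> w')"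
        using x y Zc Wc by (simp add: M.a_ac)
      then show "\<gamma> (x \<oplus>\<^bsub>M\<^esub> y) = \<gamma> x \<oplus>\<^bsub>P\<^esub> \<gamma> y"
        using x y by (simp add: \<gamma> \<alpha>_add submodule_add[OF Z] submodule_add[OF W(1)])
    next
      fix a x assume a: "a \<in> carrier R" and "x \<in> carrier M"
      then obtain z w where x: "z \<in> Z" "w \<in> W" "x = z \<oplus>\<^bsub>M\<^esub> w" using split by blast
      then have "a \<odot>\<^bsub>M\<^esub> x = a \<odot>\<^bsub>M\<^esub> z \<oplus>\<^bsub>M\<^esub> a \<odot>\<^bsub>M\<^esub> w"
        using a Zc Wc by (simp add: M.smult_r_distr)
      then show "\<gamma> (a \<odot>\<^bsub>M\<^esub> x) = a \<odot>\<^bsub>P\<^esub> \<gamma> x"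
        using x a by (simp add: \<gamma> \<alpha>_smult submodule_smult[OF Z] submodule_smult[OF W(1)])
    qed
    show "\<gamma> z = \<alpha> z" if "z \<in> Z" for z
      using \<gamma>[OF that submodule_zero[OF W(1)]] Zc[OF that] by simp
    show "\<gamma> b = \<zero>\<^bsub>P\<^esub>" if "b \<in> B" for b
    proof -
      have "b \<in> W" "b \<in> carrier M" using that W(2) Wc by blast+
      then show ?thesis using \<gamma>[OF submodule_zero[OF Z], of b] \<alpha>_zero by simp
    qed
  qed
qed

text \<open>The hypotheses describe a short exact sequence from \<open>P\<close> through
  \<open>V/B\<close> to \<open>Q\<close>: the map \<open>\<alpha>\<close> identifies the image of
  \<open>Z\<close> in \<open>V/B\<close> with \<open>P\<close>, and this image is the kernel of
  the map induced by \<open>\<beta>\<close>. An extension \<open>\<gamma>\<close> of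
  \<open>\<alpha>\<close> that vanishes on \<open>B\<close> is a retraction onto \<open>P\<close>,
  so \<open>\<gamma>\<close> and \<open>\<beta>\<close> together identify \<open>V/B\<close> with
  the sum of \<open>P\<close> and \<open>Q\<close>.\<close>

lemma split_quotient:
  assumes V: "Module.module R V" and P: "Module.module R P" and Q: "Module.module R Q"
    and Z: "submodule Z R V" and B: "submodule B R V"
    and \<alpha>: "linear_map R (V\<lparr>carrier := Z\<rparr>) P \<alpha>" "\<And>p. p \<in> carrier P \<Longrightarrow> \<exists>z\<in>Z. \<alpha> z = p"
      "\<And>z. z \<in> Z \<Longrightarrow> \<alpha> z = \<zero>\<^bsub>P\<^esub> \<longleftrightarrow> z \<in> B"
    and \<beta>: "linear_map R V Q \<beta>" "\<And>q. q \<in> carrier Q \<Longrightarrow> \<exists>v\<in>carrier V. \<beta> v = q"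
      "\<And>v. v \<in> carrier V \<Longrightarrow> \<beta> v = \<zero>\<^bsub>Q\<^esub> \<longleftrightarrow> (\<exists>z\<in>Z. \<exists>b\<in>B. v = z \<oplus>\<^bsub>V\<^esub> b)"
  obtains \<gamma> where "linear_map R V P \<gamma>"
    "\<forall>v\<in>carrier V. \<gamma> v = \<zero>\<^bsub>P\<^esub> \<and> \<beta> v = \<zero>\<^bsub>Q\<^esub> \<longleftrightarrow> v \<in> B"
    "\<forall>p\<in>carrier P. \<forall>q\<in>carrier Q. \<exists>v\<in>carrier V. \<gamma> v = p \<and> \<beta> v = q"
proof -
  interpret V: Module.module R V by fact
  interpret P: Module.module R P by fact
  interpret Q: Module.module R Q by fact
  note Zc = submodule_subset[OF Z] and Bc = submodule_subset[OF B]
  obtain \<gamma> where \<gamma>: "linear_map R V P \<gamma>" "\<And>z. z \<in> Z \<Longrightarrow> \<gamma> z = \<alpha> z" "\<And>b. b \<in> B \<Longrightarrow> \<gamma> b = \<zero>\<^bsub>P\<^esub>"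
    using extend_linear_map_vanishing[OF V P Z B \<alpha>(1)] \<alpha>(3) by metis
  note cl = linear_map_closed[OF \<gamma>(1)] linear_map_closed[OF \<beta>(1)]
  have \<beta>Z: "\<beta> z = \<zero>\<^bsub>Q\<^esub>" if "z \<in> Z" for z
  proof -
    have "z = z \<oplus>\<^bsub>V\<^esub> \<zero>\<^bsub>V\<^esub>" using Zc[OF that] by simp
    then show ?thesis using \<beta>(3)[OF Zc[OF that]] submodule_zero[OF B] that by blast
  qed
  show thesis
  proof (rule that)
    show "linear_map R V P \<gamma>" by fact
  next
    show "\<forall>v\<in>carrier V. \<gamma> v = \<zero>\<^bsub>P\<^esub> \<and> \<beta> v = \<zero>\<^bsub>Q\<^esub> \<longleftrightarrow> v \<in> B"
    proof
      fix v assume v: "v \<in> carrier V"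
      show "\<gamma> v = \<zero>\<^bsub>P\<^esub> \<and> \<beta> v = \<zero>\<^bsub>Q\<^esub> \<longleftrightarrow> v \<in> B"
      proof
        assume *: "\<gamma> v = \<zero>\<^bsub>P\<^esub> \<and> \<beta> v = \<zero>\<^bsub>Q\<^esub>"
        then obtain z b where zb: "z \<in> Z" "b \<in> B" "v = z \<oplus>\<^bsub>V\<^esub> b" using \<beta>(3)[OF v] by blast
        then have "\<gamma> v = \<gamma> z" using \<gamma>(3) Zc Bc cl by (simp add: linear_map_add[OF \<gamma>(1)])
        then have "\<alpha> z = \<zero>\<^bsub>P\<^esub>" using \<gamma>(2)[OF zb(1)] * by metis
        then have "z \<in> B" using \<alpha>(3)[OF zb(1)] by blast
        then show "v \<in> B" using zb submodule_add[OF B] by simp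
      next
        assume "v \<in> B"
        moreover have "v = \<zero>\<^bsub>V\<^esub> \<oplus>\<^bsub>V\<^esub> v" using v by simp
        ultimately have "\<beta> v = \<zero>\<^bsub>Q\<^esub>" using \<beta>(3)[OF v] submodule_zero[OF Z] by blast
        with \<open>v \<in> B\<close> \<gamma>(3) show "\<gamma> v = \<zero>\<^bsub>P\<^esub> \<and> \<beta> v = \<zero>\<^bsub>Q\<^esub>" by simp
      qed
    qed
  next
    show "\<forall>p\<in>carrier P. \<forall>q\<in>carrier Q. \<exists>v\<in>carrier V. \<gamma> v = p \<and> \<beta> v = q"
    proof (intro ballI)
      fix p q assume p: "p \<in> carrier P" and q: "q \<in> carrier Q"
      obtain v where v: "v \<in> carrier V" "\<beta> v = q" using \<beta>(2)[OF q] by blast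
      \<comment> \<open>Adding an element of \<open>Z\<close> does not change \<open>\<beta>
        v\<close> and adjusts \<open>\<gamma> v\<close> at will.\<close>
      obtain z where z: "z \<in> Z" "\<alpha> z = p \<oplus>\<^bsub>P\<^esub> \<ominus>\<^bsub>P\<^esub> \<gamma> v"
        using \<alpha>(2)[of "p \<oplus>\<^bsub>P\<^esub> \<ominus>\<^bsub>P\<^esub> \<gamma> v"] p cl(1)[OF v(1)] by auto
      have "\<gamma> (z \<oplus>\<^bsub>V\<^esub> v) = p"
        using z v p cl Zc \<gamma>(2) by (simp add: linear_map_add[OF \<gamma>(1)] P.a_assoc P.l_neg)
      moreover have "\<beta> (z \<oplus>\<^bsub>V\<^esub> v) = q"
        using z v q cl Zc by (simp add: linear_map_add[OF \<beta>(1)] \<beta>Z)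
      ultimately show "\<exists>v\<in>carrier V. \<gamma> v = p \<and> \<beta> v = q"
        using Zc[OF z(1)] v(1) by (intro bexI[of _ "z \<oplus>\<^bsub>V\<^esub> v"]) simp_all
    qed
  qed
qed

lemma vs_iso_finite_direct_sum:
  assumes V: "Module.module R V" and M: "\<And>i. i \<in> I \<Longrightarrow> Module.module R (M i)"
    and B: "submodule B R V" and "finite I"
    and h: "\<And>i. i \<in> I \<Longrightarrow> linear_map R V (M i) (h i)"
    and ker: "\<And>v. v \<in> carrier V \<Longrightarrow> (\<forall>i\<in>I. h i v = \<zero>\<^bsub>M i\<^esub>) \<longleftrightarrow> v \<in> B"
    and surj: "\<And>x. (\<And>i. i \<in> I \<Longrightarrow> x i \<in> carrier (M i)) \<Longrightarrow> \<exists>v\<in>carrier V. \<forall>i\<in>I. h i v = x i"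
  shows "vs_iso R (quotient_space V B) (direct_sum I M)"
proof -
  let ?h = "\<lambda>v. \<lambda>i\<in>I. h i v"
  have hc: "h i v \<in> carrier (M i)" if "i \<in> I" "v \<in> carrier V" for i v
    using linear_map_closed[OF h] that by simp
  have lin: "linear_map R V (direct_sum I M) ?h"
  proof (rule linear_mapI)
    fix x assume "x \<in> carrier V"
    then show "?h x \<in> carrier (direct_sum I M)"
      by (intro direct_sumI[where A = I]) (use assms(4) hc in simp_all)
  next
    fix x y assume xy: "x \<in> carrier V" "y \<in> carrier V"
    then show "?h (x \<oplus>\<^bsub>V\<^esub> y) = ?h x \<oplus>\<^bsub>direct_sum I M\<^esub> ?h y"
      by (intro direct_sum_eqI[where I = I]) (simp_all add: direct_sum_simps linear_map_add[OF h])
  next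
    fix a x assume "a \<in> carrier R" "x \<in> carrier V"
    then show "?h (a \<odot>\<^bsub>V\<^esub> x) = a \<odot>\<^bsub>direct_sum I M\<^esub> ?h x"
      by (intro direct_sum_eqI[where I = I]) (simp_all add: direct_sum_simps linear_map_smult[OF h])
  qed
  have sj: "?h ` carrier V = carrier (direct_sum I M)"
  proof
    show "?h ` carrier V \<subseteq> carrier (direct_sum I M)" using linear_map_closed[OF lin] by blast
    show "carrier (direct_sum I M) \<subseteq> ?h ` carrier V"
    proof
      fix x assume x: "x \<in> carrier (direct_sum I M)"
      obtain v where v: "v \<in> carrier V" "\<forall>i\<in>I. h i v = x i" using surj[of x] direct_sumD(2)[OF x] by blast
      have "x = ?h v"
        by (rule direct_sum_eqI[where I = I]) (use direct_sumD(1)[OF x] v in simp_all)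
      then show "x \<in> ?h ` carrier V" using v(1) by blast
    qed
  qed
  have ke: "?h v = \<zero>\<^bsub>direct_sum I M\<^esub> \<longleftrightarrow> v \<in> B" if v: "v \<in> carrier V" for v
  proof -
    have "?h v = \<zero>\<^bsub>direct_sum I M\<^esub> \<longleftrightarrow> (\<forall>i\<in>I. h i v = \<zero>\<^bsub>M i\<^esub>)"
    proof
      assume e: "?h v = \<zero>\<^bsub>direct_sum I M\<^esub>"
      show "\<forall>i\<in>I. h i v = \<zero>\<^bsub>M i\<^esub>"
      proof
        fix i assume "i \<in> I"
        then show "h i v = \<zero>\<^bsub>M i\<^esub>" using fun_cong[OF e, of i] by (simp add: direct_sum_simps)
      qed
    next
      assume "\<forall>i\<in>I. h i v = \<zero>\<^bsub>M i\<^esub>"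
      then show "?h v = \<zero>\<^bsub>direct_sum I M\<^esub>"
        by (intro direct_sum_eqI[where I = I]) (simp_all add: direct_sum_simps)
    qed
    then show ?thesis using ker[OF v] by simp
  qed
  show ?thesis by (rule first_isomorphism[OF V module_direct_sum[OF M] B lin sj ke])
qed

end

section \<open>Signs of reorderings and incidence numbers\<close>

lemma reorder_permutes:
  assumes "distinct us" "distinct vs" "set us = set vs"
  shows "permutation_of_list (zip us vs) permutes set us"
proof (rule permutation_of_list_permutes)
  have "length us = length vs" using assms by (metis distinct_card)
  then show "list_permutes (zip us vs) (set us)" using assms by simp
qed

lemma reorder_nth:
  assumes "distinct us" "length us = length vs" "i < length us"
  shows "permutation_of_list (zip us vs) (us ! i) = vs ! i"
proof (rule permutation_of_list_unique')
  show "distinct (map fst (zip us vs))" using assms(1,2) by simp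
  show "(us ! i, vs ! i) \<in> set (zip us vs)" using nth_mem[of i "zip us vs"] assms(2,3) by simp
qed

lemma reorder_sign_trans:
  assumes "distinct us" "distinct vs" "distinct ws" "set us = set vs" "set vs = set ws"
  shows "reorder_sign us ws = reorder_sign us vs * reorder_sign vs ws"
proof -
  let ?p = "permutation_of_list (zip us vs)" and ?q = "permutation_of_list (zip vs ws)"
  have len: "length us = length vs" "length vs = length ws" using assms by (metis distinct_card)+
  have p: "?p permutes set us" and q: "?q permutes set vs" and r: "permutation_of_list (zip us ws) permutes set us"
    using reorder_permutes[of us vs] reorder_permutes[of vs ws] reorder_permutes[of us ws] assms
    by simp_all
  have "permutation_of_list (zip us ws) = ?q \<circ> ?p"
  proof
    fix x
    show "permutation_of_list (zip us ws) x = (?q \<circ> ?p) x"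
    proof (cases "x \<in> set us")
      case True
      then obtain i where "i < length us" "x = us ! i" by (metis in_set_conv_nth)
      then show ?thesis using assms len by (simp add: reorder_nth)
    next
      case False
      then show ?thesis using p q r assms(4) by (simp add: permutes_not_in)
    qed
  qed
  moreover have "permutation ?p" "permutation ?q"
    using permutes_imp_permutation[OF _ p] permutes_imp_permutation[OF _ q] by simp_all
  ultimately show ?thesis
    by (simp add: reorder_sign_def sign_compose mult.commute)
qed

lemma reorder_sign_refl [simp]: "reorder_sign us us = 1"
proof -
  have "permutation_of_list (zip us us) = id"
  proof
    fix x show "permutation_of_list (zip us us) x = id x"
      by (induction us) (auto simp: permutation_of_list_Cons)
  qed
  then show ?thesis by (simp add: reorder_sign_def)
qed

lemma reorder_sign_square [simp]: "reorder_sign us vs * reorder_sign us vs = 1"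
  by (simp add: reorder_sign_def sign_def)

lemma reorder_sign_Cons:
  assumes "x \<notin> set us"
  shows "reorder_sign (x # us) (x # vs) = reorder_sign us vs"
proof -
  have "permutation_of_list (zip us vs) x = x"
    by (rule permutation_of_list_id) (use assms in \<open>auto dest: set_zip_leftD\<close>)
  then have "permutation_of_list (zip (x # us) (x # vs)) = permutation_of_list (zip us vs)"
    by (auto simp: fun_eq_iff permutation_of_list_Cons)
  then show ?thesis by (simp add: reorder_sign_def)
qed

lemma reorder_sign_swap:
  assumes "distinct (x # y # us)"
  shows "reorder_sign (x # y # us) (y # x # us) = - 1"
proof -
  have "permutation_of_list (zip us us) z = z" for z
    by (induction us) (auto simp: permutation_of_list_Cons)
  then have "permutation_of_list (zip (x # y # us) (y # x # us)) = Transposition.transpose x y"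
    by (auto simp: fun_eq_iff permutation_of_list_Cons Transposition.transpose_def)
  with assms show ?thesis by (simp add: reorder_sign_def sign_swap_id)
qed

text \<open>Moving \<open>x\<close> past one entry is one transposition.\<close>

lemma reorder_sign_move_to_front:
  "distinct (xs @ x # ys) \<Longrightarrow> reorder_sign (xs @ x # ys) (x # xs @ ys) = (- 1) ^ length xs"
proof (induction xs)
  case (Cons y xs)
  have "reorder_sign ((y # xs) @ x # ys) (x # (y # xs) @ ys) =
      reorder_sign (y # xs @ x # ys) (y # x # xs @ ys) *
      reorder_sign (y # x # xs @ ys) (x # y # xs @ ys)"
    unfolding append_Cons by (rule reorder_sign_trans) (use Cons.prems in auto)
  also have "\<dots> = (- 1) ^ length xs * (- 1)"
    using Cons by (subst reorder_sign_Cons, simp, subst reorder_sign_swap, auto)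
  finally show ?case by simp
qed simp

text \<open>The coefficient of the face \<open>\<rho>\<close> in the boundary of \<open>\<sigma>\<close>, both with reference orientation.\<close>

definition incidence :: "('v set \<Rightarrow> 'v list) \<Rightarrow> 'v set \<Rightarrow> 'v set \<Rightarrow> int" where
  "incidence ori \<sigma> \<rho> = (\<Sum>i<card \<sigma>. if set (delete_nth i (ori \<sigma>)) = \<rho>
     then (- 1) ^ i * reorder_sign (ori \<rho>) (delete_nth i (ori \<sigma>)) else 0)"

lemma set_delete_nth:
  assumes "distinct us" "i < length us"
  shows "set (delete_nth i us) = set us - {us ! i}"
proof -
  have "us = take i us @ us ! i # drop (Suc i) us" using assms(2) by (rule id_take_nth_drop)
  then have *: "distinct (take i us @ us ! i # drop (Suc i) us)"
    "set us = set (take i us @ us ! i # drop (Suc i) us)" using assms(1) by metis+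
  show ?thesis unfolding delete_nth_def *(2) using *(1) by auto
qed

lemma face_in_complex: "is_complex X \<Longrightarrow> \<sigma> \<in> X \<Longrightarrow> \<rho> \<subseteq> \<sigma> \<Longrightarrow> \<rho> \<noteq> {} \<Longrightarrow> \<rho> \<in> X"
  unfolding is_complex_def by blast

lemma simplex_finite: "is_complex X \<Longrightarrow> \<sigma> \<in> X \<Longrightarrow> finite \<sigma>"
  and simplex_nonempty: "is_complex X \<Longrightarrow> \<sigma> \<in> X \<Longrightarrow> \<sigma> \<noteq> {}"
  unfolding is_complex_def by blast+

context
  fixes X :: "'v set set" and ori :: "'v set \<Rightarrow> 'v list"
  assumes X: "is_complex X" and ori: "orientation X ori"
begin

lemma ori_props:
  assumes "\<sigma> \<in> X"
  shows "distinct (ori \<sigma>)" "set (ori \<sigma>) = \<sigma>" "length (ori \<sigma>) = card \<sigma>"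
proof -
  show *: "distinct (ori \<sigma>)" "set (ori \<sigma>) = \<sigma>" using ori assms by (auto simp: orientation_def)
  show "length (ori \<sigma>) = card \<sigma>" using distinct_card[OF *(1)] *(2) by simp
qed

text \<open>Moving the vertex at position \<open>i\<close> to the front costs the sign
  \<open>(-1)^i\<close> with which its deletion enters the boundary. Hence no position appears
  when the omitted vertex comes first, and both simplices may be listed in any convenient
  order.\<close>

lemma incidence_face:
  assumes \<sigma>: "\<sigma> \<in> X" "set (u # us) = \<sigma>" and us: "distinct (u # us)" "us \<noteq> []" "set us = \<rho>"
  shows "incidence ori \<sigma> \<rho> = reorder_sign (ori \<sigma>) (u # us) * reorder_sign (ori \<rho>) us"
proof -
  have u\<sigma>: "u \<in> \<sigma>" and \<rho>_eq: "\<rho> = \<sigma> - {u}" using \<sigma>(2) us by auto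
  have "\<rho> \<noteq> {}" using us(2,3) by auto
  then have "\<rho> \<in> X" using face_in_complex[OF X \<sigma>(1), of \<rho>] \<rho>_eq by simp
  note o = ori_props[OF \<sigma>(1)] and o' = ori_props[OF this]
  obtain xs ys where xy: "ori \<sigma> = xs @ u # ys" using o(2) u\<sigma> by (metis split_list)
  have d: "distinct (xs @ u # ys)" using o(1) xy by simp
  have s: "set (xs @ ys) = \<rho>" using o(2) d unfolding xy \<rho>_eq by auto
  have u: "u \<notin> set (xs @ ys)" using d by simp
  have del: "delete_nth (length xs) (ori \<sigma>) = xs @ ys" by (simp add: delete_nth_def xy)
  have lt: "length xs < card \<sigma>" using o(3) xy by simp
  have nth: "ori \<sigma> ! length xs = u" using xy by simp
  have face: "set (delete_nth i (ori \<sigma>)) = \<rho> \<longleftrightarrow> i = length xs" if i: "i < card \<sigma>" for i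
  proof
    assume "set (delete_nth i (ori \<sigma>)) = \<rho>"
    then have "\<sigma> - {ori \<sigma> ! i} = \<sigma> - {u}"
      using set_delete_nth[OF o(1), of i] i o(2,3) \<rho>_eq by simp
    then have "u \<notin> \<sigma> - {ori \<sigma> ! i}" by simp
    then have "ori \<sigma> ! i = ori \<sigma> ! length xs" using nth u\<sigma> by simp
    then show "i = length xs" using nth_eq_iff_index_eq[OF o(1)] i lt o(3) by simp
  next
    assume "i = length xs"
    then show "set (delete_nth i (ori \<sigma>)) = \<rho>" using del s by simp
  qed
  have "incidence ori \<sigma> \<rho> = (\<Sum>i<card \<sigma>. if i = length xs
      then (- 1) ^ i * reorder_sign (ori \<rho>) (delete_nth i (ori \<sigma>)) else 0)"
    unfolding incidence_def by (rule sum.cong) (simp_all add: face)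
  also have "\<dots> = (- 1) ^ length xs * reorder_sign (ori \<rho>) (xs @ ys)"
    using lt del by simp
  finally have 1: "incidence ori \<sigma> \<rho> = (- 1) ^ length xs * reorder_sign (ori \<rho>) (xs @ ys)" .
  have "reorder_sign (xs @ u # ys) (u # us) =
      reorder_sign (xs @ u # ys) (u # xs @ ys) * reorder_sign (u # xs @ ys) (u # us)"
    by (rule reorder_sign_trans) (use d us s in auto)
  then have 2: "reorder_sign (ori \<sigma>) (u # us) = (- 1) ^ length xs * reorder_sign (xs @ ys) us"
    unfolding xy reorder_sign_move_to_front[OF d] reorder_sign_Cons[OF u] .
  have 3: "reorder_sign (ori \<rho>) us =
      reorder_sign (ori \<rho>) (xs @ ys) * reorder_sign (xs @ ys) us"
    by (rule reorder_sign_trans) (use d us s o' in auto)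
  have "a * b = a * c * (b * c)" if "c * c = 1" for a b c :: int
    using arg_cong[OF that, of "\<lambda>x. a * b * x"] by (simp add: ac_simps)
  from this[OF reorder_sign_square] show ?thesis unfolding 1 2 3 .
qed

lemma incidence_nonface:
  assumes "\<sigma> \<in> X" "\<And>u. u \<in> \<sigma> \<Longrightarrow> \<rho> \<noteq> \<sigma> - {u}"
  shows "incidence ori \<sigma> \<rho> = 0"
proof -
  note o = ori_props[OF assms(1)]
  have "set (delete_nth i (ori \<sigma>)) \<noteq> \<rho>" if i: "i < card \<sigma>" for i
  proof -
    have lt: "i < length (ori \<sigma>)" using i o(3) by simp
    then have "ori \<sigma> ! i \<in> \<sigma>" using nth_mem[OF lt] unfolding o(2) by simp
    from assms(2)[OF this] show ?thesis unfolding set_delete_nth[OF o(1) lt] o(2) by (rule not_sym)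
  qed
  then show ?thesis unfolding incidence_def by (intro sum.neutral ballI) simp
qed

text \<open>Deleting two vertices in either order gives opposite signs, because the two ways of listing
  them first differ by a transposition.\<close>

lemma incidence_swap:
  assumes \<sigma>: "\<sigma> \<in> X" "set (u # w # us) = \<sigma>" and us: "distinct (u # w # us)" "us \<noteq> []"
  shows "incidence ori \<sigma> (\<sigma> - {u}) * incidence ori (\<sigma> - {u}) (set us) =
    - (incidence ori \<sigma> (\<sigma> - {w}) * incidence ori (\<sigma> - {w}) (set us))"
proof -
  have e: "\<sigma> - {u} = set (w # us)" "\<sigma> - {w} = set (u # us)" "set (w # u # us) = \<sigma>"
    using \<sigma>(2) us by auto
  have X: "\<sigma> - {u} \<in> X" "\<sigma> - {w} \<in> X"
    using face_in_complex[OF X \<sigma>(1), of "\<sigma> - {u}"] face_in_complex[OF X \<sigma>(1), of "\<sigma> - {w}"] e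
    by auto
  have "reorder_sign (ori \<sigma>) (w # u # us) =
      reorder_sign (ori \<sigma>) (u # w # us) * reorder_sign (u # w # us) (w # u # us)"
    by (rule reorder_sign_trans) (use ori_props[OF \<sigma>(1)] \<sigma>(2) us in auto)
  then have swap: "reorder_sign (ori \<sigma>) (w # u # us) = - reorder_sign (ori \<sigma>) (u # w # us)"
    unfolding reorder_sign_swap[OF us(1)] by simp
  have "incidence ori \<sigma> (\<sigma> - {u}) =
      reorder_sign (ori \<sigma>) (u # w # us) * reorder_sign (ori (\<sigma> - {u})) (w # us)"
    by (rule incidence_face[OF \<sigma> us(1) _ e(1)[symmetric]]) simp
  moreover have "incidence ori \<sigma> (\<sigma> - {w}) =
      reorder_sign (ori \<sigma>) (w # u # us) * reorder_sign (ori (\<sigma> - {w})) (u # us)"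
    by (rule incidence_face[OF \<sigma>(1) e(3) _ _ e(2)[symmetric]]) (use us in auto)
  moreover have "incidence ori (\<sigma> - {u}) (set us) =
      reorder_sign (ori (\<sigma> - {u})) (w # us) * reorder_sign (ori (set us)) us"
    by (rule incidence_face[OF X(1) e(1)[symmetric] _ us(2) refl]) (use us in auto)
  moreover have "incidence ori (\<sigma> - {w}) (set us) =
      reorder_sign (ori (\<sigma> - {w})) (u # us) * reorder_sign (ori (set us)) us"
    by (rule incidence_face[OF X(2) e(2)[symmetric] _ us(2) refl]) (use us in auto)
  moreover have "a * b * (b * c) = a * c" if "b * b = 1" for a b c :: int
    using arg_cong[OF that, of "\<lambda>x. a * c * x"] by (simp add: ac_simps)
  note this[OF reorder_sign_square]
  ultimately show ?thesis unfolding swap by simp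
qed

text \<open>A face of codimension two arises by deleting two vertices, so it is reached through
  exactly two intermediate faces, whose contributions cancel.\<close>

lemma incidence_incidence:
  assumes \<sigma>: "\<sigma> \<in> X" and 3: "card \<sigma> \<ge> 3"
  shows "(\<Sum>\<rho>\<in>(\<lambda>u. \<sigma> - {u}) ` \<sigma>. incidence ori \<sigma> \<rho> * incidence ori \<rho> \<pi>) = 0"
proof -
  note fin = simplex_finite[OF X \<sigma>]
  have inj: "inj_on (\<lambda>u. \<sigma> - {u}) \<sigma>" by (auto simp: inj_on_def)
  have face: "\<sigma> - {u} \<in> X" if "u \<in> \<sigma>" for u
  proof (rule face_in_complex[OF X \<sigma>])
    show "\<sigma> - {u} \<noteq> {}"
    proof
      assume "\<sigma> - {u} = {}"
      then have "card \<sigma> \<le> card {u}" by (intro card_mono) auto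
      with 3 show False by simp
    qed
  qed auto
  let ?g = "\<lambda>u. incidence ori \<sigma> (\<sigma> - {u}) * incidence ori (\<sigma> - {u}) \<pi>"
  have "(\<Sum>\<rho>\<in>(\<lambda>u. \<sigma> - {u}) ` \<sigma>. incidence ori \<sigma> \<rho> * incidence ori \<rho> \<pi>) = (\<Sum>u\<in>\<sigma>. ?g u)"
    by (simp add: sum.reindex[OF inj])
  also have "\<dots> = 0"
  proof (cases "\<exists>u w. u \<in> \<sigma> \<and> w \<in> \<sigma> \<and> u \<noteq> w \<and> \<pi> = \<sigma> - {u, w}")
    case False
    have "?g u = 0" if "u \<in> \<sigma>" for u
    proof -
      have "incidence ori (\<sigma> - {u}) \<pi> = 0"
      proof (rule incidence_nonface[OF face[OF that]])
        fix w assume "w \<in> \<sigma> - {u}"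
        moreover have "\<sigma> - {u} - {w} = \<sigma> - {u, w}" by blast
        ultimately show "\<pi> \<noteq> \<sigma> - {u} - {w}" using False that by auto
      qed
      then show ?thesis by simp
    qed
    then show ?thesis by (intro sum.neutral ballI) blast
  next
    case True
    then obtain u w where uw: "u \<in> \<sigma>" "w \<in> \<sigma>" "u \<noteq> w" "\<pi> = \<sigma> - {u, w}" by blast
    obtain us where us: "set us = \<pi>" "distinct us"
      using finite_distinct_list[of \<pi>] fin uw(4) by auto
    have \<sigma>us: "\<sigma> = set (u # w # us)" using us uw by auto
    have d: "distinct (u # w # us)" using us uw by auto
    have "us \<noteq> []" using 3 \<sigma>us d distinct_card[OF d] by auto
    have "?g v = 0" if "v \<in> \<sigma> - {u, w}" for v
    proof -
      have "v \<in> \<sigma>" using that by simp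
      have "incidence ori (\<sigma> - {v}) \<pi> = 0"
        by (rule incidence_nonface[OF face[OF \<open>v \<in> \<sigma>\<close>]]) (use that uw in auto)
      then show ?thesis by simp
    qed
    then have "(\<Sum>v\<in>\<sigma>. ?g v) = (\<Sum>v\<in>{u, w}. ?g v)"
      by (intro sum.mono_neutral_right) (use fin uw in auto)
    also have "\<dots> = ?g u + ?g w" using uw by simp
    finally show ?thesis
      using incidence_swap[OF \<sigma> \<sigma>us[symmetric] d \<open>us \<noteq> []\<close>] unfolding us(1) by simp
  qed
  finally show ?thesis .
qed

end

section \<open>Chains with coefficients in a field\<close>

context cring
begin

definition of_integer :: "int \<Rightarrow> 'a" where
  "of_integer n = [n] \<cdot>\<^bsub>R\<^esub> \<one>"

lemma of_integer_closed [simp]: "of_integer n \<in> carrier R"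
  by (simp add: of_integer_def)

lemma of_integer_0 [simp]: "of_integer 0 = \<zero>"
  using add_pow_int_ge[of 0 R \<one>] by (simp add: of_integer_def)

lemma of_integer_1 [simp]: "of_integer 1 = \<one>"
  by (simp add: of_integer_def)

lemma of_integer_add: "of_integer (m + n) = of_integer m \<oplus> of_integer n"
  unfolding of_integer_def by (simp add: add.int_pow_mult)

lemma of_integer_minus: "of_integer (- n) = \<ominus> of_integer n"
  unfolding of_integer_def by (simp add: add.int_pow_neg)

lemma of_integer_mult: "of_integer (m * n) = of_integer m \<otimes> of_integer n"
proof -
  have "of_integer m \<otimes> of_integer n = [m] \<cdot>\<^bsub>R\<^esub> of_integer n"
    using add_pow_ldistr_int[of \<one> "of_integer n" m] by (simp add: of_integer_def)
  also have "\<dots> = [(n * m)] \<cdot>\<^bsub>R\<^esub> \<one>"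
    unfolding of_integer_def by (simp add: add.int_pow_pow mult.commute)
  finally show ?thesis by (simp add: of_integer_def mult.commute)
qed

lemma of_integer_sum:
  "finite A \<Longrightarrow> of_integer (\<Sum>a\<in>A. g a) = (\<Oplus>a\<in>A. of_integer (g a))"
  by (induction A rule: finite_induct) (simp_all add: of_integer_add Pi_def)

text \<open>Signs enter chains as integer multiples in the additive group. As scalar multiples
  they can be moved through linear maps.\<close>

lemma integer_multiple:
  assumes M: "Module.module R M" and x: "x \<in> carrier M"
  shows "[(n::int)] \<cdot>\<^bsub>M\<^esub> x = of_integer n \<odot>\<^bsub>M\<^esub> x"
proof -
  interpret M: Module.module R M by fact
  have nat: "[(k::nat)] \<cdot>\<^bsub>M\<^esub> x = of_integer (int k) \<odot>\<^bsub>M\<^esub> x" for k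
  proof (induction k)
    case 0
    then show ?case using x by simp
  next
    case (Suc k)
    have "of_integer (int (Suc k)) = of_integer (int k) \<oplus> \<one>"
      using of_integer_add[of "int k" 1] by (simp add: add.commute)
    then show ?case using Suc x by (simp add: M.smult_l_distr)
  qed
  show ?thesis
  proof (cases "n \<ge> 0")
    case True
    then show ?thesis using nat[of "nat n"] add_pow_int_ge[OF True, of M x] by simp
  next
    case False
    then have "of_integer n = \<ominus> of_integer (- n)" by (simp add: of_integer_minus)
    then show ?thesis
      using nat[of "nat (- n)"] add_pow_int_lt[of n M x] False x by (simp add: M.smult_l_minus)
  qed
qed

lemma free_space_simps:
  "\<zero>\<^bsub>free_space R S\<^esub> = (\<lambda>b. \<zero>)"
  "c \<oplus>\<^bsub>free_space R S\<^esub> d = (\<lambda>b. c b \<oplus> d b)"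
  "a \<odot>\<^bsub>free_space R S\<^esub> c = (\<lambda>b. a \<otimes> c b)"
  by (simp_all add: free_space_def)

lemma free_spaceI:
  assumes "finite A" "A \<subseteq> S" "\<And>b. c b \<in> carrier R" "\<And>b. b \<notin> A \<Longrightarrow> c b = \<zero>"
  shows "c \<in> carrier (free_space R S)"
proof -
  have "{b. c b \<noteq> \<zero>} \<subseteq> A" using assms(4) by blast
  with assms(1-3) show ?thesis by (auto simp: free_space_def intro: finite_subset)
qed

lemma free_spaceD:
  assumes "c \<in> carrier (free_space R S)"
  shows "c b \<in> carrier R" "finite {b. c b \<noteq> \<zero>}" "{b. c b \<noteq> \<zero>} \<subseteq> S" "b \<notin> S \<Longrightarrow> c b = \<zero>"
  using assms unfolding free_space_def by auto

lemma module_free_space: "Module.module R (free_space R S)"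
proof (rule moduleI)
  show "cring R" ..
  note [simp] = free_space_simps
  note D = free_spaceD
  show "abelian_group (free_space R S)"
  proof (rule abelian_groupI)
    fix c d assume c: "c \<in> carrier (free_space R S)" and d: "d \<in> carrier (free_space R S)"
    show "c \<oplus>\<^bsub>free_space R S\<^esub> d \<in> carrier (free_space R S)"
      by (rule free_spaceI[where A = "{b. c b \<noteq> \<zero>} \<union> {b. d b \<noteq> \<zero>}"])
        (use D(1-3)[OF c] D(1-3)[OF d] in simp_all)
    show "c \<oplus>\<^bsub>free_space R S\<^esub> d = d \<oplus>\<^bsub>free_space R S\<^esub> c"
      using D(1)[OF c] D(1)[OF d] by (simp add: a_comm)
    fix e assume e: "e \<in> carrier (free_space R S)"
    show "c \<oplus>\<^bsub>free_space R S\<^esub> d \<oplus>\<^bsub>free_space R S\<^esub> e =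
        c \<oplus>\<^bsub>free_space R S\<^esub> (d \<oplus>\<^bsub>free_space R S\<^esub> e)"
      using D(1)[OF c] D(1)[OF d] D(1)[OF e] by (simp add: a_assoc)
  next
    show "\<zero>\<^bsub>free_space R S\<^esub> \<in> carrier (free_space R S)"
      by (rule free_spaceI[where A = "{}"]) simp_all
  next
    fix c assume c: "c \<in> carrier (free_space R S)"
    show "\<zero>\<^bsub>free_space R S\<^esub> \<oplus>\<^bsub>free_space R S\<^esub> c = c" using D(1)[OF c] by simp
    have "(\<lambda>b. \<ominus> c b) \<in> carrier (free_space R S)"
      by (rule free_spaceI[where A = "{b. c b \<noteq> \<zero>}"]) (use D(1-3)[OF c] in simp_all)
    moreover have "(\<lambda>b. \<ominus> c b) \<oplus>\<^bsub>free_space R S\<^esub> c = \<zero>\<^bsub>free_space R S\<^esub>"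
      using D(1)[OF c] by (simp add: l_neg)
    ultimately show "\<exists>d\<in>carrier (free_space R S). d \<oplus>\<^bsub>free_space R S\<^esub> c = \<zero>\<^bsub>free_space R S\<^esub>"
      by blast
  qed
  fix a c assume a: "a \<in> carrier R" and c: "c \<in> carrier (free_space R S)"
  show "a \<odot>\<^bsub>free_space R S\<^esub> c \<in> carrier (free_space R S)"
    by (rule free_spaceI[where A = "{b. c b \<noteq> \<zero>}"]) (use D(1-3)[OF c] a in simp_all)
  fix b assume b: "b \<in> carrier R"
  show "(a \<oplus> b) \<odot>\<^bsub>free_space R S\<^esub> c =
      a \<odot>\<^bsub>free_space R S\<^esub> c \<oplus>\<^bsub>free_space R S\<^esub> b \<odot>\<^bsub>free_space R S\<^esub> c"
    using D(1)[OF c] a b by (simp add: l_distr)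
  show "(a \<otimes> b) \<odot>\<^bsub>free_space R S\<^esub> c = a \<odot>\<^bsub>free_space R S\<^esub> (b \<odot>\<^bsub>free_space R S\<^esub> c)"
    using D(1)[OF c] a b by (simp add: m_assoc)
next
  fix c assume "c \<in> carrier (free_space R S)"
  from free_spaceD(1)[OF this] show "\<one> \<odot>\<^bsub>free_space R S\<^esub> c = c"
    by (simp add: free_space_simps)
next
  fix a c d assume a: "a \<in> carrier R"
    and c: "c \<in> carrier (free_space R S)" and d: "d \<in> carrier (free_space R S)"
  show "a \<odot>\<^bsub>free_space R S\<^esub> (c \<oplus>\<^bsub>free_space R S\<^esub> d) =
      a \<odot>\<^bsub>free_space R S\<^esub> c \<oplus>\<^bsub>free_space R S\<^esub> a \<odot>\<^bsub>free_space R S\<^esub> d"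
    using a free_spaceD(1)[OF c] free_spaceD(1)[OF d] by (simp add: free_space_simps r_distr)
qed

lemma finsum_free_space:
  assumes "finite A" "\<And>a. a \<in> A \<Longrightarrow> g a \<in> carrier (free_space R S)"
  shows "(\<Oplus>\<^bsub>free_space R S\<^esub>a\<in>A. g a) b = (\<Oplus>a\<in>A. g a b)"
proof -
  interpret F: Module.module R "free_space R S" by (rule module_free_space)
  show ?thesis using assms
  proof (induction A)
    case (insert a A)
    then have "g x b \<in> carrier R" if "x \<in> insert a A" for x
      using free_spaceD(1)[of "g x" S] that by blast
    with insert show ?case by (simp add: Pi_def free_space_simps)
  qed (simp add: free_space_simps)
qed

definition single :: "'s \<Rightarrow> 's \<Rightarrow> 'a" where
  "single s = (\<lambda>b. if b = s then \<one> else \<zero>)"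

lemma single_in_free_space: "s \<in> S \<Longrightarrow> single s \<in> carrier (free_space R S)"
  by (rule free_spaceI[where A = "{s}"]) (simp_all add: single_def)

lemma free_space_induct [consumes 1, case_names zero add]:
  assumes "c \<in> carrier (free_space R S)"
    and "P (\<lambda>b. \<zero>)"
    and step: "\<And>c a s. c \<in> carrier (free_space R S) \<Longrightarrow> a \<in> carrier R \<Longrightarrow> s \<in> S \<Longrightarrow> P c \<Longrightarrow>
      P (c \<oplus>\<^bsub>free_space R S\<^esub> a \<odot>\<^bsub>free_space R S\<^esub> single s)"
  shows "P c"
proof -
  have "P c" if "finite A" "{b. c b \<noteq> \<zero>} \<subseteq> A" "A \<subseteq> S" "\<And>b. c b \<in> carrier R" for A and c :: "'c \<Rightarrow> 'a"
    using that
  proof (induction A arbitrary: c)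
    case empty
    then have "c = (\<lambda>b. \<zero>)" by (auto simp: fun_eq_iff)
    then show ?case using assms(2) by simp
  next
    case (insert s A)
    let ?d = "\<lambda>b. if b = s then \<zero> else c b"
    have "P ?d" by (rule insert.IH) (use insert.prems in auto)
    moreover have "?d \<in> carrier (free_space R S)"
      by (rule free_spaceI[where A = A]) (use insert.prems insert.hyps in auto)
    moreover have "c = ?d \<oplus>\<^bsub>free_space R S\<^esub> c s \<odot>\<^bsub>free_space R S\<^esub> single s"
      using insert.prems(3) by (auto simp: fun_eq_iff free_space_simps single_def)
    ultimately show ?case using step[of ?d "c s" s] insert.prems by auto
  qed
  from this[OF free_spaceD(2)[OF assms(1)] subset_refl free_spaceD(3,1)[OF assms(1)]]
  show ?thesis by blast
qed

lemma linear_map_eq_on_basis: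
  assumes N: "Module.module R N" and h: "linear_map R (free_space R S) N h"
    and g: "linear_map R (free_space R S) N g"
    and eq: "\<And>s. s \<in> S \<Longrightarrow> h (single s) = g (single s)"
    and c: "c \<in> carrier (free_space R S)"
  shows "h c = g c"
  using c
proof (induction rule: free_space_induct)
  case zero
  then show ?case
    using linear_map_zero[OF module_free_space N h] linear_map_zero[OF module_free_space N g]
    by (simp add: free_space_simps)
next
  case (add c a s)
  interpret F: Module.module R "free_space R S" by (rule module_free_space)
  have s: "single s \<in> carrier (free_space R S)" by (rule single_in_free_space) fact
  show ?case
    using add s eq
    by (simp add: linear_map_add[OF h] linear_map_add[OF g] linear_map_smult[OF h]
        linear_map_smult[OF g])
qed

text \<open>The set over which a linear extension sums depends on its argument. To add two values,
  both sums must run over a common set.\<close>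

lemma linear_extension_superset:
  assumes M: "Module.module R M" and g: "\<And>s. s \<in> S \<Longrightarrow> g s \<in> carrier M"
    and c: "c \<in> carrier (free_space R S)"
    and A: "finite A" "{b. c b \<noteq> \<zero>} \<subseteq> A" "A \<subseteq> S"
  shows "linear_extension R M g c = (\<Oplus>\<^bsub>M\<^esub>b\<in>A. c b \<odot>\<^bsub>M\<^esub> g b)"
proof -
  interpret M: Module.module R M by fact
  show ?thesis
    unfolding linear_extension_def
  proof (rule M.add.finprod_mono_neutral_cong_left[OF A(1,2)])
    show "c b \<odot>\<^bsub>M\<^esub> g b = \<zero>\<^bsub>M\<^esub>" if "b \<in> A - {b. c b \<noteq> \<zero>}" for b
      using that A(3) g by auto
    show "(\<lambda>b. c b \<odot>\<^bsub>M\<^esub> g b) \<in> A \<rightarrow> carrier M"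
      using A(3) g free_spaceD(1)[OF c] by auto
  qed simp
qed

lemma linear_map_linear_extension:
  assumes M: "Module.module R M" and g: "\<And>s. s \<in> S \<Longrightarrow> g s \<in> carrier M"
  shows "linear_map R (free_space R S) M (linear_extension R M g)"
proof (rule linear_mapI)
  interpret M: Module.module R M by fact
  interpret F: Module.module R "free_space R S" by (rule module_free_space)
  note sup = linear_extension_superset[OF M g]
  note D = free_spaceD
  fix c assume c: "c \<in> carrier (free_space R S)"
  have gc: "c b \<odot>\<^bsub>M\<^esub> g b \<in> carrier M" if "b \<in> S" for b using that g D(1)[OF c] by simp
  have c_eq: "linear_extension R M g c = (\<Oplus>\<^bsub>M\<^esub>b\<in>{b. c b \<noteq> \<zero>}. c b \<odot>\<^bsub>M\<^esub> g b)"
    by (rule sup[OF _ c]) (use D[OF c] in auto)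
  show "linear_extension R M g c \<in> carrier M"
    unfolding c_eq using D(3)[OF c] gc by (intro M.finsum_closed) auto
  fix d assume d: "d \<in> carrier (free_space R S)"
  have gd: "d b \<odot>\<^bsub>M\<^esub> g b \<in> carrier M" if "b \<in> S" for b using that g D(1)[OF d] by simp
  let ?A = "{b. c b \<noteq> \<zero>} \<union> {b. d b \<noteq> \<zero>}"
  have A: "finite ?A" "?A \<subseteq> S" using D(2,3)[OF c] D(2,3)[OF d] by auto
  have "linear_extension R M g (c \<oplus>\<^bsub>free_space R S\<^esub> d) =
      (\<Oplus>\<^bsub>M\<^esub>b\<in>?A. (c b \<oplus> d b) \<odot>\<^bsub>M\<^esub> g b)"
    by (subst sup[OF _ F.a_closed[OF c d], where A = ?A]) (use A in \<open>auto simp: free_space_simps\<close>)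
  also have "\<dots> = (\<Oplus>\<^bsub>M\<^esub>b\<in>?A. c b \<odot>\<^bsub>M\<^esub> g b \<oplus>\<^bsub>M\<^esub> d b \<odot>\<^bsub>M\<^esub> g b)"
    by (rule M.finsum_cong') (use A gc gd g D(1)[OF c] D(1)[OF d] in \<open>auto simp: M.smult_l_distr\<close>)
  also have "\<dots> = (\<Oplus>\<^bsub>M\<^esub>b\<in>?A. c b \<odot>\<^bsub>M\<^esub> g b) \<oplus>\<^bsub>M\<^esub> (\<Oplus>\<^bsub>M\<^esub>b\<in>?A. d b \<odot>\<^bsub>M\<^esub> g b)"
    by (rule M.finsum_addf) (use A gc gd in auto)
  also have "\<dots> = linear_extension R M g c \<oplus>\<^bsub>M\<^esub> linear_extension R M g d"
    using sup[OF _ c A(1) _ A(2)] sup[OF _ d A(1) _ A(2)] by simp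
  finally show "linear_extension R M g (c \<oplus>\<^bsub>free_space R S\<^esub> d) = \<dots>" .
next
  interpret M: Module.module R M by fact
  interpret F: Module.module R "free_space R S" by (rule module_free_space)
  note sup = linear_extension_superset[OF M g]
  note D = free_spaceD
  fix a c assume a: "a \<in> carrier R" and c: "c \<in> carrier (free_space R S)"
  have gc: "c b \<odot>\<^bsub>M\<^esub> g b \<in> carrier M" if "b \<in> S" for b using that g D(1)[OF c] by simp
  let ?A = "{b. c b \<noteq> \<zero>}"
  have A: "finite ?A" "?A \<subseteq> S" using D(2,3)[OF c] by auto
  have "linear_extension R M g (a \<odot>\<^bsub>free_space R S\<^esub> c) = (\<Oplus>\<^bsub>M\<^esub>b\<in>?A. (a \<otimes> c b) \<odot>\<^bsub>M\<^esub> g b)"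
    by (subst sup[OF _ F.smult_closed[OF a c], where A = ?A]) (use A a in \<open>auto simp: free_space_simps\<close>)
  also have "\<dots> = (\<Oplus>\<^bsub>M\<^esub>b\<in>?A. a \<odot>\<^bsub>M\<^esub> (c b \<odot>\<^bsub>M\<^esub> g b))"
    by (rule M.finsum_cong') (use A a gc g D(1)[OF c] in \<open>auto simp: M.smult_assoc1\<close>)
  also have "\<dots> = a \<odot>\<^bsub>M\<^esub> (\<Oplus>\<^bsub>M\<^esub>b\<in>?A. c b \<odot>\<^bsub>M\<^esub> g b)"
    by (rule M.finsum_smult_ldistr[symmetric]) (use A a gc in auto)
  also have "\<dots> = a \<odot>\<^bsub>M\<^esub> linear_extension R M g c"
    using sup[OF _ c A(1) subset_refl A(2)] by simp
  finally show "linear_extension R M g (a \<odot>\<^bsub>free_space R S\<^esub> c) = \<dots>" .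
qed

lemma linear_extension_single:
  assumes M: "Module.module R M" and "\<And>s. s \<in> S \<Longrightarrow> g s \<in> carrier M" and s: "s \<in> S"
  shows "linear_extension R M g (single s) = g s"
proof -
  interpret M: Module.module R M by fact
  have "linear_extension R M g (single s) = (\<Oplus>\<^bsub>M\<^esub>b\<in>{s}. single s b \<odot>\<^bsub>M\<^esub> g b)"
    by (rule linear_extension_superset[OF M assms(2) single_in_free_space[OF s]])
      (use s in \<open>auto simp: single_def\<close>)
  also have "\<dots> = g s" using assms(2)[OF s] by (simp add: single_def)
  finally show ?thesis .
qed

end

section \<open>Chain complexes\<close>

definition chain_complex ::
    "('k, 'r) ring_scheme \<Rightarrow> (nat \<Rightarrow> ('k, 'a) module) \<Rightarrow> (nat \<Rightarrow> 'a \<Rightarrow> 'a) \<Rightarrow> bool" where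
  "chain_complex K C d \<longleftrightarrow>
    (\<forall>n. Module.module K (C n)) \<and> (\<forall>n. linear_map K (C (Suc n)) (C n) (d (Suc n))) \<and>
    (\<forall>n. \<forall>x\<in>carrier (C (Suc (Suc n))). d (Suc n) (d (Suc (Suc n)) x) = \<zero>\<^bsub>C n\<^esub>)"

context cring
begin

lemma submodule_cycles:
  assumes "chain_complex R C d"
  shows "submodule (cycles C d n) R (C n)"
proof (cases n)
  case 0
  then show ?thesis using assms submodule_carrier by (auto simp: chain_complex_def cycles_def)
next
  case (Suc m)
  then show ?thesis
    using linear_map_kernel[of "C (Suc m)" "C m" "d (Suc m)"] assms
    by (simp add: chain_complex_def cycles_def)
qed

lemma submodule_boundaries:
  assumes "chain_complex R C d"
  shows "submodule (boundaries C d n) R (C n)"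
  unfolding boundaries_def
  by (rule linear_map_image[of "C (Suc n)"])
    (use assms submodule_carrier in \<open>auto simp: chain_complex_def\<close>)

lemma boundaries_subset_cycles:
  assumes "chain_complex R C d"
  shows "boundaries C d n \<subseteq> cycles C d n"
proof
  fix y assume "y \<in> boundaries C d n"
  then obtain x where x: "x \<in> carrier (C (Suc n))" "y = d (Suc n) x" by (auto simp: boundaries_def)
  have "linear_map R (C (Suc n)) (C n) (d (Suc n))" using assms by (simp add: chain_complex_def)
  then have y: "y \<in> carrier (C n)" unfolding x(2) by (rule linear_map_closed) (rule x(1))
  show "y \<in> cycles C d n"
  proof (cases n)
    case 0
    then show ?thesis using y by (simp add: cycles_def)
  next
    case (Suc m)
    then have "d n y = \<zero>\<^bsub>C m\<^esub>" using assms x by (simp add: chain_complex_def)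
    with Suc y show ?thesis by (simp add: cycles_def)
  qed
qed

lemma module_cycles:
  assumes "chain_complex R C d"
  shows "Module.module R ((C n)\<lparr>carrier := cycles C d n\<rparr>)"
  by (rule submodule_module[OF _ submodule_cycles[OF assms]])
    (use assms in \<open>simp add: chain_complex_def\<close>)

lemma submodule_boundaries_cycles:
  assumes "chain_complex R C d"
  shows "submodule (boundaries C d n) R ((C n)\<lparr>carrier := cycles C d n\<rparr>)"
  by (rule submodule_restrict[OF _ submodule_cycles[OF assms] submodule_boundaries[OF assms]
        boundaries_subset_cycles[OF assms]])
    (use assms in \<open>simp add: chain_complex_def\<close>)

lemma module_homology:
  assumes "chain_complex R C d"
  shows "Module.module R (homology C d n)"
  unfolding homology_def
  by (rule module_quotient_space[OF module_cycles[OF assms] submodule_boundaries_cycles[OF assms]])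

lemma linear_map_class:
  assumes "chain_complex R C d"
  shows "linear_map R ((C n)\<lparr>carrier := cycles C d n\<rparr>) (homology C d n)
    (\<lambda>z. boundaries C d n +>\<^bsub>C n\<^esub> z)"
  using linear_map_coset[OF module_cycles[OF assms] submodule_boundaries_cycles[OF assms]]
  unfolding homology_def a_r_coset_restrict .

lemma carrier_homology:
  "carrier (homology C d n) = (\<lambda>z. boundaries C d n +>\<^bsub>C n\<^esub> z) ` cycles C d n"
  unfolding homology_def carrier_quotient_space a_r_coset_restrict by simp

lemma zero_homology: "\<zero>\<^bsub>homology C d n\<^esub> = boundaries C d n"
  by (simp add: homology_def zero_quotient_space)

lemma class_zero_iff:
  assumes "chain_complex R C d" "z \<in> carrier (C n)"
  shows "boundaries C d n +>\<^bsub>C n\<^esub> z = \<zero>\<^bsub>homology C d n\<^esub> \<longleftrightarrow> z \<in> boundaries C d n"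
  unfolding zero_homology
  by (rule coset_zero_iff[OF _ submodule_boundaries[OF assms(1)] assms(2)])
    (use assms(1) in \<open>simp add: chain_complex_def\<close>)

lemma class_eqI:
  assumes "chain_complex R C d" "x \<in> carrier (C n)" "y \<in> carrier (C n)" "b \<in> boundaries C d n"
    "x = b \<oplus>\<^bsub>C n\<^esub> y"
  shows "boundaries C d n +>\<^bsub>C n\<^esub> x = boundaries C d n +>\<^bsub>C n\<^esub> y"
proof -
  have "Module.module R (C n)" using assms(1) by (simp add: chain_complex_def)
  from coset_eq_iff[OF this submodule_boundaries[OF assms(1)] assms(2,3)] assms(4,5)
  show ?thesis by blast
qed

text \<open>All representatives of a class give the same value, so the union defining the induced map
  is the class of the image of any one of them.\<close>

lemma homology_map_class:
  assumes C: "chain_complex R C d" and D: "chain_complex R D e"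
    and \<phi>: "linear_map R (C n) (D n) \<phi>"
    and bd: "\<And>b. b \<in> boundaries C d n \<Longrightarrow> \<phi> b \<in> boundaries D e n"
    and z: "z \<in> carrier (C n)"
  shows "homology_map D e n \<phi> (boundaries C d n +>\<^bsub>C n\<^esub> z) = boundaries D e n +>\<^bsub>D n\<^esub> \<phi> z"
proof -
  have mC: "Module.module R (C n)" and mD: "Module.module R (D n)"
    using C D by (simp_all add: chain_complex_def)
  have "boundaries D e n +>\<^bsub>D n\<^esub> \<phi> y = boundaries D e n +>\<^bsub>D n\<^esub> \<phi> z"
    if y: "y \<in> boundaries C d n +>\<^bsub>C n\<^esub> z" for y
  proof -
    obtain b where b: "b \<in> boundaries C d n" "y = b \<oplus>\<^bsub>C n\<^esub> z" using y unfolding mem_coset_iff by blast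
    have bc: "b \<in> carrier (C n)" using submodule_subset[OF submodule_boundaries[OF C] b(1)] .
    have "\<phi> y = \<phi> b \<oplus>\<^bsub>D n\<^esub> \<phi> z" unfolding b(2) by (rule linear_map_add[OF \<phi> bc z])
    moreover have "y \<in> carrier (C n)"
      unfolding b(2) using mC bc z by (simp add: Module.module_def abelian_group_def abelian_monoid.a_closed)
    ultimately show ?thesis
      using class_eqI[OF D linear_map_closed[OF \<phi>] linear_map_closed[OF \<phi> z] bd[OF b(1)]] by blast
  qed
  moreover have "z \<in> boundaries C d n +>\<^bsub>C n\<^esub> z"
    by (rule mem_coset[OF mC submodule_boundaries[OF C] z])
  ultimately show ?thesis unfolding homology_map_def by (intro SUP_eq_const) blast+
qed

lemma free_space_mono:
  "S \<subseteq> T \<Longrightarrow> c \<in> carrier (free_space R S) \<Longrightarrow> c \<in> carrier (free_space R T)"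
  by (auto simp: free_space_def)

lemma linear_map_free_space_subset:
  assumes "linear_map R (free_space R T) N h" "S \<subseteq> T"
  shows "linear_map R (free_space R S) N h"
  using assms free_space_mono[OF assms(2)]
  by (intro linear_mapI)
    (auto simp: free_space_simps linear_map_closed linear_map_add[OF assms(1), unfolded free_space_simps]
      linear_map_smult[OF assms(1), unfolded free_space_simps])

definition restrict_chain :: "('s \<Rightarrow> bool) \<Rightarrow> ('s \<Rightarrow> 'a) \<Rightarrow> 's \<Rightarrow> 'a" where
  "restrict_chain P c = (\<lambda>s. if P s then c s else \<zero>)"

lemma restrict_chain_closed:
  assumes "c \<in> carrier (free_space R S)" "\<And>s. s \<in> S \<Longrightarrow> P s \<Longrightarrow> s \<in> T"
  shows "restrict_chain P c \<in> carrier (free_space R T)"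
  by (rule free_spaceI[where A = "{s. c s \<noteq> \<zero>} \<inter> {s. P s}"])
    (use free_spaceD(1-3)[OF assms(1)] assms(2) in \<open>auto simp: restrict_chain_def\<close>)

lemma linear_map_restrict_chain:
  assumes "\<And>s. s \<in> S \<Longrightarrow> P s \<Longrightarrow> s \<in> T"
  shows "linear_map R (free_space R S) (free_space R T) (restrict_chain P)"
proof (rule linear_mapI)
  show "restrict_chain P c \<in> carrier (free_space R T)" if "c \<in> carrier (free_space R S)" for c
    by (rule restrict_chain_closed[OF that assms])
qed (auto simp: free_space_simps restrict_chain_def fun_eq_iff)

lemma restrict_chain_single:
  "restrict_chain P (single s) = (if P s then single s else (\<lambda>b. \<zero>))"
  by (auto simp: restrict_chain_def single_def)

lemma restrict_chain_id:
  assumes "c \<in> carrier (free_space R S)" "\<And>s. s \<in> S \<Longrightarrow> P s"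
  shows "restrict_chain P c = c"
proof
  fix s show "restrict_chain P c s = c s"
  proof (cases "P s")
    case False
    then have "s \<notin> S" using assms(2) by blast
    from free_spaceD(4)[OF assms(1) this] show ?thesis by (simp add: restrict_chain_def)
  qed (simp add: restrict_chain_def)
qed

end

section \<open>The simplicial chain complex\<close>

locale oriented_complex = field K for K :: "('k, 'r) ring_scheme" (structure) +
  fixes X :: "'v set set" and ori :: "'v set \<Rightarrow> 'v list"
  assumes complex: "is_complex X" and orient: "orientation X ori"
begin

lemma simplices_card: "\<sigma> \<in> simplices X d \<longleftrightarrow> \<sigma> \<in> X \<and> card \<sigma> = Suc d"
proof -
  have "card \<sigma> \<noteq> 0" if "\<sigma> \<in> X"
    using simplex_finite[OF complex that] simplex_nonempty[OF complex that] by simp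
  then show ?thesis by (auto simp: simplices_def sdim_def)
qed

lemma face_simplices:
  assumes "\<sigma> \<in> simplices X (Suc d)" "u \<in> \<sigma>"
  shows "\<sigma> - {u} \<in> simplices X d"
proof -
  have \<sigma>: "\<sigma> \<in> X" "card \<sigma> = Suc (Suc d)" using assms(1) by (simp_all add: simplices_card)
  then have c: "card (\<sigma> - {u}) = Suc d" using assms(2) by simp
  have "\<sigma> - {u} \<noteq> {}"
  proof
    assume "\<sigma> - {u} = {}"
    show False using c unfolding \<open>\<sigma> - {u} = {}\<close> by simp
  qed
  then have "\<sigma> - {u} \<in> X" using face_in_complex[OF complex \<sigma>(1), of "\<sigma> - {u}"] by blast
  then show ?thesis using c by (simp add: simplices_card)
qed

lemma incidence_nonzero_face:
  assumes "\<sigma> \<in> X" "incidence ori \<sigma> \<rho> \<noteq> 0"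
  obtains u where "u \<in> \<sigma>" "\<rho> = \<sigma> - {u}"
  using incidence_nonface[OF complex orient assms(1), of \<rho>] assms(2) by blast

text \<open>The boundary of the basis element \<open>\<sigma>\<close>, as shown by
  \<open>boundary_single\<close> below.\<close>

definition incidence_chain :: "'v set \<Rightarrow> 'v set \<Rightarrow> 'k" where
  "incidence_chain \<sigma> = (\<lambda>\<rho>. of_integer (incidence ori \<sigma> \<rho>))"

lemma incidence_chain_closed:
  assumes "\<sigma> \<in> simplices X (Suc d)"
  shows "incidence_chain \<sigma> \<in> carrier (chains K X d)"
  unfolding chains_def incidence_chain_def
proof (rule free_spaceI[where A = "(\<lambda>u. \<sigma> - {u}) ` \<sigma>"])
  have \<sigma>: "\<sigma> \<in> X" using assms by (simp add: simplices_def)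
  show "finite ((\<lambda>u. \<sigma> - {u}) ` \<sigma>)" using simplex_finite[OF complex \<sigma>] by simp
  show "(\<lambda>u. \<sigma> - {u}) ` \<sigma> \<subseteq> simplices X d" using face_simplices[OF assms] by blast
  show "of_integer (incidence ori \<sigma> \<rho>) = \<zero>" if "\<rho> \<notin> (\<lambda>u. \<sigma> - {u}) ` \<sigma>" for \<rho>
  proof -
    have "incidence ori \<sigma> \<rho> = 0" using incidence_nonzero_face[OF \<sigma>, of \<rho>] that by blast
    then show ?thesis by simp
  qed
qed simp

lemma oriented_simplex_eq:
  "oriented_simplex K ori us =
    (\<lambda>\<rho>. of_integer (if set us = \<rho> then reorder_sign (ori \<rho>) us else 0))"
  by (auto simp: oriented_simplex_def of_integer_def[symmetric] fun_eq_iff)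

lemma boundary_term:
  assumes "\<sigma> \<in> simplices X (Suc d)"
  shows "(\<Oplus>\<^bsub>chains K X d\<^esub>i\<in>{..Suc d}.
      [((-1) ^ i :: int)] \<cdot>\<^bsub>chains K X d\<^esub> oriented_simplex K ori (delete_nth i (ori \<sigma>))) =
    incidence_chain \<sigma>" (is "finsum _ ?g _ = _")
proof
  fix \<rho>
  have \<sigma>: "\<sigma> \<in> X" and card: "card \<sigma> = Suc (Suc d)" using assms by (simp_all add: simplices_card)
  note o = ori_props[OF complex orient \<sigma>]
  have mod: "Module.module K (chains K X d)" unfolding chains_def by (rule module_free_space)
  have os: "oriented_simplex K ori (delete_nth i (ori \<sigma>)) \<in> carrier (chains K X d)"
    if "i \<in> {..Suc d}" for i
  proof -
    have i: "i < length (ori \<sigma>)" using that card o(3) by simp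
    have s: "set (delete_nth i (ori \<sigma>)) = \<sigma> - {ori \<sigma> ! i}"
      using set_delete_nth[OF o(1) i] o(2) by simp
    moreover have "ori \<sigma> ! i \<in> \<sigma>" using nth_mem[OF i] o(2) by simp
    ultimately have "set (delete_nth i (ori \<sigma>)) \<in> simplices X d" using face_simplices[OF assms] by simp
    then show ?thesis unfolding chains_def oriented_simplex_eq
      by (intro free_spaceI[where A = "{set (delete_nth i (ori \<sigma>))}"]) auto
  qed
  have g: "?g i = of_integer ((-1) ^ i) \<odot>\<^bsub>chains K X d\<^esub> oriented_simplex K ori (delete_nth i (ori \<sigma>))"
    if "i \<in> {..Suc d}" for i
    by (rule integer_multiple[OF mod os[OF that]])
  have gc: "?g i \<in> carrier (chains K X d)" if "i \<in> {..Suc d}" for i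
    unfolding g[OF that] using Module.module.smult_closed[OF mod _ os[OF that]] by simp
  have "finsum (chains K X d) ?g {..Suc d} \<rho> = (\<Oplus>i\<in>{..Suc d}. ?g i \<rho>)"
    using finsum_free_space[of "{..Suc d}" ?g "simplices X d" \<rho>] gc by (simp only: chains_def finite_atMost)
  also have "\<dots> = (\<Oplus>i\<in>{..Suc d}. of_integer (if set (delete_nth i (ori \<sigma>)) = \<rho>
      then (- 1) ^ i * reorder_sign (ori \<rho>) (delete_nth i (ori \<sigma>)) else 0))"
  proof (rule finsum_cong')
    fix i assume "i \<in> {..Suc d}"
    from g[OF this] show "?g i \<rho> = of_integer (if set (delete_nth i (ori \<sigma>)) = \<rho>
      then (- 1) ^ i * reorder_sign (ori \<rho>) (delete_nth i (ori \<sigma>)) else 0)"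
      by (cases "set (delete_nth i (ori \<sigma>)) = \<rho>")
        (simp_all add: chains_def free_space_simps oriented_simplex_eq of_integer_mult)
  qed simp_all
  also have "\<dots> = of_integer (incidence ori \<sigma> \<rho>)"
    unfolding incidence_def card lessThan_Suc_atMost by (rule of_integer_sum[symmetric]) simp
  finally show "finsum (chains K X d) ?g {..Suc d} \<rho> = incidence_chain \<sigma> \<rho>"
    by (simp add: incidence_chain_def)
qed

lemma boundary_eq:
  assumes c: "c \<in> carrier (free_space K S)" and S: "S \<subseteq> simplices X (Suc d)"
  shows "boundary K X ori (Suc d) c = linear_extension K (chains K X d) incidence_chain c"
proof -
  have mod: "Module.module K (chains K X d)" unfolding chains_def by (rule module_free_space)
  let ?g = "\<lambda>\<sigma>. \<Oplus>\<^bsub>chains K X d\<^esub>i\<in>{..Suc d}.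
      [((-1) ^ i :: int)] \<cdot>\<^bsub>chains K X d\<^esub> oriented_simplex K ori (delete_nth i (ori \<sigma>))"
  have g: "?g \<sigma> = incidence_chain \<sigma>" if "\<sigma> \<in> S" for \<sigma> using boundary_term that S by blast
  have ic: "incidence_chain \<sigma> \<in> carrier (chains K X d)" if "\<sigma> \<in> S" for \<sigma>
    using incidence_chain_closed that S by blast
  interpret M: Module.module K "chains K X d" by (rule mod)
  show ?thesis
    unfolding boundary_def diff_Suc_1 linear_extension_def
    by (rule M.finsum_cong') (use free_spaceD[OF c] g ic in auto)
qed

lemma linear_map_boundary: "linear_map K (chains K X (Suc d)) (chains K X d) (boundary K X ori (Suc d))"
proof (rule linear_map_cong)
  show "Module.module K (chains K X (Suc d))" unfolding chains_def by (rule module_free_space)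
  show "linear_map K (chains K X (Suc d)) (chains K X d) (linear_extension K (chains K X d) incidence_chain)"
    using incidence_chain_closed unfolding chains_def
    by (intro linear_map_linear_extension[OF module_free_space]) auto
qed (rule boundary_eq[symmetric, OF _ subset_refl], simp add: chains_def)

lemma boundary_apply:
  assumes c: "c \<in> carrier (chains K X (Suc d))" and A: "finite A" "{\<sigma>. c \<sigma> \<noteq> \<zero>} \<subseteq> A" "A \<subseteq> simplices X (Suc d)"
  shows "boundary K X ori (Suc d) c \<rho> = (\<Oplus>\<sigma>\<in>A. c \<sigma> \<otimes> of_integer (incidence ori \<sigma> \<rho>))"
proof -
  note mod = module_free_space[of "simplices X d"]
  interpret M: Module.module K "free_space K (simplices X d)" by (rule mod)
  have c': "c \<in> carrier (free_space K (simplices X (Suc d)))" using c by (simp add: chains_def)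
  have ic: "incidence_chain \<sigma> \<in> carrier (free_space K (simplices X d))" if "\<sigma> \<in> simplices X (Suc d)" for \<sigma>
    using incidence_chain_closed that by (simp add: chains_def)
  have "boundary K X ori (Suc d) c \<rho> =
      (\<Oplus>\<^bsub>free_space K (simplices X d)\<^esub>\<sigma>\<in>A. c \<sigma> \<odot>\<^bsub>free_space K (simplices X d)\<^esub> incidence_chain \<sigma>) \<rho>"
    unfolding boundary_eq[OF c' subset_refl] chains_def
    using linear_extension_superset[OF mod ic c' A] by simp
  also have "\<dots> = (\<Oplus>\<sigma>\<in>A. (c \<sigma> \<odot>\<^bsub>free_space K (simplices X d)\<^esub> incidence_chain \<sigma>) \<rho>)"
    by (rule finsum_free_space[OF A(1)]) (use A(3) ic free_spaceD(1)[OF c'] in auto)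
  finally show ?thesis by (simp add: free_space_simps incidence_chain_def)
qed

lemma boundary_single:
  assumes "\<sigma> \<in> simplices X (Suc d)"
  shows "boundary K X ori (Suc d) (single \<sigma>) = incidence_chain \<sigma>"
proof -
  have s: "single \<sigma> \<in> carrier (free_space K (simplices X (Suc d)))"
    by (rule single_in_free_space) fact
  show ?thesis
    unfolding boundary_eq[OF s subset_refl]
    unfolding chains_def
    by (rule linear_extension_single[OF module_free_space, where S = "simplices X (Suc d)"])
      (use assms incidence_chain_closed in \<open>auto simp: chains_def\<close>)
qed

lemma boundary_boundary:
  assumes "c \<in> carrier (chains K X (Suc (Suc d)))"
  shows "boundary K X ori (Suc d) (boundary K X ori (Suc (Suc d)) c) = \<zero>\<^bsub>chains K X d\<^esub>"
proof (rule linear_map_eq_on_basis[where S = "simplices X (Suc (Suc d))" and N = "chains K X d"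
      and h = "\<lambda>c. boundary K X ori (Suc d) (boundary K X ori (Suc (Suc d)) c)"
      and g = "\<lambda>c. \<zero>\<^bsub>chains K X d\<^esub>"])
  show mod: "Module.module K (chains K X d)" unfolding chains_def by (rule module_free_space)
  interpret M: Module.module K "chains K X d" by (rule mod)
  show "linear_map K (free_space K (simplices X (Suc (Suc d)))) (chains K X d)
      (\<lambda>c. boundary K X ori (Suc d) (boundary K X ori (Suc (Suc d)) c))"
    unfolding chains_def[symmetric] by (rule linear_map_comp[OF linear_map_boundary linear_map_boundary])
  show "linear_map K (free_space K (simplices X (Suc (Suc d)))) (chains K X d) (\<lambda>c. \<zero>\<^bsub>chains K X d\<^esub>)"
    by (rule linear_mapI) simp_all
  fix \<sigma> assume \<sigma>: "\<sigma> \<in> simplices X (Suc (Suc d))"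
  then have \<sigma>X: "\<sigma> \<in> X" "card \<sigma> \<ge> 3" by (simp_all add: simplices_card)
  let ?A = "(\<lambda>u. \<sigma> - {u}) ` \<sigma>"
  have A: "finite ?A" "?A \<subseteq> simplices X (Suc d)"
    using simplex_finite[OF complex \<sigma>X(1)] face_simplices[OF \<sigma>] by auto
  \<comment> \<open>Summing over all facets instead of the support lets the integer identity for
    incidence numbers apply.\<close>
  have supp: "{\<rho>. incidence_chain \<sigma> \<rho> \<noteq> \<zero>} \<subseteq> ?A"
  proof
    fix \<rho> assume "\<rho> \<in> {\<rho>. incidence_chain \<sigma> \<rho> \<noteq> \<zero>}"
    then have "incidence ori \<sigma> \<rho> \<noteq> 0" by (auto simp: incidence_chain_def)
    then show "\<rho> \<in> ?A" by (rule incidence_nonzero_face[OF \<sigma>X(1)]) blast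
  qed
  show "boundary K X ori (Suc d) (boundary K X ori (Suc (Suc d)) (single \<sigma>)) = \<zero>\<^bsub>chains K X d\<^esub>"
  proof
    fix \<pi>
    have "boundary K X ori (Suc d) (incidence_chain \<sigma>) \<pi> =
        (\<Oplus>\<rho>\<in>?A. incidence_chain \<sigma> \<rho> \<otimes> of_integer (incidence ori \<rho> \<pi>))"
      by (rule boundary_apply[OF incidence_chain_closed[OF \<sigma>] A(1) supp A(2)])
    also have "\<dots> = of_integer (\<Sum>\<rho>\<in>?A. incidence ori \<sigma> \<rho> * incidence ori \<rho> \<pi>)"
      unfolding of_integer_sum[OF A(1)] incidence_chain_def of_integer_mult ..
    also have "\<dots> = \<zero>" unfolding incidence_incidence[OF complex orient \<sigma>X] by simp
    finally show "boundary K X ori (Suc d) (boundary K X ori (Suc (Suc d)) (single \<sigma>)) \<pi> = \<zero>\<^bsub>chains K X d\<^esub> \<pi>"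
      unfolding boundary_single[OF \<sigma>] by (simp add: chains_def free_space_simps)
  qed
qed (use assms in \<open>simp add: chains_def\<close>)

lemma chain_complex_simplicial: "chain_complex K (chains K X) (boundary K X ori)"
  unfolding chain_complex_def
  using linear_map_boundary boundary_boundary by (auto simp: chains_def module_free_space)

end

section \<open>Chains over the simplices of the base\<close>

locale fibered_complex = oriented_complex K X ori
  for K :: "('k, 'r) ring_scheme" (structure) and X :: "'v set set" and ori +
  fixes Y :: "'w set set" and f :: "'v \<Rightarrow> 'w" and s :: "'w set \<Rightarrow> 'k"
  assumes base_complex: "is_complex Y" and simplicial: "simplicial_map X Y f"
    and s_closed [simp]: "s \<tau> \<in> carrier K" and s_square: "s \<tau> \<otimes> s \<tau> = \<one>"
begin

abbreviation bd :: "nat \<Rightarrow> ('v set \<Rightarrow> 'k) \<Rightarrow> 'v set \<Rightarrow> 'k" where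
  "bd \<equiv> boundary K X ori"

abbreviation zero_chain :: "'v set \<Rightarrow> 'k" where
  "zero_chain \<equiv> \<lambda>_. \<zero>"

text \<open>The piece of a chain over one simplex of the base, and over all simplices of one
  dimension. The filtration of the chains of \<open>X\<close> by the dimension of the image has
  the pieces \<open>part p\<close> as its graded parts.\<close>

definition res :: "'w set \<Rightarrow> ('v set \<Rightarrow> 'k) \<Rightarrow> 'v set \<Rightarrow> 'k" where
  "res \<tau> = restrict_chain (\<lambda>\<sigma>. f ` \<sigma> = \<tau>)"

definition part :: "nat \<Rightarrow> ('v set \<Rightarrow> 'k) \<Rightarrow> 'v set \<Rightarrow> 'k" where
  "part p = restrict_chain (\<lambda>\<sigma>. sdim (f ` \<sigma>) = p)"

definition over :: "'w set \<Rightarrow> nat \<Rightarrow> 'v set set" where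
  "over \<tau> n = {\<sigma> \<in> simplices X n. f ` \<sigma> = \<tau>}"

definition over_dim :: "nat \<Rightarrow> nat \<Rightarrow> 'v set set" where
  "over_dim p n = {\<sigma> \<in> simplices X n. sdim (f ` \<sigma>) = p}"

abbreviation Ch :: "nat \<Rightarrow> ('k, 'v set \<Rightarrow> 'k) module" where
  "Ch n \<equiv> free_space K (simplices X n)"

abbreviation Ch_over :: "'w set \<Rightarrow> nat \<Rightarrow> ('k, 'v set \<Rightarrow> 'k) module" where
  "Ch_over \<tau> n \<equiv> free_space K (over \<tau> n)"

abbreviation Ch_dim :: "nat \<Rightarrow> nat \<Rightarrow> ('k, 'v set \<Rightarrow> 'k) module" where
  "Ch_dim p n \<equiv> free_space K (over_dim p n)"

lemma over_subset: "over \<tau> n \<subseteq> simplices X n" "over_dim p n \<subseteq> simplices X n"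
  by (auto simp: over_def over_dim_def)

lemma over_subset_over_dim: "sdim \<tau> = p \<Longrightarrow> over \<tau> n \<subseteq> over_dim p n"
  by (auto simp: over_def over_dim_def)

lemma image_in_base: "\<sigma> \<in> simplices X n \<Longrightarrow> f ` \<sigma> \<in> Y"
  using simplicial by (auto simp: simplicial_map_def simplices_def)

lemma over_dim_image: "\<sigma> \<in> over_dim p n \<Longrightarrow> f ` \<sigma> \<in> simplices Y p"
  using image_in_base by (auto simp: over_dim_def simplices_def)

lemma base_eqI:
  assumes "\<tau> \<in> simplices Y p" "\<tau>' \<in> simplices Y p" "\<tau> \<subseteq> \<tau>'"
  shows "\<tau> = \<tau>'"
proof -
  have *: "\<tau> \<in> Y" "\<tau>' \<in> Y" "card \<tau> - 1 = card \<tau>' - 1" using assms by (auto simp: simplices_def sdim_def)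
  then have "finite \<tau>" "finite \<tau>'" "card \<tau> \<noteq> 0" "card \<tau>' \<noteq> 0"
    using simplex_finite[OF base_complex] simplex_nonempty[OF base_complex] by auto
  then have "card \<tau> = card \<tau>'" using *(3) by arith
  then show ?thesis using \<open>finite \<tau>'\<close> assms(3) by (intro card_subset_eq)
qed

lemma fiber_chains_eq: "fiber_chains K X f \<tau> q = Ch_over \<tau> (sdim \<tau> + q)"
  unfolding fiber_chains_def chains_def free_space_def over_def fiber_def
  by (auto simp: simplices_def)

lemma res_closed:
  assumes "c \<in> carrier (free_space K S)" "S \<subseteq> simplices X n"
  shows "res \<tau> c \<in> carrier (Ch_over \<tau> n)"
  unfolding res_def by (rule restrict_chain_closed[OF assms(1)]) (use assms(2) in \<open>auto simp: over_def\<close>)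

lemma part_closed:
  assumes "c \<in> carrier (free_space K S)" "S \<subseteq> simplices X n"
  shows "part p c \<in> carrier (Ch_dim p n)"
  unfolding part_def
  by (rule restrict_chain_closed[OF assms(1)]) (use assms(2) in \<open>auto simp: over_dim_def\<close>)

lemma linear_map_res: "linear_map K (Ch n) (Ch_over \<tau> n) (res \<tau>)"
  unfolding res_def by (rule linear_map_restrict_chain) (auto simp: over_def)

lemma linear_map_bd: "linear_map K (Ch (Suc n)) (Ch n) (bd (Suc n))"
  using linear_map_boundary unfolding chains_def .

lemma bd_closed: "c \<in> carrier (free_space K S) \<Longrightarrow> S \<subseteq> simplices X (Suc n) \<Longrightarrow>
    bd (Suc n) c \<in> carrier (Ch n)"
  using linear_map_closed[OF linear_map_bd] free_space_mono by blast

lemma bd_zero: "bd (Suc n) zero_chain = zero_chain"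
  using linear_map_zero[OF module_free_space module_free_space linear_map_bd]
  by (simp add: free_space_simps)

lemma res_part: "sdim \<tau> = p \<Longrightarrow> res \<tau> (part p c) = res \<tau> c"
  by (auto simp: res_def part_def restrict_chain_def fun_eq_iff)

lemma res_res: "res \<tau> (res \<tau> c) = res \<tau> c"
  by (auto simp: res_def restrict_chain_def fun_eq_iff)

lemma res_other: "c \<in> carrier (Ch_over \<tau>' n) \<Longrightarrow> \<tau> \<noteq> \<tau>' \<Longrightarrow> res \<tau> c = zero_chain"
  using free_spaceD(4)[of c "over \<tau>' n"] by (auto simp: res_def restrict_chain_def over_def fun_eq_iff)

lemma res_id: "c \<in> carrier (Ch_over \<tau> n) \<Longrightarrow> res \<tau> c = c"
  unfolding res_def by (rule restrict_chain_id) (auto simp: over_def)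

lemma part_id: "c \<in> carrier (Ch_dim p n) \<Longrightarrow> part p c = c"
  unfolding part_def by (rule restrict_chain_id) (auto simp: over_dim_def)

lemma chain_eqI:
  assumes "c \<in> carrier (Ch_dim p n)" "d \<in> carrier (Ch_dim p n)"
    and "\<And>\<tau>. \<tau> \<in> simplices Y p \<Longrightarrow> res \<tau> c = res \<tau> d"
  shows "c = d"
proof
  fix \<sigma>
  show "c \<sigma> = d \<sigma>"
  proof (cases "\<sigma> \<in> over_dim p n")
    case True
    from fun_cong[OF assms(3)[OF over_dim_image[OF True]], of \<sigma>] show ?thesis
      by (simp add: res_def restrict_chain_def)
  next
    case False
    then show ?thesis using free_spaceD(4)[OF assms(1)] free_spaceD(4)[OF assms(2)] by simp
  qed
qed

lemma res_zero: "res \<tau> zero_chain = zero_chain"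
  by (simp add: res_def restrict_chain_def)

text \<open>The image of a face is contained in the image of the simplex.\<close>

lemma res_bd_above:
  assumes c: "c \<in> carrier (Ch (Suc n))"
  shows "res \<tau> (bd (Suc n) c) = res \<tau> (bd (Suc n) (restrict_chain (\<lambda>\<sigma>. \<tau> \<subseteq> f ` \<sigma>) c))"
proof (rule linear_map_eq_on_basis[where S = "simplices X (Suc n)" and N = "Ch_over \<tau> n"
      and h = "\<lambda>c. res \<tau> (bd (Suc n) c)"
      and g = "\<lambda>c. res \<tau> (bd (Suc n) (restrict_chain (\<lambda>\<sigma>. \<tau> \<subseteq> f ` \<sigma>) c))"])
  show h: "linear_map K (Ch (Suc n)) (Ch_over \<tau> n)
      (\<lambda>c. res \<tau> (bd (Suc n) c))"
    by (rule linear_map_comp[OF linear_map_bd linear_map_res])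
  show "linear_map K (Ch (Suc n)) (Ch_over \<tau> n)
      (\<lambda>c. res \<tau> (bd (Suc n) (restrict_chain (\<lambda>\<sigma>. \<tau> \<subseteq> f ` \<sigma>) c)))"
    by (rule linear_map_comp[OF linear_map_restrict_chain h]) simp
  fix \<sigma> assume \<sigma>: "\<sigma> \<in> simplices X (Suc n)"
  then have \<sigma>X: "\<sigma> \<in> X" by (simp add: simplices_def)
  show "res \<tau> (bd (Suc n) (single \<sigma>)) =
      res \<tau> (bd (Suc n) (restrict_chain (\<lambda>\<sigma>. \<tau> \<subseteq> f ` \<sigma>) (single \<sigma>)))"
  proof (cases "\<tau> \<subseteq> f ` \<sigma>")
    case False
    have "incidence ori \<sigma> \<rho> = 0" if "f ` \<rho> = \<tau>" for \<rho>
    proof (rule ccontr)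
      assume "incidence ori \<sigma> \<rho> \<noteq> 0"
      then obtain u where "\<rho> = \<sigma> - {u}" by (rule incidence_nonzero_face[OF \<sigma>X])
      then show False using that False by blast
    qed
    then have "res \<tau> (incidence_chain \<sigma>) = zero_chain"
      by (auto simp: res_def restrict_chain_def incidence_chain_def fun_eq_iff)
    then show ?thesis using False
      by (simp add: boundary_single[OF \<sigma>] restrict_chain_single res_zero bd_zero)
  qed (simp add: restrict_chain_single)
qed (use c in \<open>simp_all add: module_free_space\<close>)

text \<open>Distinct simplices of the same dimension do not contain each other, so a simplex lying
  over another \<open>p\<close>-simplex has no face over \<open>\<tau>\<close>.\<close>

lemma res_bd_same_dim:
  assumes c: "c \<in> carrier (Ch_dim p (Suc n))" and \<tau>: "\<tau> \<in> simplices Y p"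
  shows "res \<tau> (bd (Suc n) c) = res \<tau> (bd (Suc n) (res \<tau> c))"
proof -
  have "restrict_chain (\<lambda>\<sigma>. \<tau> \<subseteq> f ` \<sigma>) c = res \<tau> c"
  proof
    fix \<sigma>
    show "restrict_chain (\<lambda>\<sigma>. \<tau> \<subseteq> f ` \<sigma>) c \<sigma> = res \<tau> c \<sigma>"
    proof (cases "\<sigma> \<in> over_dim p (Suc n)")
      case True
      then have "\<tau> \<subseteq> f ` \<sigma> \<longleftrightarrow> f ` \<sigma> = \<tau>"
        using base_eqI[OF \<tau> over_dim_image[OF True]] by blast
      then show ?thesis by (simp add: res_def restrict_chain_def)
    next
      case False
      from free_spaceD(4)[OF c this] show ?thesis by (simp add: res_def restrict_chain_def)
    qed
  qed
  then show ?thesis using res_bd_above[OF free_space_mono[OF over_subset(2) c]] by simp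
qed

lemma fiber_boundary_eq:
  assumes "c \<in> carrier (Ch_over \<tau> (Suc (sdim \<tau> + q)))"
  shows "fiber_boundary K X ori f \<tau> (Suc q) c = res \<tau> (bd (Suc (sdim \<tau> + q)) c)"
proof
  fix \<sigma>
  have b: "bd (Suc (sdim \<tau> + q)) c \<in> carrier (Ch (sdim \<tau> + q))"
    by (rule bd_closed[OF assms over_subset(1)])
  have "bd (Suc (sdim \<tau> + q)) c \<sigma> = \<zero>" if "\<sigma> \<notin> X"
    by (rule free_spaceD(4)[OF b]) (use that in \<open>simp add: simplices_def\<close>)
  then show "fiber_boundary K X ori f \<tau> (Suc q) c \<sigma> = res \<tau> (bd (Suc (sdim \<tau> + q)) c) \<sigma>"
    by (auto simp: fiber_boundary_def fiber_def res_def restrict_chain_def)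
qed

text \<open>The square of the boundary of the fibre is the piece over \<open>\<tau>\<close> of the
  square of the boundary of \<open>X\<close>: discarding, between the two boundaries, the
  simplices that do not lie over \<open>\<tau>\<close> is harmless, because they lie over proper
  faces of \<open>\<tau>\<close> and so have no face over \<open>\<tau>\<close>.\<close>

lemma chain_complex_fiber: "chain_complex K (fiber_chains K X f \<tau>) (fiber_boundary K X ori f \<tau>)"
proof -
  have lin: "linear_map K (Ch_over \<tau> (Suc (sdim \<tau> + q))) (Ch_over \<tau> (sdim \<tau> + q))
      (fiber_boundary K X ori f \<tau> (Suc q))" for q
  proof (rule linear_map_cong[OF module_free_space])
    show "linear_map K (Ch_over \<tau> (Suc (sdim \<tau> + q))) (Ch_over \<tau> (sdim \<tau> + q))
      (\<lambda>c. res \<tau> (bd (Suc (sdim \<tau> + q)) c))"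
      by (rule linear_map_free_space_subset[OF linear_map_comp[OF linear_map_bd linear_map_res] over_subset(1)])
  qed (simp add: fiber_boundary_eq)
  have sq: "fiber_boundary K X ori f \<tau> (Suc q) (fiber_boundary K X ori f \<tau> (Suc (Suc q)) c) = zero_chain"
    if c: "c \<in> carrier (Ch_over \<tau> (Suc (Suc (sdim \<tau> + q))))" for q c
  proof -
    let ?n = "sdim \<tau> + q"
    let ?b = "bd (Suc (Suc ?n)) c"
    have c': "c \<in> carrier (Ch_over \<tau> (Suc (sdim \<tau> + Suc q)))" using c by simp
    have e1: "fiber_boundary K X ori f \<tau> (Suc (Suc q)) c = res \<tau> ?b"
      using fiber_boundary_eq[OF c'] by simp
    have b: "?b \<in> carrier (Ch (Suc ?n))" by (rule bd_closed[OF c over_subset(1)])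
    have A: "{\<sigma>. c \<sigma> \<noteq> \<zero>} \<subseteq> over \<tau> (Suc (Suc ?n))" using free_spaceD(3)[OF c] .
    have "restrict_chain (\<lambda>\<sigma>. \<tau> \<subseteq> f ` \<sigma>) ?b = res \<tau> ?b"
    proof
      fix \<rho>
      have "?b \<rho> = \<zero>" if \<rho>: "\<tau> \<subset> f ` \<rho>"
      proof -
        have z: "c \<sigma> \<otimes> of_integer (incidence ori \<sigma> \<rho>) = \<zero>" if "\<sigma> \<in> {\<sigma>. c \<sigma> \<noteq> \<zero>}" for \<sigma>
        proof -
          have \<sigma>: "\<sigma> \<in> X" "f ` \<sigma> = \<tau>" using that A by (auto simp: over_def simplices_def)
          have "incidence ori \<sigma> \<rho> = 0"
          proof (rule ccontr)
            assume "incidence ori \<sigma> \<rho> \<noteq> 0"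
            then obtain u where "\<rho> = \<sigma> - {u}" by (rule incidence_nonzero_face[OF \<sigma>(1)])
            then show False using \<rho> \<sigma>(2) by blast
          qed
          then show ?thesis using free_spaceD(1)[OF c] by simp
        qed
        have "?b \<rho> = (\<Oplus>\<sigma>\<in>{\<sigma>. c \<sigma> \<noteq> \<zero>}. c \<sigma> \<otimes> of_integer (incidence ori \<sigma> \<rho>))"
          by (rule boundary_apply)
            (use free_spaceD(2)[OF c] A over_subset(1) free_space_mono[OF over_subset(1) c] in \<open>auto simp: chains_def\<close>)
        also have "\<dots> = (\<Oplus>\<sigma>\<in>{\<sigma>. c \<sigma> \<noteq> \<zero>}. \<zero>)" by (rule finsum_cong') (use z in auto)
        finally show ?thesis by simp
      qed
      then show "restrict_chain (\<lambda>\<sigma>. \<tau> \<subseteq> f ` \<sigma>) ?b \<rho> = res \<tau> ?b \<rho>"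
        by (auto simp: res_def restrict_chain_def)
    qed
    then have "res \<tau> (bd (Suc ?n) (res \<tau> ?b)) = res \<tau> (bd (Suc ?n) ?b)"
      using res_bd_above[OF b, of \<tau>] by simp
    also have "bd (Suc ?n) ?b = zero_chain"
      using boundary_boundary[of c ?n] free_space_mono[OF over_subset(1) c]
      by (simp add: chains_def free_space_simps)
    also have "res \<tau> zero_chain = zero_chain" by (simp add: res_def restrict_chain_def)
    finally show ?thesis
      unfolding e1 using fiber_boundary_eq[OF res_closed[OF b subset_refl]] by simp
  qed
  show ?thesis
    unfolding chain_complex_def fiber_chains_eq
    using lin sq by (simp add: module_free_space free_space_simps)
qed

abbreviation fiber_cycles :: "'w set \<Rightarrow> nat \<Rightarrow> ('v set \<Rightarrow> 'k) set" where
  "fiber_cycles \<tau> \<equiv> cycles (fiber_chains K X f \<tau>) (fiber_boundary K X ori f \<tau>)"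

abbreviation fiber_boundaries :: "'w set \<Rightarrow> nat \<Rightarrow> ('v set \<Rightarrow> 'k) set" where
  "fiber_boundaries \<tau> \<equiv> boundaries (fiber_chains K X f \<tau>) (fiber_boundary K X ori f \<tau>)"

abbreviation fiber_class :: "'w set \<Rightarrow> nat \<Rightarrow> ('v set \<Rightarrow> 'k) \<Rightarrow> ('v set \<Rightarrow> 'k) set" where
  "fiber_class \<tau> q z \<equiv> fiber_boundaries \<tau> q +>\<^bsub>fiber_chains K X f \<tau> q\<^esub> z"

abbreviation leray :: "nat \<Rightarrow> ('w, 'k, ('v set \<Rightarrow> 'k) set) cosheaf" where
  "leray \<equiv> leray_cosheaf K X ori f"

abbreviation lchains :: "nat \<Rightarrow> nat \<Rightarrow> ('k, 'w set \<Rightarrow> ('v set \<Rightarrow> 'k) set) module" where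
  "lchains q \<equiv> cosheaf_chains Y (leray q)"

lemma cobj_leray: "cobj (leray q) \<tau> = homology (fiber_chains K X f \<tau>) (fiber_boundary K X ori f \<tau>) q"
  by (simp add: leray_cosheaf_def)

lemma module_cobj: "Module.module K (cobj (leray q) \<tau>)"
  unfolding cobj_leray by (rule module_homology[OF chain_complex_fiber])

lemma fiber_cycle_iff:
  "x \<in> fiber_cycles \<tau> q \<longleftrightarrow> x \<in> carrier (Ch_over \<tau> (sdim \<tau> + q)) \<and>
    (q = 0 \<or> res \<tau> (bd (sdim \<tau> + q) x) = zero_chain)"
  by (cases q) (auto simp: cycles_def fiber_chains_eq fiber_boundary_eq free_space_simps)

lemma fiber_boundary_iff:
  "x \<in> fiber_boundaries \<tau> q \<longleftrightarrow>
    (\<exists>a\<in>carrier (Ch_over \<tau> (Suc (sdim \<tau> + q))). x = res \<tau> (bd (Suc (sdim \<tau> + q)) a))"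
  by (auto simp: boundaries_def fiber_chains_eq fiber_boundary_eq)

text \<open>The signs \<open>s \<tau>\<close> leave room to correct, simplex by simplex of the base, a mismatch between
  the boundary of \<open>X\<close> and the boundary of the cosheaf.\<close>

definition signed_res :: "'w set \<Rightarrow> ('v set \<Rightarrow> 'k) \<Rightarrow> 'v set \<Rightarrow> 'k" where
  "signed_res \<tau> c = (\<lambda>\<sigma>. s \<tau> \<otimes> res \<tau> c \<sigma>)"

text \<open>These are the cycles of the graded piece in filtration degree \<open>p\<close> of the
  chains of \<open>X\<close>. The map \<open>class_chain\<close> below identifies the homology of
  that piece with the cosheaf chains \<open>C\<^sub>p(Y; L\<^sub>q)\<close>; that it is onto and
  what its kernel is are \<open>class_chain_surj\<close> and
  \<open>class_chain_zero_iff\<close>.\<close>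

definition fiberwise_cycles :: "nat \<Rightarrow> nat \<Rightarrow> ('v set \<Rightarrow> 'k) set" where
  "fiberwise_cycles p q = {z \<in> carrier (Ch_dim p (p + q)).
     \<forall>\<tau>\<in>simplices Y p. res \<tau> z \<in> fiber_cycles \<tau> q}"

definition class_chain :: "nat \<Rightarrow> nat \<Rightarrow> ('v set \<Rightarrow> 'k) \<Rightarrow> 'w set \<Rightarrow> ('v set \<Rightarrow> 'k) set" where
  "class_chain p q z = (\<lambda>\<tau>\<in>simplices Y p. fiber_class \<tau> q (signed_res \<tau> z))"

lemma linear_map_signed_res:
  "linear_map K (Ch n) (Ch_over \<tau> n) (signed_res \<tau>)"
proof (rule linear_mapI)
  interpret F: Module.module K "Ch_over \<tau> n" by (rule module_free_space)
  have e: "signed_res \<tau> c = s \<tau> \<odot>\<^bsub>Ch_over \<tau> n\<^esub> res \<tau> c" for c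
    by (simp add: signed_res_def free_space_simps)
  note r = linear_map_closed[OF linear_map_res]
  fix c assume c: "c \<in> carrier (Ch n)"
  show "signed_res \<tau> c \<in> carrier (Ch_over \<tau> n)" unfolding e using r[OF c] by simp
  show "signed_res \<tau> (c \<oplus>\<^bsub>Ch n\<^esub> d) =
      signed_res \<tau> c \<oplus>\<^bsub>Ch_over \<tau> n\<^esub> signed_res \<tau> d"
    if d: "d \<in> carrier (Ch n)" for d
    unfolding e linear_map_add[OF linear_map_res c d] using r[OF c] r[OF d] by (simp add: F.smult_r_distr)
  show "signed_res \<tau> (a \<odot>\<^bsub>Ch n\<^esub> c) =
      a \<odot>\<^bsub>Ch_over \<tau> n\<^esub> signed_res \<tau> c" if a: "a \<in> carrier K" for a
    unfolding e linear_map_smult[OF linear_map_res a c]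
    using r[OF c] a by (simp add: F.smult_assoc1[symmetric] m_comm)
qed

lemma signed_res_twice:
  assumes "c \<in> carrier (free_space K S)"
  shows "s \<tau> \<otimes> (s \<tau> \<otimes> res \<tau> c \<sigma>) = res \<tau> c \<sigma>"
proof -
  have "res \<tau> c \<sigma> \<in> carrier K" using free_spaceD(1)[OF assms] by (simp add: res_def restrict_chain_def)
  then show ?thesis by (simp add: m_assoc[symmetric] s_square)
qed

lemma fiberwise_cyclesD:
  assumes "z \<in> fiberwise_cycles p q"
  shows "z \<in> carrier (Ch_dim p (p + q))" "z \<in> carrier (Ch (p + q))"
    "\<tau> \<in> simplices Y p \<Longrightarrow> res \<tau> z \<in> fiber_cycles \<tau> q"
  using assms free_space_mono[OF over_subset(2)] by (auto simp: fiberwise_cycles_def)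

lemma submodule_fiber_cycles: "submodule (fiber_cycles \<tau> q) K (Ch_over \<tau> (sdim \<tau> + q))"
  using submodule_cycles[OF chain_complex_fiber] unfolding fiber_chains_eq .

lemma signed_res_cycle:
  assumes "z \<in> fiberwise_cycles p q" "\<tau> \<in> simplices Y p"
  shows "signed_res \<tau> z \<in> fiber_cycles \<tau> q"
  using submodule_smult[OF submodule_fiber_cycles s_closed fiberwise_cyclesD(3)[OF assms]]
  by (simp add: signed_res_def free_space_simps)

lemma base_dim: "\<tau> \<in> simplices Y p \<Longrightarrow> sdim \<tau> = p"
  by (simp add: simplices_def)

lemma submodule_fiberwise_cycles:
  "submodule (fiberwise_cycles p q) K (Ch_dim p (p + q))"
proof (rule submodule_criterion[OF module_free_space])
  interpret F: Module.module K "Ch_dim p (p + q)" by (rule module_free_space)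
  have r: "linear_map K (Ch_dim p (p + q)) (Ch_over \<tau> (sdim \<tau> + q)) (res \<tau>)"
    if "\<tau> \<in> simplices Y p" for \<tau>
    using linear_map_free_space_subset[OF linear_map_res over_subset(2)] base_dim[OF that] by simp
  note sub = submodule_fiber_cycles
  show "fiberwise_cycles p q \<subseteq> carrier (Ch_dim p (p + q))"
    by (auto simp: fiberwise_cycles_def)
  show "\<zero>\<^bsub>Ch_dim p (p + q)\<^esub> \<in> fiberwise_cycles p q"
    unfolding fiberwise_cycles_def
    using linear_map_zero[OF module_free_space module_free_space r] submodule_zero[OF sub] by auto
  fix x assume x: "x \<in> fiberwise_cycles p q"
  note x' = fiberwise_cyclesD(1,3)[OF x]
  show "x \<oplus>\<^bsub>Ch_dim p (p + q)\<^esub> y \<in> fiberwise_cycles p q"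
    if y: "y \<in> fiberwise_cycles p q" for y
  proof -
    note y' = fiberwise_cyclesD(1,3)[OF y]
    show ?thesis unfolding fiberwise_cycles_def
      using F.a_closed[OF x'(1) y'(1)] linear_map_add[OF r x'(1) y'(1)]
        submodule_add[OF sub x'(2) y'(2)] by auto
  qed
  show "a \<odot>\<^bsub>Ch_dim p (p + q)\<^esub> x \<in> fiberwise_cycles p q" if a: "a \<in> carrier K" for a
    unfolding fiberwise_cycles_def
    using F.smult_closed[OF a x'(1)] linear_map_smult[OF r a x'(1)] submodule_smult[OF sub a x'(2)] by auto
qed

lemma module_cosheaf_chains: "Module.module K (lchains q p)"
  unfolding cosheaf_chains_def by (rule module_direct_sum) (rule module_cobj)

lemma linear_map_fiber_class:
  "linear_map K ((Ch_over \<tau> (sdim \<tau> + q))\<lparr>carrier := fiber_cycles \<tau> q\<rparr>)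
    (cobj (leray q) \<tau>) (fiber_class \<tau> q)"
  using linear_map_class[OF chain_complex_fiber] unfolding cobj_leray fiber_chains_eq .

lemma fiber_class_zero_iff:
  assumes "z \<in> carrier (Ch_over \<tau> (sdim \<tau> + q))"
  shows "fiber_class \<tau> q z = \<zero>\<^bsub>cobj (leray q) \<tau>\<^esub> \<longleftrightarrow> z \<in> fiber_boundaries \<tau> q"
  unfolding cobj_leray
  by (rule class_zero_iff[OF chain_complex_fiber]) (use assms in \<open>simp add: fiber_chains_eq\<close>)

lemma fiber_cycle_carrier: "z \<in> fiber_cycles \<tau> q \<Longrightarrow> z \<in> carrier (Ch_over \<tau> (sdim \<tau> + q))"
  by (simp add: fiber_cycle_iff)

lemma zero_fiber_cycle: "zero_chain \<in> fiber_cycles \<tau> q"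
  using submodule_zero[OF submodule_fiber_cycles] by (simp add: free_space_simps)

lemma fiber_class_zero: "fiber_class \<tau> q zero_chain = \<zero>\<^bsub>cobj (leray q) \<tau>\<^esub>"
  using fiber_class_zero_iff[OF fiber_cycle_carrier[OF zero_fiber_cycle]]
    submodule_zero[OF submodule_boundaries[OF chain_complex_fiber]]
  by (simp add: fiber_chains_eq free_space_simps)

lemma linear_map_class_chain:
  "linear_map K ((Ch_dim p (p + q))\<lparr>carrier := fiberwise_cycles p q\<rparr>)
    (lchains q p) (class_chain p q)"
proof (rule linear_mapI)
  let ?L = "lchains q p"
  note cl = linear_map_fiber_class
  note [simp] = cosheaf_chains_def direct_sum_simps class_chain_def
  have sr: "linear_map K (Ch_dim p (p + q)) (Ch_over \<tau> (sdim \<tau> + q)) (signed_res \<tau>)"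
    if "\<tau> \<in> simplices Y p" for \<tau>
    using linear_map_free_space_subset[OF linear_map_signed_res over_subset(2)] base_dim[OF that] by simp
  fix x assume "x \<in> carrier ((Ch_dim p (p + q))\<lparr>carrier := fiberwise_cycles p q\<rparr>)"
  then have x: "x \<in> fiberwise_cycles p q" by simp
  note xs = signed_res_cycle[OF x] and x' = fiberwise_cyclesD(1)[OF x]
  show "class_chain p q x \<in> carrier ?L"
    unfolding cosheaf_chains_def
  proof (rule direct_sumI)
    let ?A = "(\<lambda>\<sigma>. f ` \<sigma>) ` {\<sigma>. x \<sigma> \<noteq> \<zero>}"
    show "finite ?A" using free_spaceD(2)[OF x'] by simp
    show "class_chain p q x \<in> extensional (simplices Y p)" by simp
    fix \<tau> assume \<tau>: "\<tau> \<in> simplices Y p"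
    show "class_chain p q x \<tau> \<in> carrier (cobj (leray q) \<tau>)"
      using linear_map_closed[OF cl, of "signed_res \<tau> x"] xs[OF \<tau>] \<tau> by simp
    assume "\<tau> \<notin> ?A"
    then have "signed_res \<tau> x = zero_chain"
      by (auto simp: signed_res_def res_def restrict_chain_def fun_eq_iff)
    then show "class_chain p q x \<tau> = \<zero>\<^bsub>cobj (leray q) \<tau>\<^esub>" using \<tau> fiber_class_zero by simp
  qed
  show "class_chain p q (x \<oplus>\<^bsub>(Ch_dim p (p + q))\<lparr>carrier := fiberwise_cycles p q\<rparr>\<^esub> y) =
      class_chain p q x \<oplus>\<^bsub>?L\<^esub> class_chain p q y"
    if "y \<in> carrier ((Ch_dim p (p + q))\<lparr>carrier := fiberwise_cycles p q\<rparr>)" for y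
  proof -
    have y: "y \<in> fiberwise_cycles p q" using that by simp
    note ys = signed_res_cycle[OF y] and y' = fiberwise_cyclesD(1)[OF y]
    show ?thesis
    proof (rule direct_sum_eqI[where I = "simplices Y p"])
      fix \<tau> assume \<tau>: "\<tau> \<in> simplices Y p"
      show "class_chain p q (x \<oplus>\<^bsub>(Ch_dim p (p + q))\<lparr>carrier := fiberwise_cycles p q\<rparr>\<^esub> y) \<tau> =
          (class_chain p q x \<oplus>\<^bsub>?L\<^esub> class_chain p q y) \<tau>"
        using \<tau> linear_map_add[OF sr[OF \<tau>] x' y'] linear_map_add[OF cl, where x = "signed_res \<tau> x" and y = "signed_res \<tau> y"]
          xs[OF \<tau>] ys[OF \<tau>] by simp
    qed simp_all
  qed
  show "class_chain p q (a \<odot>\<^bsub>(Ch_dim p (p + q))\<lparr>carrier := fiberwise_cycles p q\<rparr>\<^esub> x) =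
      a \<odot>\<^bsub>?L\<^esub> class_chain p q x" if a: "a \<in> carrier K" for a
  proof (rule direct_sum_eqI[where I = "simplices Y p"])
    fix \<tau> assume \<tau>: "\<tau> \<in> simplices Y p"
    show "class_chain p q (a \<odot>\<^bsub>(Ch_dim p (p + q))\<lparr>carrier := fiberwise_cycles p q\<rparr>\<^esub> x) \<tau> =
          (a \<odot>\<^bsub>?L\<^esub> class_chain p q x) \<tau>"
      using \<tau> linear_map_smult[OF sr[OF \<tau>] a x'] linear_map_smult[OF cl a, of "signed_res \<tau> x"] xs[OF \<tau>] by simp
  qed simp_all
qed

text \<open>Pieces over different simplices of the base have disjoint supports. Finitely many of
  them form a chain, which still has finite support.\<close>

lemma glue_chains:
  assumes T: "finite T" "T \<subseteq> simplices Y p" and a: "\<forall>\<tau>\<in>T. a \<tau> \<in> carrier (Ch_over \<tau> n)"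
  shows "\<exists>c\<in>carrier (Ch_dim p n).
    (\<forall>\<tau>\<in>T. res \<tau> c = a \<tau>) \<and> (\<forall>\<tau>. \<tau> \<notin> T \<longrightarrow> res \<tau> c = zero_chain)"
proof (intro bexI conjI ballI allI impI)
  let ?c = "\<lambda>\<sigma>. if f ` \<sigma> \<in> T then a (f ` \<sigma>) \<sigma> else \<zero>"
  show "?c \<in> carrier (Ch_dim p n)"
  proof (rule free_spaceI[where A = "\<Union>\<tau>\<in>T. {\<sigma>. a \<tau> \<sigma> \<noteq> \<zero>}"])
    show "finite (\<Union>\<tau>\<in>T. {\<sigma>. a \<tau> \<sigma> \<noteq> \<zero>})" using T(1) free_spaceD(2)[OF bspec[OF a]] by blast
    show "(\<Union>\<tau>\<in>T. {\<sigma>. a \<tau> \<sigma> \<noteq> \<zero>}) \<subseteq> over_dim p n"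
    proof (rule UN_least)
      fix \<tau> assume \<tau>: "\<tau> \<in> T"
      then have "sdim \<tau> = p" using T(2) base_dim by blast
      then show "{\<sigma>. a \<tau> \<sigma> \<noteq> \<zero>} \<subseteq> over_dim p n"
        using free_spaceD(3)[OF bspec[OF a \<tau>]] over_subset_over_dim by blast
    qed
    show "?c \<sigma> \<in> carrier K" for \<sigma> using free_spaceD(1)[OF bspec[OF a]] by auto
    show "?c \<sigma> = \<zero>" if "\<sigma> \<notin> (\<Union>\<tau>\<in>T. {\<sigma>. a \<tau> \<sigma> \<noteq> \<zero>})" for \<sigma> using that by auto
  qed
  show "res \<tau> ?c = a \<tau>" if \<tau>: "\<tau> \<in> T" for \<tau>
  proof
    fix \<sigma>
    show "res \<tau> ?c \<sigma> = a \<tau> \<sigma>"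
      using free_spaceD(4)[OF bspec[OF a \<tau>], of \<sigma>] \<tau> by (auto simp: res_def restrict_chain_def over_def)
  qed
  show "res \<tau> ?c = zero_chain" if "\<tau> \<notin> T" for \<tau>
    using that by (auto simp: res_def restrict_chain_def)
qed

text \<open>A cosheaf chain has finitely many values other than zero. Cycles representing them
  glue to one chain.\<close>

lemma class_chain_surj:
  assumes x: "x \<in> carrier (lchains q p)"
  obtains z where "z \<in> fiberwise_cycles p q" "class_chain p q z = x"
proof -
  note xD = direct_sumD[OF x[unfolded cosheaf_chains_def]]
  let ?T = "{\<tau> \<in> simplices Y p. x \<tau> \<noteq> \<zero>\<^bsub>cobj (leray q) \<tau>\<^esub>}"
  have ex: "\<exists>y. y \<in> fiber_cycles \<tau> q \<and> fiber_class \<tau> q y = x \<tau>" if "\<tau> \<in> ?T" for \<tau>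
  proof -
    have "x \<tau> \<in> carrier (cobj (leray q) \<tau>)" by (rule xD(2)) (use that in simp)
    then show ?thesis unfolding cobj_leray carrier_homology by (elim imageE) (metis)
  qed
  define y where "y \<tau> = (SOME y. y \<in> fiber_cycles \<tau> q \<and> fiber_class \<tau> q y = x \<tau>)" for \<tau>
  have y: "y \<tau> \<in> fiber_cycles \<tau> q" "fiber_class \<tau> q (y \<tau>) = x \<tau>" if "\<tau> \<in> ?T" for \<tau>
    using someI_ex[OF ex[OF that]] unfolding y_def by (rule conjunct1, rule conjunct2)
  \<comment> \<open>The factor \<open>s \<tau>\<close> cancels the one in
    \<open>signed_res\<close>.\<close>
  let ?a = "\<lambda>\<tau> \<sigma>. s \<tau> \<otimes> y \<tau> \<sigma>"
  have az: "?a \<tau> \<in> fiber_cycles \<tau> q" if "\<tau> \<in> ?T" for \<tau>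
    using submodule_smult[OF submodule_fiber_cycles s_closed y(1)[OF that]] by (simp add: free_space_simps)
  have ac: "\<forall>\<tau>\<in>?T. ?a \<tau> \<in> carrier (Ch_over \<tau> (p + q))"
  proof
    fix \<tau> assume \<tau>: "\<tau> \<in> ?T"
    then have "sdim \<tau> = p" by (simp add: base_dim)
    with fiber_cycle_carrier[OF az[OF \<tau>]] show "?a \<tau> \<in> carrier (Ch_over \<tau> (p + q))"
      by simp
  qed
  have T: "?T \<subseteq> simplices Y p" by blast
  from glue_chains[OF xD(3) T ac] obtain z
    where z: "z \<in> carrier (Ch_dim p (p + q))"
      "\<forall>\<tau>\<in>?T. res \<tau> z = ?a \<tau>" "\<forall>\<tau>. \<tau> \<notin> ?T \<longrightarrow> res \<tau> z = zero_chain"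
    by (elim bexE conjE) (rule that)
  have zc: "z \<in> fiberwise_cycles p q"
    unfolding fiberwise_cycles_def
  proof (intro CollectI conjI ballI)
    fix \<tau> assume "\<tau> \<in> simplices Y p"
    show "res \<tau> z \<in> fiber_cycles \<tau> q"
    proof (cases "\<tau> \<in> ?T")
      case True
      with z(2) az[OF True] show ?thesis by simp
    next
      case False
      with z(3) zero_fiber_cycle show ?thesis by simp
    qed
  qed (rule z(1))
  have "class_chain p q z = x"
  proof (rule direct_sum_eqI[where I = "simplices Y p"])
    show "class_chain p q z \<in> extensional (simplices Y p)" by (simp add: class_chain_def)
    show "x \<in> extensional (simplices Y p)" by (rule xD(1))
    fix \<tau> assume \<tau>: "\<tau> \<in> simplices Y p"
    show "class_chain p q z \<tau> = x \<tau>"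
    proof (cases "\<tau> \<in> ?T")
      case True
      have "signed_res \<tau> z = y \<tau>"
        using free_spaceD(1)[OF fiber_cycle_carrier[OF y(1)[OF True]]]
        by (simp add: signed_res_def bspec[OF z(2) True] m_assoc[symmetric] s_square)
      then show ?thesis using \<tau> y(2)[OF True] by (simp add: class_chain_def)
    next
      case False
      have "signed_res \<tau> z = zero_chain" by (simp add: signed_res_def z(3)[rule_format, OF False])
      then have "class_chain p q z \<tau> = \<zero>\<^bsub>cobj (leray q) \<tau>\<^esub>" using \<tau> fiber_class_zero by (simp add: class_chain_def)
      then show ?thesis using False \<tau> by simp
    qed
  qed
  with zc that show thesis by blast
qed

text \<open>All pieces of \<open>z\<close> bound in their fibres if and only if they bound
  simultaneously: chains that bound the finitely many pieces glue to one chain, and distinct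
  \<open>p\<close>-simplices of the base do not interfere in the part over the
  \<open>p\<close>-simplices of its boundary.\<close>

lemma class_chain_zero_iff:
  assumes z: "z \<in> fiberwise_cycles p q"
  shows "class_chain p q z = \<zero>\<^bsub>lchains q p\<^esub> \<longleftrightarrow>
    (\<exists>a\<in>carrier (Ch_dim p (Suc (p + q))). z = part p (bd (Suc (p + q)) a))"
proof -
  note z' = fiberwise_cyclesD[OF z]
  let ?n = "p + q"
  have zi: "class_chain p q z = \<zero>\<^bsub>lchains q p\<^esub> \<longleftrightarrow>
      (\<forall>\<tau>\<in>simplices Y p. signed_res \<tau> z \<in> fiber_boundaries \<tau> q)"
  proof -
    have "class_chain p q z = \<zero>\<^bsub>lchains q p\<^esub> \<longleftrightarrow>
      (\<forall>\<tau>\<in>simplices Y p. fiber_class \<tau> q (signed_res \<tau> z) = \<zero>\<^bsub>cobj (leray q) \<tau>\<^esub>)"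
      by (auto simp: class_chain_def cosheaf_chains_def direct_sum_simps fun_eq_iff restrict_def)
    then show ?thesis using fiber_class_zero_iff[OF fiber_cycle_carrier[OF signed_res_cycle[OF z]]] by simp
  qed
  show ?thesis
  proof
    assume "class_chain p q z = \<zero>\<^bsub>lchains q p\<^esub>"
    then have "\<exists>a. a \<in> carrier (Ch_over \<tau> (Suc ?n)) \<and> signed_res \<tau> z = res \<tau> (bd (Suc ?n) a)"
      if "\<tau> \<in> simplices Y p" for \<tau>
      using that zi by (force simp: fiber_boundary_iff base_dim[OF that])
    then obtain a where a: "\<And>\<tau>. \<tau> \<in> simplices Y p \<Longrightarrow> a \<tau> \<in> carrier (Ch_over \<tau> (Suc ?n))"
      "\<And>\<tau>. \<tau> \<in> simplices Y p \<Longrightarrow> signed_res \<tau> z = res \<tau> (bd (Suc ?n) (a \<tau>))" by metis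
    let ?b = "\<lambda>\<tau>. s \<tau> \<odot>\<^bsub>Ch_over \<tau> (Suc ?n)\<^esub> a \<tau>"
    have bc: "?b \<tau> \<in> carrier (Ch_over \<tau> (Suc ?n))" if "\<tau> \<in> simplices Y p" for \<tau>
      by (rule Module.module.smult_closed[OF module_free_space s_closed a(1)[OF that]])
    have b: "res \<tau> (bd (Suc ?n) (?b \<tau>)) = res \<tau> z" if \<tau>: "\<tau> \<in> simplices Y p" for \<tau>
    proof -
      have "linear_map K (Ch_over \<tau> (Suc ?n)) (Ch_over \<tau> ?n) (\<lambda>c. res \<tau> (bd (Suc ?n) c))"
        by (rule linear_map_free_space_subset[OF linear_map_comp[OF linear_map_bd linear_map_res] over_subset(1)])
      from linear_map_smult[OF this s_closed a(1)[OF \<tau>]]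
      show ?thesis unfolding a(2)[OF \<tau>, symmetric]
        using signed_res_twice[OF z'(1)] by (simp add: free_space_simps signed_res_def)
    qed
    let ?T = "(\<lambda>\<sigma>. f ` \<sigma>) ` {\<sigma>. z \<sigma> \<noteq> \<zero>}"
    have T: "finite ?T" "?T \<subseteq> simplices Y p"
      using free_spaceD(2,3)[OF z'(1)] over_dim_image by blast+
    have bT: "\<forall>\<tau>\<in>?T. ?b \<tau> \<in> carrier (Ch_over \<tau> (Suc ?n))"
      using bc T(2) by blast
    from glue_chains[OF T bT] obtain c
      where c: "c \<in> carrier (Ch_dim p (Suc ?n))"
        "\<forall>\<tau>\<in>?T. res \<tau> c = ?b \<tau>" "\<forall>\<tau>. \<tau> \<notin> ?T \<longrightarrow> res \<tau> c = zero_chain"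
      by (elim bexE conjE) (rule that)
    have "z = part p (bd (Suc ?n) c)"
    proof (rule chain_eqI[OF z'(1)])
      show "part p (bd (Suc ?n) c) \<in> carrier (Ch_dim p ?n)"
        by (rule part_closed[OF bd_closed[OF c(1) over_subset(2)] subset_refl])
      fix \<tau> assume \<tau>: "\<tau> \<in> simplices Y p"
      have "res \<tau> (part p (bd (Suc ?n) c)) = res \<tau> (bd (Suc ?n) (res \<tau> c))"
        unfolding res_part[OF base_dim[OF \<tau>]] by (rule res_bd_same_dim[OF c(1) \<tau>])
      also have "\<dots> = res \<tau> z"
      proof (cases "\<tau> \<in> ?T")
        case True
        show ?thesis unfolding bspec[OF c(2) True] by (rule b[OF \<tau>])
      next
        case False
        show ?thesis unfolding c(3)[rule_format, OF False] bd_zero using False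
          by (auto simp: res_def restrict_chain_def fun_eq_iff)
      qed
      finally show "res \<tau> z = res \<tau> (part p (bd (Suc ?n) c))" by simp
    qed
    with c(1) show "\<exists>a\<in>carrier (Ch_dim p (Suc ?n)). z = part p (bd (Suc ?n) a)" by blast
  next
    assume "\<exists>a\<in>carrier (Ch_dim p (Suc ?n)). z = part p (bd (Suc ?n) a)"
    then obtain a where a: "a \<in> carrier (Ch_dim p (Suc ?n))" "z = part p (bd (Suc ?n) a)"
      by blast
    have "signed_res \<tau> z \<in> fiber_boundaries \<tau> q" if \<tau>: "\<tau> \<in> simplices Y p" for \<tau>
    proof -
      have "res \<tau> z = res \<tau> (bd (Suc ?n) (res \<tau> a))"
        unfolding a(2) res_part[OF base_dim[OF \<tau>]] by (rule res_bd_same_dim[OF a(1) \<tau>])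
      moreover have "res \<tau> a \<in> carrier (Ch_over \<tau> (Suc ?n))"
        by (rule res_closed[OF a(1) over_subset(2)])
      ultimately have "res \<tau> z \<in> fiber_boundaries \<tau> q"
        unfolding fiber_boundary_iff base_dim[OF \<tau>] by blast
      from submodule_smult[OF submodule_boundaries[OF chain_complex_fiber] s_closed this]
      show ?thesis by (simp add: signed_res_def fiber_chains_eq free_space_simps)
    qed
    then show "class_chain p q z = \<zero>\<^bsub>lchains q p\<^esub>" using zi by blast
  qed
qed

end

section \<open>Transition maps of the Leray cosheaves over a graph\<close>

text \<open>The cosheaf boundary of an edge \<open>[a, b]\<close> is the value at \<open>b\<close>
  minus the value at \<open>a\<close>, whereas the boundary of \<open>X\<close> treats the two
  ends alike. The signs \<open>s\<close> compensate for this. They take opposite values at the two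
  ends of every edge, as a 2-colouring of the vertices provides; the sign of an edge is that of
  its head.\<close>

locale fibered_graph = fibered_complex K X ori Y f s
  for K :: "('k, 'r) ring_scheme" (structure) and X :: "'v set set" and ori
    and Y :: "'w set set" and f :: "'v \<Rightarrow> 'w" and s +
  fixes oriY :: "'w set \<Rightarrow> 'w list"
  assumes base_orient: "orientation Y oriY"
    and base_graph: "\<tau> \<in> Y \<Longrightarrow> sdim \<tau> \<le> 1"
    and edge_signs: "e \<in> simplices Y 1 \<Longrightarrow> oriY e = [a, b] \<Longrightarrow> s {b} = s e \<and> s {a} = \<ominus> s e"
begin

abbreviation lbd where
  "lbd q \<equiv> cosheaf_boundary Y oriY (leray q)"

abbreviation lhom where
  "lhom p q \<equiv> cosheaf_homology Y oriY (leray q) p"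

text \<open>The sign of moving the last of \<open>q + 2\<close> vertices to the front.\<close>

definition degree_sign :: "nat \<Rightarrow> 'k" where
  "degree_sign q = of_integer ((- 1) ^ Suc q)"

lemma degree_sign_closed [simp]: "degree_sign q \<in> carrier K"
  by (simp add: degree_sign_def)

lemma degree_sign_square: "degree_sign q \<otimes> degree_sign q = \<one>"
  unfolding degree_sign_def of_integer_mult[symmetric] by (simp flip: power_add)

lemma edgeE:
  assumes "e \<in> simplices Y 1"
  obtains a b where "oriY e = [a, b]" "a \<noteq> b" "e = {a, b}" "{a} \<in> simplices Y 0" "{b} \<in> simplices Y 0"
proof -
  have e: "e \<in> Y" "card e - 1 = 1" using assms by (auto simp: simplices_def sdim_def)
  note o = ori_props[OF base_complex base_orient e(1)]
  have "length (oriY e) = Suc (Suc 0)" using o(3) e(2) by simp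
  then obtain a b where ab: "oriY e = [a, b]" by (auto simp: length_Suc_conv)
  have eq: "e = {a, b}" "a \<noteq> b" using o(1,2) ab by auto
  have "{a} \<in> Y" "{b} \<in> Y" using face_in_complex[OF base_complex e(1)] eq by auto
  with ab eq show thesis using that by (auto simp: simplices_def sdim_def)
qed

lemma other_vertexE:
  assumes "e \<in> simplices Y 1" "v \<in> e"
  obtains v' where "v' \<in> e" "v' \<noteq> v" "e = {v, v'}"
proof -
  obtain a b where ab: "a \<noteq> b" "e = {a, b}" using edgeE[OF assms(1)] .
  show thesis
  proof (cases "v = a")
    case True
    then show thesis using that[of b] ab by simp
  next
    case False
    then show thesis using that[of a] ab assms(2) by auto
  qed
qed

lemma orient_vertex:
  assumes "{v} \<in> Y"
  shows "oriY {v} = [v]"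
proof -
  note o = ori_props[OF base_complex base_orient assms]
  have "length (oriY {v}) = Suc 0" using o(3) by simp
  then obtain w where "oriY {v} = [w]" by (auto simp: length_Suc_conv)
  with o(2) show ?thesis by simp
qed

lemma vertexE:
  assumes "\<tau> \<in> simplices Y 0"
  obtains v where "\<tau> = {v}"
proof -
  have "\<tau> \<in> Y" "card \<tau> - 1 = 0" using assms by (auto simp: simplices_def sdim_def)
  then have "card \<tau> = 1"
    using simplex_finite[OF base_complex] simplex_nonempty[OF base_complex]
    by (metis One_nat_def Suc_pred card_gt_0_iff)
  then show thesis using that by (auto simp: card_1_singleton_iff)
qed

lemma filter_eq_singleton:
  assumes "distinct xs" "w \<in> set xs" "\<And>x. x \<in> set xs \<Longrightarrow> P x \<longleftrightarrow> x = w"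
  shows "filter P xs = [w]"
proof -
  have "filter P xs = filter (\<lambda>x. x = w) xs" by (rule filter_cong) (use assms(3) in auto)
  also have "\<dots> = [w]" using assms(1,2)
    by (induction xs) (auto simp: filter_empty_conv)
  finally show ?thesis .
qed

text \<open>Let \<open>N\<close> be the set of vertices of \<open>\<sigma>\<close> over
  \<open>v\<close>. The transition map is not zero on \<open>\<sigma>\<close> if and only if
  \<open>\<sigma>\<close> has a single further vertex \<open>w\<close>, and this is also the only
  case in which a facet of \<open>\<sigma>\<close> lies over \<open>v\<close>; the facet is then
  \<open>N\<close>. The transition map moves \<open>w\<close> to the end of the ordering before
  deleting it, the boundary moves it to the front. The two results differ by \<open>degree_sign
  q\<close>.\<close>

lemma fiber_map_term:
  assumes e: "e \<in> simplices Y 1" and v: "v \<in> e" and \<sigma>: "\<sigma> \<in> over e (Suc q)"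
  shows "(if int (sdim \<sigma>) - int (sdim e) \<noteq> int (sdim (maximal_face f {v} \<sigma>)) - int (sdim {v})
        then \<zero>\<^bsub>fiber_chains K X f {v} q\<^esub>
        else let us = alone_last f {v} (ori \<sigma>) in
          [(reorder_sign (ori \<sigma>) us)] \<cdot>\<^bsub>fiber_chains K X f {v} q\<^esub>
            oriented_simplex K ori (filter (\<lambda>u. f u \<in> {v}) us)) =
    (\<lambda>\<rho>. degree_sign q \<otimes> res {v} (incidence_chain \<sigma>) \<rho>)" (is "?G = _")
proof -
  define N where "N = {u \<in> \<sigma>. f u = v}"
  have \<sigma>': "\<sigma> \<in> X" "card \<sigma> = Suc (Suc q)" "f ` \<sigma> = e" using \<sigma> by (auto simp: over_def simplices_card)
  note o = ori_props[OF complex orient \<sigma>'(1)]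
  have fin: "finite \<sigma>" using simplex_finite[OF complex \<sigma>'(1)] .
  have N: "N \<subseteq> \<sigma>" "N \<noteq> {}" "finite N" using v \<sigma>'(3) fin by (auto simp: N_def)
  obtain v' where v': "v' \<in> e" "v' \<noteq> v" "e = {v, v'}" using other_vertexE[OF e v] .
  have "N \<noteq> \<sigma>" using v' \<sigma>'(3) by (auto simp: N_def)
  then have lt: "card N < Suc (Suc q)" using N(1) \<sigma>'(2) fin psubset_card_mono[of \<sigma> N] by auto
  have mf: "maximal_face f {v} \<sigma> = N" by (auto simp: maximal_face_def N_def)
  have cN: "card N \<noteq> 0" using N by simp
  have dims: "sdim \<sigma> = Suc q" "sdim e = 1" "sdim {v} = 0" "sdim N = card N - 1"
    using \<sigma>'(2) e by (simp_all add: sdim_def simplices_def)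
  have cond: "int (sdim \<sigma>) - int (sdim e) = int (sdim (maximal_face f {v} \<sigma>)) - int (sdim {v}) \<longleftrightarrow> card N = Suc q"
    unfolding mf dims using cN by auto
  have only_N: "\<rho> = N \<and> card N = Suc q" if \<rho>: "f ` \<rho> = {v}" "incidence ori \<sigma> \<rho> \<noteq> 0" for \<rho>
  proof -
    obtain u where u: "u \<in> \<sigma>" "\<rho> = \<sigma> - {u}" using \<rho>(2) by (rule incidence_nonzero_face[OF \<sigma>'(1)])
    then have c: "card \<rho> = Suc q" using \<sigma>'(2) fin by simp
    have "\<rho> \<subseteq> N" using \<rho>(1) u(2) by (auto simp: N_def)
    moreover have "card N \<le> card \<rho>" using lt c by simp
    ultimately show ?thesis using card_seteq[OF N(3)] c by blast
  qed
  show ?thesis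
  proof (cases "card N = Suc q")
    case False
    have "res {v} (incidence_chain \<sigma>) = zero_chain"
    proof
      fix \<rho> show "res {v} (incidence_chain \<sigma>) \<rho> = \<zero>"
        using only_N[of \<rho>] False
        by (cases "f ` \<rho> = {v}"; cases "incidence ori \<sigma> \<rho> = 0")
          (auto simp: res_def restrict_chain_def incidence_chain_def)
    qed
    then show ?thesis using False cond by (simp add: fiber_chains_eq free_space_simps)
  next
    case True
    have "card (\<sigma> - N) = 1" using True \<sigma>'(2) N card_Diff_subset[OF N(3,1)] by simp
    then obtain w where w: "\<sigma> - N = {w}" by (auto simp: card_1_singleton_iff)
    then have w\<sigma>: "w \<in> \<sigma>" "f w \<noteq> v" by (auto simp: N_def)
    define ws where "ws = filter (\<lambda>u. \<not> alone f \<sigma> u) (ori \<sigma>) @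
      filter (\<lambda>u. alone f \<sigma> u \<and> f u \<in> {v}) (ori \<sigma>)"
    have alone_w: "alone f \<sigma> w"
      unfolding alone_def
    proof (intro ballI impI)
      fix u assume "u \<in> \<sigma>" "f u = f w"
      then have "u \<in> \<sigma> - N" using w\<sigma>(2) by (simp add: N_def)
      then show "u = w" using w by simp
    qed
    have "filter (\<lambda>u. alone f \<sigma> u \<and> f u \<notin> {v}) (ori \<sigma>) = [w]"
    proof (rule filter_eq_singleton[OF o(1)])
      show "w \<in> set (ori \<sigma>)" using w\<sigma> o(2) by simp
      show "(alone f \<sigma> x \<and> f x \<notin> {v}) = (x = w)" if "x \<in> set (ori \<sigma>)" for x
        using that o(2) w w\<sigma> alone_w by (auto simp: N_def)
    qed
    then have us: "alone_last f {v} (ori \<sigma>) = ws @ [w]"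
      unfolding alone_last_def ws_def o(2) by simp
    have ws: "set ws = N" "distinct ws"
    proof -
      have "x \<in> N" if "x \<in> \<sigma>" "\<not> alone f \<sigma> x" for x using that w alone_w by (auto simp: N_def)
      then show "set ws = N" using o(2) by (auto simp: ws_def N_def)
      show "distinct ws" using o(1) by (auto simp: ws_def)
    qed
    have "\<forall>u\<in>set ws. f u = v" using ws(1) by (simp add: N_def)
    then have fil: "filter (\<lambda>u. f u = v) (ws @ [w]) = ws" using w\<sigma>(2) by simp
    have len: "length ws = Suc q" using distinct_card[OF ws(2)] ws(1) True by simp
    then have "ws \<noteq> []" by auto
    have wws: "distinct (w # ws)" "set (w # ws) = \<sigma>" "set (ws @ [w]) = \<sigma>" using ws w N(1) by auto
    have "f ` N = {v}" using N(2) by (auto simp: N_def)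
    moreover have "N \<in> X" by (rule face_in_complex[OF complex \<sigma>'(1) N(1,2)])
    ultimately have Nover: "N \<in> over {v} (sdim {v} + q)" using True
      by (simp add: over_def simplices_card sdim_def)
    have os: "oriented_simplex K ori ws \<in> carrier (fiber_chains K X f {v} q)"
      unfolding fiber_chains_eq oriented_simplex_eq
      by (rule free_spaceI[where A = "{N}"]) (use Nover ws in auto)
    have G: "?G = of_integer (reorder_sign (ori \<sigma>) (ws @ [w])) \<odot>\<^bsub>fiber_chains K X f {v} q\<^esub> oriented_simplex K ori ws"
      using cond True os integer_multiple[of "fiber_chains K X f {v} q" "oriented_simplex K ori ws"]
      by (simp add: us fil Let_def fiber_chains_eq module_free_space del: filter_append)
    have "reorder_sign (ori \<sigma>) (w # ws) =
        reorder_sign (ori \<sigma>) (ws @ [w]) * reorder_sign (ws @ [w]) (w # ws)"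
      by (rule reorder_sign_trans) (use o wws in auto)
    also have "reorder_sign (ws @ [w]) (w # ws) = (- 1) ^ Suc q"
      using reorder_sign_move_to_front[of ws w "[]"] wws(1) len by simp
    finally have "incidence ori \<sigma> N = reorder_sign (ori \<sigma>) (ws @ [w]) * (- 1) ^ Suc q * reorder_sign (ori N) ws"
      using incidence_face[OF complex orient \<sigma>'(1) wws(2,1) \<open>ws \<noteq> []\<close> ws(1)] by simp
    then have sgn: "(- 1) ^ Suc q * incidence ori \<sigma> N = reorder_sign (ori \<sigma>) (ws @ [w]) * reorder_sign (ori N) ws"
      by (simp add: mult.assoc mult.left_commute flip: power_add)
    show ?thesis
    proof
      fix \<rho>
      have L: "?G \<rho> = of_integer (reorder_sign (ori \<sigma>) (ws @ [w]) * (if N = \<rho> then reorder_sign (ori \<rho>) ws else 0))"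
        unfolding G using ws(1) by (simp add: fiber_chains_eq free_space_simps oriented_simplex_eq of_integer_mult)
      show "?G \<rho> = degree_sign q \<otimes> res {v} (incidence_chain \<sigma>) \<rho>"
      proof (cases "\<rho> = N")
        case True
        have "res {v} (incidence_chain \<sigma>) N = of_integer (incidence ori \<sigma> N)"
          using \<open>f ` N = {v}\<close> by (simp add: res_def restrict_chain_def incidence_chain_def)
        then show ?thesis unfolding L unfolding True degree_sign_def
          by (simp add: of_integer_mult[symmetric] sgn del: power_Suc)
      next
        case False
        then have "res {v} (incidence_chain \<sigma>) \<rho> = \<zero>"
          using only_N[of \<rho>]
          by (cases "f ` \<rho> = {v}"; cases "incidence ori \<sigma> \<rho> = 0")
            (auto simp: res_def restrict_chain_def incidence_chain_def)
        then show ?thesis unfolding L using False by simp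
      qed
    qed
  qed
qed

lemma linear_map_signed_bd:
  "linear_map K (Ch_over e (Suc q)) (Ch_over {v} q)
    (\<lambda>x \<rho>. degree_sign q \<otimes> res {v} (bd (Suc q) x) \<rho>)"
proof -
  let ?N = "Ch_over {v} q"
  interpret N: Module.module K ?N by (rule module_free_space)
  have l: "linear_map K (Ch_over e (Suc q)) ?N (\<lambda>x. res {v} (bd (Suc q) x))"
    by (rule linear_map_free_space_subset[OF linear_map_comp[OF linear_map_bd linear_map_res] over_subset(1)])
  have "linear_map K ?N ?N (\<lambda>x. degree_sign q \<odot>\<^bsub>?N\<^esub> x)"
    by (rule linear_mapI) (simp_all add: N.smult_r_distr N.smult_assoc1[symmetric] m_comm)
  from linear_map_comp[OF l this] show ?thesis by (simp add: free_space_simps)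
qed

text \<open>By linearity, a transition map from an edge to a vertex is a signed piece of the
  simplicial boundary. Everything that follows uses transition maps in this form only.\<close>

lemma fiber_map_eq:
  assumes e: "e \<in> simplices Y 1" and v: "v \<in> e" and x: "x \<in> carrier (Ch_over e (Suc q))"
  shows "fiber_map K X ori f e {v} q x = (\<lambda>\<rho>. degree_sign q \<otimes> res {v} (bd (Suc q) x) \<rho>)"
proof -
  let ?N = "Ch_over {v} q"
  have Neq: "fiber_chains K X f {v} q = ?N" by (simp add: fiber_chains_eq sdim_def)
  let ?G = "\<lambda>\<sigma>. if int (sdim \<sigma>) - int (sdim e) \<noteq> int (sdim (maximal_face f {v} \<sigma>)) - int (sdim {v})
        then \<zero>\<^bsub>fiber_chains K X f {v} q\<^esub>
        else let us = alone_last f {v} (ori \<sigma>) in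
          [(reorder_sign (ori \<sigma>) us)] \<cdot>\<^bsub>fiber_chains K X f {v} q\<^esub>
            oriented_simplex K ori (filter (\<lambda>u. f u \<in> {v}) us)"
  have G: "?G \<sigma> = (\<lambda>\<rho>. degree_sign q \<otimes> res {v} (bd (Suc q) (single \<sigma>)) \<rho>)" if "\<sigma> \<in> over e (Suc q)" for \<sigma>
  proof -
    have "\<sigma> \<in> simplices X (Suc q)" using that over_subset(1) by blast
    from fiber_map_term[OF e v that] show ?thesis unfolding boundary_single[OF \<open>\<sigma> \<in> simplices X (Suc q)\<close>] .
  qed
  have Gc: "?G \<sigma> \<in> carrier ?N" if "\<sigma> \<in> over e (Suc q)" for \<sigma>
    unfolding G[OF that] by (rule linear_map_closed[OF linear_map_signed_bd single_in_free_space[OF that]])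
  have fm: "fiber_map K X ori f e {v} q = linear_extension K ?N ?G"
    unfolding fiber_map_def unfolding Neq ..
  show ?thesis
    unfolding fm
  proof (rule linear_map_eq_on_basis[OF module_free_space _ linear_map_signed_bd _ x])
    show "linear_map K (Ch_over e (Suc q)) ?N (linear_extension K ?N ?G)"
      by (rule linear_map_linear_extension[OF module_free_space Gc])
    show "linear_extension K ?N ?G (single \<sigma>) = (\<lambda>\<rho>. degree_sign q \<otimes> res {v} (bd (Suc q) (single \<sigma>)) \<rho>)"
      if \<sigma>: "\<sigma> \<in> over e (Suc q)" for \<sigma>
    proof -
      have "linear_extension K ?N ?G (single \<sigma>) = ?G \<sigma>"
        by (rule linear_extension_single[OF module_free_space Gc \<sigma>])
      also have "\<dots> = (\<lambda>\<rho>. degree_sign q \<otimes> res {v} (bd (Suc q) (single \<sigma>)) \<rho>)" by (rule G[OF \<sigma>])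
      finally show ?thesis .
    qed
  qed
qed

lemma over_vertices_if:
  assumes c: "c \<in> carrier (Ch n)" and r: "\<And>e. e \<in> simplices Y 1 \<Longrightarrow> res e c = zero_chain"
  shows "c \<in> carrier (Ch_dim 0 n)"
proof (rule free_spaceI[where A = "{\<sigma>. c \<sigma> \<noteq> \<zero>}"])
  note cD = free_spaceD[OF c]
  show "finite {\<sigma>. c \<sigma> \<noteq> \<zero>}" by (rule cD(2))
  show "{\<sigma>. c \<sigma> \<noteq> \<zero>} \<subseteq> over_dim 0 n"
  proof
    fix \<sigma> assume \<sigma>: "\<sigma> \<in> {\<sigma>. c \<sigma> \<noteq> \<zero>}"
    then have \<sigma>n: "\<sigma> \<in> simplices X n" using cD(3) by blast
    have "sdim (f ` \<sigma>) \<noteq> 1"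
    proof
      assume "sdim (f ` \<sigma>) = 1"
      then have "f ` \<sigma> \<in> simplices Y 1" using image_in_base[OF \<sigma>n] by (simp add: simplices_def)
      from fun_cong[OF r[OF this], of \<sigma>] show False using \<sigma> by (simp add: res_def restrict_chain_def)
    qed
    then have "sdim (f ` \<sigma>) = 0" using base_graph[OF image_in_base[OF \<sigma>n]] by simp
    then show "\<sigma> \<in> over_dim 0 n" using \<sigma>n by (simp add: over_dim_def)
  qed
qed (use free_spaceD(1)[OF c] in auto)

lemma split_chain:
  assumes c: "c \<in> carrier (Ch n)"
  shows "part 0 c \<oplus>\<^bsub>Ch n\<^esub> part 1 c = c"
proof
  fix \<sigma>
  note cD = free_spaceD[OF c]
  show "(part 0 c \<oplus>\<^bsub>Ch n\<^esub> part 1 c) \<sigma> = c \<sigma>"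
  proof (cases "\<sigma> \<in> simplices X n")
    case True
    from base_graph[OF image_in_base[OF this]] have "sdim (f ` \<sigma>) = 0 \<or> sdim (f ` \<sigma>) = 1" by auto
    then show ?thesis using cD(1) by (auto simp: part_def restrict_chain_def free_space_simps)
  next
    case False
    then show ?thesis using cD(4) by (auto simp: part_def restrict_chain_def free_space_simps)
  qed
qed

lemma res_edge_bd_over_vertices:
  assumes c: "c \<in> carrier (Ch_dim 0 (Suc n))" and e: "e \<in> simplices Y 1"
  shows "res e (bd (Suc n) c) = zero_chain"
proof -
  have "restrict_chain (\<lambda>\<sigma>. e \<subseteq> f ` \<sigma>) c = zero_chain"
  proof
    fix \<sigma>
    show "restrict_chain (\<lambda>\<sigma>. e \<subseteq> f ` \<sigma>) c \<sigma> = \<zero>"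
    proof (cases "\<sigma> \<in> over_dim 0 (Suc n) \<and> e \<subseteq> f ` \<sigma>")
      case True
      then obtain v where "f ` \<sigma> = {v}" using vertexE[OF over_dim_image] by blast
      moreover obtain a b where "a \<noteq> b" "e = {a, b}" using edgeE[OF e] by metis
      ultimately show ?thesis using True by auto
    next
      case False
      then show ?thesis using free_spaceD(4)[OF c, of \<sigma>] by (auto simp: restrict_chain_def)
    qed
  qed
  then show ?thesis
    using res_bd_above[OF free_space_mono[OF over_subset(2) c], of e] by (simp add: res_zero bd_zero)
qed

lemma bd_over_vertices:
  assumes "c \<in> carrier (Ch_dim 0 (Suc n))"
  shows "bd (Suc n) c \<in> carrier (Ch_dim 0 n)"
  by (rule over_vertices_if[OF bd_closed[OF assms over_subset(2)]])
    (rule res_edge_bd_over_vertices[OF assms])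

lemma bd_bd: "c \<in> carrier (Ch (Suc (Suc n))) \<Longrightarrow>
    bd (Suc n) (bd (Suc (Suc n)) c) = zero_chain"
  using boundary_boundary[of c n] by (simp add: chains_def free_space_simps)

text \<open>A boundary \<open>b\<close> of the fibre over \<open>e\<close> is the part over \<open>e\<close> of the boundary in \<open>X\<close> of a chain over
  \<open>e\<close>, and the rest of that boundary lies over the ends of \<open>e\<close>. The boundaries of the two parts
  cancel, so the piece over \<open>v\<close> of the boundary of \<open>b\<close> bounds in the fibre over \<open>v\<close>.\<close>

lemma fiber_map_boundaries:
  assumes e: "e \<in> simplices Y 1" and v: "v \<in> e" and b: "b \<in> fiber_boundaries e q"
  shows "fiber_map K X ori f e {v} q b \<in> fiber_boundaries {v} q"
proof -
  let ?C = "\<lambda>n. Ch n"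
  interpret C: Module.module K "?C q" by (rule module_free_space)
  interpret C1: Module.module K "?C (Suc q)" by (rule module_free_space)
  have de: "sdim e = 1" using e by (simp add: simplices_def)
  have vY: "{v} \<in> simplices Y 0" using edgeE[OF e] v by (metis insert_iff singletonD)
  obtain a where a: "a \<in> carrier (Ch_over e (Suc (Suc q)))" "b = res e (bd (Suc (Suc q)) a)"
    using b unfolding fiber_boundary_iff de by auto
  let ?c = "bd (Suc (Suc q)) a"
  have ac: "a \<in> carrier (?C (Suc (Suc q)))" using free_space_mono[OF over_subset(1) a(1)] .
  have c: "?c \<in> carrier (?C (Suc q))" by (rule bd_closed[OF a(1) over_subset(1)])
  have ao: "a \<in> carrier (Ch_dim 1 (Suc (Suc q)))"
    by (rule free_space_mono[OF over_subset_over_dim[OF de] a(1)])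
  have bo: "b \<in> carrier (Ch_over e (Suc q))" unfolding a(2) by (rule res_closed[OF c subset_refl])
  have bC: "b \<in> carrier (?C (Suc q))" using free_space_mono[OF over_subset(1) bo] .
  have p0: "part 0 ?c \<in> carrier (Ch_dim 0 (Suc q))" by (rule part_closed[OF c subset_refl])
  then have p0C: "part 0 ?c \<in> carrier (?C (Suc q))" using free_space_mono[OF over_subset(2)] by blast
  have "part 1 ?c = b"
  proof (rule chain_eqI)
    show "part 1 ?c \<in> carrier (Ch_dim 1 (Suc q))" by (rule part_closed[OF c subset_refl])
    show "b \<in> carrier (Ch_dim 1 (Suc q))"
      by (rule free_space_mono[OF over_subset_over_dim[OF de] bo])
    fix \<tau> assume \<tau>: "\<tau> \<in> simplices Y 1"
    then have "sdim \<tau> = 1" by (simp add: simplices_def)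
    then have "res \<tau> (part 1 ?c) = res \<tau> (bd (Suc (Suc q)) (res \<tau> a))"
      using res_part res_bd_same_dim[OF ao \<tau>] by simp
    also have "\<dots> = res \<tau> b"
    proof (cases "\<tau> = e")
      case True
      then show ?thesis using res_id[OF a(1)] a(2) by (simp add: res_res)
    next
      case False
      then show ?thesis using res_other[OF a(1) False] res_other[OF bo False] by (simp add: res_zero bd_zero)
    qed
    finally show "res \<tau> (part 1 ?c) = res \<tau> b" .
  qed
  \<comment> \<open>Hence the boundaries of \<open>b\<close> and of \<open>part 0 ?c\<close>
    cancel, because \<open>?c\<close> is itself a boundary.\<close>
  then have split: "part 0 ?c \<oplus>\<^bsub>?C (Suc q)\<^esub> b = ?c" using split_chain[OF c] by simp
  have "bd (Suc q) (part 0 ?c) \<oplus>\<^bsub>?C q\<^esub> bd (Suc q) b = bd (Suc q) ?c"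
    using linear_map_add[OF linear_map_bd p0C bC] split by simp
  also have "\<dots> = \<zero>\<^bsub>?C q\<^esub>" using bd_bd[OF ac] by (simp add: free_space_simps)
  finally have sum: "bd (Suc q) (part 0 ?c) \<oplus>\<^bsub>?C q\<^esub> bd (Suc q) b = \<zero>\<^bsub>?C q\<^esub>" .
  have b1: "bd (Suc q) (part 0 ?c) \<in> carrier (?C q)" "bd (Suc q) b \<in> carrier (?C q)"
    using linear_map_closed[OF linear_map_bd] p0C bC by blast+
  have "bd (Suc q) b = \<ominus>\<^bsub>?C q\<^esub> bd (Suc q) (part 0 ?c)"
    using C.minus_equality[OF _ b1] sum C.a_comm[OF b1] by (simp add: C.minus_equality b1)
  then have "bd (Suc q) b = (\<ominus> \<one>) \<odot>\<^bsub>?C q\<^esub> bd (Suc q) (part 0 ?c)"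
    using minus_one_smult[OF module_free_space b1(1)] by simp
  then have "res {v} (bd (Suc q) b) = (\<ominus> \<one>) \<odot>\<^bsub>Ch_over {v} q\<^esub> res {v} (bd (Suc q) (part 0 ?c))"
    using linear_map_smult[OF linear_map_res _ b1(1)] by simp
  also have "res {v} (bd (Suc q) (part 0 ?c)) = res {v} (bd (Suc q) (res {v} ?c))"
    using res_bd_same_dim[OF p0 vY] res_part[of "{v}" 0] by (simp add: sdim_def)
  finally have r: "res {v} (bd (Suc q) b) =
      (\<ominus> \<one>) \<odot>\<^bsub>Ch_over {v} q\<^esub> res {v} (bd (Suc q) (res {v} ?c))" .
  have "res {v} (bd (Suc q) (res {v} ?c)) \<in> fiber_boundaries {v} q"
    unfolding fiber_boundary_iff using res_closed[OF c subset_refl, of "{v}"] by (auto simp: sdim_def)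
  note submodule_smult[OF submodule_boundaries[OF chain_complex_fiber] _ this]
  from submodule_smult[OF submodule_boundaries[OF chain_complex_fiber] degree_sign_closed this[of "\<ominus> \<one>"]]
  show ?thesis unfolding fiber_map_eq[OF e v bo] r
    by (simp add: fiber_chains_eq free_space_simps sdim_def)
qed

lemma cmor_leray_class:
  assumes e: "e \<in> simplices Y 1" and v: "v \<in> e" and x: "x \<in> carrier (Ch_over e (Suc q))"
  shows "cmor (leray q) e {v} (fiber_class e q x) =
    fiber_class {v} q (\<lambda>\<rho>. degree_sign q \<otimes> res {v} (bd (Suc q) x) \<rho>)"
proof -
  have de: "sdim e = 1" using e by (simp add: simplices_def)
  have eqs: "fiber_chains K X f e q = Ch_over e (Suc q)"
    "fiber_chains K X f {v} q = Ch_over {v} q"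
    by (simp_all add: fiber_chains_eq de) (simp add: sdim_def)
  have lin: "linear_map K (fiber_chains K X f e q) (fiber_chains K X f {v} q) (fiber_map K X ori f e {v} q)"
    unfolding eqs by (rule linear_map_cong[OF module_free_space linear_map_signed_bd])
      (simp add: fiber_map_eq[OF e v])
  have "cmor (leray q) e {v} (fiber_class e q x) = fiber_class {v} q (fiber_map K X ori f e {v} q x)"
    unfolding leray_cosheaf_def cosheaf.simps
    by (rule homology_map_class[OF chain_complex_fiber chain_complex_fiber lin fiber_map_boundaries[OF e v]])
      (use x in \<open>simp_all add: eqs\<close>)
  then show ?thesis unfolding fiber_map_eq[OF e v x] .
qed

end

section \<open>The boundary of the Leray cosheaf over a graph\<close>

lemma (in cring) summand_closed:
  assumes "\<And>i. i \<in> I \<Longrightarrow> Module.module R (M i)" "i \<in> I" "a \<in> carrier (M i)"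
  shows "summand I M i a \<in> carrier (direct_sum I M)"
proof (rule direct_sumI[where A = "{i}"])
  show "summand I M i a j \<in> carrier (M j)" if "j \<in> I" for j
  proof -
    interpret M: Module.module R "M j" by (rule assms(1)) fact
    show ?thesis using that assms(3) by (simp add: summand_def)
  qed
qed (use assms(2) in \<open>auto simp: summand_def\<close>)

context fibered_graph
begin

lemma part_other: "c \<in> carrier (Ch_dim p n) \<Longrightarrow> p \<noteq> p' \<Longrightarrow> part p' c = zero_chain"
  using free_spaceD(4)[of c "over_dim p n"]
  by (auto simp: part_def restrict_chain_def over_dim_def fun_eq_iff)

lemma over_dim_1_0: "over_dim 1 0 = {}"
proof -
  have False if "\<sigma> \<in> over_dim 1 0" for \<sigma>
  proof -
    have \<sigma>: "\<sigma> \<in> X" "card \<sigma> = Suc 0" "card (f ` \<sigma>) - 1 = 1"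
      using that by (auto simp: over_dim_def simplices_card sdim_def)
    then show False using card_image_le[OF simplex_finite[OF complex \<sigma>(1)], of f] by simp
  qed
  then show ?thesis by blast
qed

text \<open>The part over the edges of the boundary consists of the boundaries in the fibres,
  which vanish by hypothesis. If \<open>q = 0\<close> the hypothesis is void, but then the
  boundary consists of vertices of \<open>X\<close>, and none of these lies over an edge.\<close>

lemma bd_over_edges:
  assumes z: "z \<in> fiberwise_cycles 1 q"
  shows "bd (Suc q) z \<in> carrier (Ch_dim 0 q)"
proof (rule over_vertices_if)
  have zc: "z \<in> carrier (Ch_dim 1 (Suc q))" using fiberwise_cyclesD(1)[OF z] by simp
  show b: "bd (Suc q) z \<in> carrier (Ch q)" by (rule bd_closed[OF zc over_subset(2)])
  fix e assume e: "e \<in> simplices Y 1"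
  show "res e (bd (Suc q) z) = zero_chain"
  proof (cases "q = 0")
    case True
    have "res e (bd (Suc q) z) \<in> carrier (Ch_dim 1 q)"
      by (rule free_space_mono[OF over_subset_over_dim[OF base_dim[OF e]] res_closed[OF b subset_refl]])
    then have r: "res e (bd (Suc q) z) \<in> carrier (free_space K {})" unfolding True over_dim_1_0 .
    show ?thesis
    proof
      fix \<sigma> show "res e (bd (Suc q) z) \<sigma> = \<zero>" using free_spaceD(4)[OF r, of \<sigma>] by simp
    qed
  next
    case False
    have "res e (bd (sdim e + q) (res e z)) = zero_chain"
      using fiberwise_cyclesD(3)[OF z e] False unfolding fiber_cycle_iff by blast
    then show ?thesis using res_bd_same_dim[OF zc e] base_dim[OF e] by simp
  qed
qed

lemma fiberwise_cycles_vertices: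
  "w \<in> fiberwise_cycles 0 q \<longleftrightarrow>
    w \<in> carrier (Ch_dim 0 q) \<and> (q = 0 \<or> bd q w = zero_chain)"
proof (cases q)
  case 0
  have "res \<tau> w \<in> fiber_cycles \<tau> 0" if "w \<in> carrier (Ch_dim 0 0)" "\<tau> \<in> simplices Y 0" for \<tau>
    using res_closed[OF that(1) over_subset(2)] base_dim[OF that(2)] by (simp add: fiber_cycle_iff)
  then show ?thesis using 0 by (auto simp: fiberwise_cycles_def)
next
  case (Suc r)
  show ?thesis
  proof
    assume w: "w \<in> fiberwise_cycles 0 q"
    then have wc: "w \<in> carrier (Ch_dim 0 (Suc r))" using fiberwise_cyclesD(1)[OF w] Suc by simp
    have "bd (Suc r) w = zero_chain"
    proof (rule chain_eqI[OF bd_over_vertices[OF wc]])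
      show "zero_chain \<in> carrier (Ch_dim 0 r)" by (rule free_spaceI[where A = "{}"]) simp_all
      fix \<tau> assume \<tau>: "\<tau> \<in> simplices Y 0"
      show "res \<tau> (bd (Suc r) w) = res \<tau> zero_chain"
        using fiberwise_cyclesD(3)[OF w \<tau>] res_bd_same_dim[OF wc \<tau>] Suc base_dim[OF \<tau>]
        by (simp add: fiber_cycle_iff res_zero)
    qed
    then show "w \<in> carrier (Ch_dim 0 q) \<and> (q = 0 \<or> bd q w = zero_chain)"
      using wc Suc by simp
  next
    assume *: "w \<in> carrier (Ch_dim 0 q) \<and> (q = 0 \<or> bd q w = zero_chain)"
    then have wc: "w \<in> carrier (Ch_dim 0 (Suc r))" and b: "bd (Suc r) w = zero_chain"
      using Suc by simp_all
    have "res \<tau> w \<in> fiber_cycles \<tau> q" if \<tau>: "\<tau> \<in> simplices Y 0" for \<tau>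
      using res_closed[OF wc over_subset(2)] res_bd_same_dim[OF wc \<tau>] Suc base_dim[OF \<tau>] b
      by (simp add: fiber_cycle_iff res_zero)
    then show "w \<in> fiberwise_cycles 0 q" using wc Suc by (simp add: fiberwise_cycles_def)
  qed
qed

text \<open>On \<open>fiberwise_cycles 1 q\<close> this is the connecting map of the filtration,
  at the level of chains and with the sign of the transition maps.\<close>

definition edge_bd :: "nat \<Rightarrow> ('v set \<Rightarrow> 'k) \<Rightarrow> 'v set \<Rightarrow> 'k" where
  "edge_bd q z = (\<lambda>\<sigma>. degree_sign q \<otimes> bd (Suc q) z \<sigma>)"

abbreviation cycle_space :: "nat \<Rightarrow> nat \<Rightarrow> ('k, 'v set \<Rightarrow> 'k) module" where
  "cycle_space p q \<equiv> (Ch_dim p (p + q))\<lparr>carrier := fiberwise_cycles p q\<rparr>"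

lemma module_cycle_space: "Module.module K (cycle_space p q)"
  by (rule submodule_module[OF module_free_space submodule_fiberwise_cycles])

lemma linear_map_edge_bd:
  "linear_map K (Ch (Suc q)) (Ch q) (edge_bd q)"
proof -
  let ?N = "Ch q"
  interpret N: Module.module K ?N by (rule module_free_space)
  have "linear_map K ?N ?N (\<lambda>x. degree_sign q \<odot>\<^bsub>?N\<^esub> x)"
    by (rule linear_mapI) (simp_all add: N.smult_r_distr N.smult_assoc1[symmetric] m_comm)
  from linear_map_comp[OF linear_map_bd this] show ?thesis
    by (simp add: free_space_simps edge_bd_def[abs_def])
qed

lemma edge_bd_cycles:
  assumes z: "z \<in> fiberwise_cycles 1 q"
  shows "edge_bd q z \<in> fiberwise_cycles 0 q"
proof -
  let ?N = "Ch_dim 0 (0 + q)"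
  have zc: "z \<in> carrier (Ch (Suc q))" using fiberwise_cyclesD(2)[OF z] by simp
  have "bd (Suc q) z \<in> fiberwise_cycles 0 q"
    unfolding fiberwise_cycles_vertices
  proof
    show "bd (Suc q) z \<in> carrier (Ch_dim 0 q)" by (rule bd_over_edges[OF z])
    show "q = 0 \<or> bd q (bd (Suc q) z) = zero_chain"
      using bd_bd zc by (cases q) auto
  qed
  from submodule_smult[OF submodule_fiberwise_cycles degree_sign_closed this]
  show ?thesis by (simp add: edge_bd_def free_space_simps)
qed

lemma linear_map_edge_bd_cycles: "linear_map K (cycle_space 1 q) (cycle_space 0 q) (edge_bd q)"
proof (rule linear_mapI)
  fix x assume "x \<in> carrier (cycle_space 1 q)"
  then have x: "x \<in> fiberwise_cycles 1 q" by simp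
  then have xc: "x \<in> carrier (Ch (Suc q))" using fiberwise_cyclesD(2)[OF x] by simp
  show "edge_bd q x \<in> carrier (cycle_space 0 q)" using edge_bd_cycles[OF x] by simp
  show "edge_bd q (x \<oplus>\<^bsub>cycle_space 1 q\<^esub> y) = edge_bd q x \<oplus>\<^bsub>cycle_space 0 q\<^esub> edge_bd q y"
    if "y \<in> carrier (cycle_space 1 q)" for y
  proof -
    have "y \<in> carrier (Ch (Suc q))" using fiberwise_cyclesD(2)[of y 1 q] that by simp
    from linear_map_add[OF linear_map_edge_bd xc this] show ?thesis by (simp add: free_space_simps)
  qed
  show "edge_bd q (a \<odot>\<^bsub>cycle_space 1 q\<^esub> x) = a \<odot>\<^bsub>cycle_space 0 q\<^esub> edge_bd q x" if "a \<in> carrier K" for a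
    using linear_map_smult[OF linear_map_edge_bd that xc] by (simp add: free_space_simps)
qed

lemma linear_map_class_edge_bd:
  "linear_map K (cycle_space 1 q) (lchains q 0) (\<lambda>z. class_chain 0 q (edge_bd q z))"
  by (rule linear_map_comp[OF linear_map_edge_bd_cycles linear_map_class_chain])

text \<open>The contribution of the edge \<open>e\<close> to the boundary of a cosheaf chain whose
  value at \<open>e\<close> is \<open>x\<close>.\<close>

definition edge_term :: "nat \<Rightarrow> 'w set \<Rightarrow> ('v set \<Rightarrow> 'k) set \<Rightarrow> 'w set \<Rightarrow> ('v set \<Rightarrow> 'k) set" where
  "edge_term q e x = (\<Oplus>\<^bsub>lchains q 0\<^esub>i\<in>{..Suc 0}.
     (let vs = delete_nth i (oriY e) in
       [((-1) ^ i * reorder_sign (oriY (set vs)) vs)] \<cdot>\<^bsub>lchains q 0\<^esub>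
         summand (simplices Y 0) (cobj (leray q)) (set vs) (cmor (leray q) e (set vs) x)))"

text \<open>Up to the factor \<open>s e\<close>, both transition maps out of \<open>e\<close>
  restrict \<open>edge_bd q y\<close> to an end of \<open>e\<close>. The cosheaf boundary counts
  the head \<open>b\<close> positively and the tail \<open>a\<close> negatively, and these signs
  agree with those that \<open>class_chain\<close> attaches to the vertices, since \<open>s {b} =
  s e\<close> and \<open>s {a} = - s e\<close>. At all other vertices both sides vanish because
  \<open>y\<close> is concentrated over \<open>e\<close>.\<close>

lemma edge_term_class:
  assumes e: "e \<in> simplices Y 1" and y: "y \<in> fiberwise_cycles 1 q"
    and ye: "y \<in> carrier (Ch_over e (Suc q))"
  shows "edge_term q e (fiber_class e q (signed_res e y)) = class_chain 0 q (edge_bd q y)"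
proof -
  let ?D = "lchains q 0"
  interpret D: Module.module K ?D by (rule module_cosheaf_chains)
  obtain a b where ab: "oriY e = [a, b]" "a \<noteq> b" "e = {a, b}" "{a} \<in> simplices Y 0" "{b} \<in> simplices Y 0"
    using edgeE[OF e] .
  have abe: "a \<in> e" "b \<in> e" using ab(3) by simp_all
  note sgn = edge_signs[OF e ab(1)]
  let ?w = "edge_bd q y"
  have w: "?w \<in> fiberwise_cycles 0 q" by (rule edge_bd_cycles[OF y])
  have yC: "y \<in> carrier (Ch (Suc q))" using free_space_mono[OF over_subset(1) ye] .
  have by_c: "bd (Suc q) y \<sigma> \<in> carrier K" for \<sigma> using free_spaceD(1)[OF bd_closed[OF yC subset_refl]] .
  have sr: "signed_res e y = s e \<odot>\<^bsub>Ch (Suc q)\<^esub> y"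
    by (simp add: signed_res_def res_id[OF ye] free_space_simps)
  have x: "signed_res e y \<in> carrier (Ch_over e (Suc q))"
    using linear_map_closed[OF linear_map_signed_res yC] .
  have cm: "cmor (leray q) e {v} (fiber_class e q (signed_res e y)) =
      fiber_class {v} q (\<lambda>\<rho>. s e \<otimes> res {v} ?w \<rho>)" if v: "v \<in> e" for v
  proof -
    have "bd (Suc q) (signed_res e y) = (\<lambda>\<rho>. s e \<otimes> bd (Suc q) y \<rho>)"
      unfolding sr linear_map_smult[OF linear_map_bd s_closed yC] by (simp add: free_space_simps)
    then have "(\<lambda>\<rho>. degree_sign q \<otimes> res {v} (bd (Suc q) (signed_res e y)) \<rho>) = (\<lambda>\<rho>. s e \<otimes> res {v} ?w \<rho>)"
      using by_c by (auto simp: res_def restrict_chain_def edge_bd_def m_lcomm)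
    then show ?thesis unfolding cmor_leray_class[OF e v x] by simp
  qed
  have rw: "res {v} ?w \<in> fiber_cycles {v} q" if "{v} \<in> simplices Y 0" for v
    by (rule fiberwise_cyclesD(3)[OF w that])
  have srw: "(\<lambda>\<rho>. s e \<otimes> res {v} ?w \<rho>) \<in> fiber_cycles {v} q" if "{v} \<in> simplices Y 0" for v
    using submodule_smult[OF submodule_fiber_cycles s_closed rw[OF that]] by (simp add: free_space_simps)
  let ?c = "\<lambda>v. fiber_class {v} q (\<lambda>\<rho>. s e \<otimes> res {v} ?w \<rho>)"
  let ?S = "\<lambda>v. summand (simplices Y 0) (cobj (leray q)) {v} (?c v)"
  have cc: "?c v \<in> carrier (cobj (leray q) {v})" if "{v} \<in> simplices Y 0" for v
    using linear_map_closed[OF linear_map_fiber_class, of "\<lambda>\<rho>. s e \<otimes> res {v} ?w \<rho>" "{v}" q] srw[OF that] by simp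
  have Sc: "?S v \<in> carrier ?D" if "{v} \<in> simplices Y 0" for v
    unfolding cosheaf_chains_def
    by (rule summand_closed[where M = "cobj (leray q)" and i = "{v}", OF module_cobj that cc[OF that]])
  have vert: "{a} \<in> Y" "{b} \<in> Y" using ab(4,5) by (simp_all add: simplices_def)
  have "edge_term q e (fiber_class e q (signed_res e y)) = ?S b \<oplus>\<^bsub>?D\<^esub> (\<ominus> \<one>) \<odot>\<^bsub>?D\<^esub> ?S a"
  proof -
    let ?t = "\<lambda>i. let vs = delete_nth i (oriY e) in
       [((-1) ^ i * reorder_sign (oriY (set vs)) vs)] \<cdot>\<^bsub>?D\<^esub>
         summand (simplices Y 0) (cobj (leray q)) (set vs) (cmor (leray q) e (set vs) (fiber_class e q (signed_res e y)))"
    have t0: "?t 0 = ?S b"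
      using integer_multiple[OF module_cosheaf_chains Sc[OF ab(5)], of 1] Sc[OF ab(5)] cm[OF abe(2)]
      by (simp add: ab(1) delete_nth_def orient_vertex[OF vert(2)])
    have t1: "?t (Suc 0) = (\<ominus> \<one>) \<odot>\<^bsub>?D\<^esub> ?S a"
      using integer_multiple[OF module_cosheaf_chains Sc[OF ab(4)], of "- 1"] cm[OF abe(1)]
      by (simp add: ab(1) delete_nth_def orient_vertex[OF vert(1)] of_integer_minus)
    have "{..Suc 0} = {0, Suc 0}" by auto
    then have "edge_term q e (fiber_class e q (signed_res e y)) = (\<Oplus>\<^bsub>?D\<^esub>i\<in>{0, Suc 0}. ?t i)"
      by (simp only: edge_term_def)
    also have "\<dots> = ?t 0 \<oplus>\<^bsub>?D\<^esub> ?t (Suc 0)"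
    proof -
      have "?t 0 \<in> carrier ?D" "?t (Suc 0) \<in> carrier ?D"
        unfolding t0 t1 using Sc ab(4,5) by simp_all
      then show ?thesis by (subst D.finsum_insert) (simp_all del: One_nat_def)
    qed
    finally show ?thesis unfolding t0 t1 .
  qed
  also have "\<dots> = class_chain 0 q ?w"
  proof (rule direct_sum_eqI[where I = "simplices Y 0"])
    show "?S b \<oplus>\<^bsub>?D\<^esub> (\<ominus> \<one>) \<odot>\<^bsub>?D\<^esub> ?S a \<in> extensional (simplices Y 0)"
      by (simp add: cosheaf_chains_def direct_sum_simps)
    show "class_chain 0 q ?w \<in> extensional (simplices Y 0)" by (simp add: class_chain_def)
    fix \<tau> assume \<tau>: "\<tau> \<in> simplices Y 0"
    obtain v where v: "\<tau> = {v}" using vertexE[OF \<tau>] .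
    interpret C: Module.module K "cobj (leray q) {v}" by (rule module_cobj)
    interpret Ca: Module.module K "cobj (leray q) {a}" by (rule module_cobj)
    interpret Cb: Module.module K "cobj (leray q) {b}" by (rule module_cobj)
    have L: "(?S b \<oplus>\<^bsub>?D\<^esub> (\<ominus> \<one>) \<odot>\<^bsub>?D\<^esub> ?S a) \<tau> =
        (if v = b then ?c b else \<zero>\<^bsub>cobj (leray q) {v}\<^esub>) \<oplus>\<^bsub>cobj (leray q) {v}\<^esub>
        (\<ominus> \<one>) \<odot>\<^bsub>cobj (leray q) {v}\<^esub> (if v = a then ?c a else \<zero>\<^bsub>cobj (leray q) {v}\<^esub>)"
      using \<tau> v by (simp add: cosheaf_chains_def direct_sum_simps summand_def)
    have Rr: "class_chain 0 q ?w \<tau> = fiber_class {v} q (\<lambda>\<rho>. s {v} \<otimes> res {v} ?w \<rho>)"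
      using \<tau> v by (simp add: class_chain_def signed_res_def)
    consider "v = b" | "v = a" | "v \<notin> e" using ab(3) by blast
    then show "(?S b \<oplus>\<^bsub>?D\<^esub> (\<ominus> \<one>) \<odot>\<^bsub>?D\<^esub> ?S a) \<tau> = class_chain 0 q ?w \<tau>"
    proof cases
      case 1
      then show ?thesis unfolding L Rr using ab(2) cc[OF ab(5)] sgn by simp
    next
      case 2
      have sub: "fiber_class {a} q ((\<ominus> \<one>) \<odot>\<^bsub>Ch_over {a} (sdim {a} + q)\<^esub> (\<lambda>\<rho>. s e \<otimes> res {a} ?w \<rho>)) =
          (\<ominus> \<one>) \<odot>\<^bsub>cobj (leray q) {a}\<^esub> ?c a"
        using linear_map_smult[OF linear_map_fiber_class, of "\<ominus> \<one>" "\<lambda>\<rho>. s e \<otimes> res {a} ?w \<rho>" "{a}" q] srw[OF ab(4)] by simp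
      have "res {a} ?w \<rho> \<in> carrier K" for \<rho> using free_spaceD(1)[OF fiber_cycle_carrier[OF rw[OF ab(4)]]] .
      then have "(\<ominus> \<one>) \<odot>\<^bsub>Ch_over {a} (sdim {a} + q)\<^esub> (\<lambda>\<rho>. s e \<otimes> res {a} ?w \<rho>) = (\<lambda>\<rho>. s {a} \<otimes> res {a} ?w \<rho>)"
        using sgn by (simp add: free_space_simps l_minus)
      then show ?thesis unfolding L Rr using 2 ab(2) sub cc[OF ab(4)] v by simp
    next
      case 3
      have "res {v} (bd (Suc q) y) = zero_chain"
      proof -
        have "restrict_chain (\<lambda>\<sigma>. {v} \<subseteq> f ` \<sigma>) y = zero_chain"
        proof
          fix \<sigma> show "restrict_chain (\<lambda>\<sigma>. {v} \<subseteq> f ` \<sigma>) y \<sigma> = \<zero>"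
            using free_spaceD(4)[OF ye, of \<sigma>] 3 by (auto simp: restrict_chain_def over_def)
        qed
        then show ?thesis using res_bd_above[OF yC, of "{v}"] by (simp add: bd_zero res_zero)
      qed
      then have rv: "res {v} (bd (Suc q) y) \<rho> = \<zero>" for \<rho> by simp
      have "res {v} ?w = zero_chain"
      proof
        fix \<rho> show "res {v} ?w \<rho> = \<zero>"
          using rv[of \<rho>] by (auto simp: edge_bd_def res_def restrict_chain_def split: if_splits)
      qed
      moreover have "v \<noteq> a" "v \<noteq> b" using 3 ab(3) by auto
      ultimately show ?thesis unfolding L Rr using fiber_class_zero[of "{v}" q] by simp
    qed
  qed
  finally show ?thesis .
qed

text \<open>The right-hand side is linear in \<open>z\<close>, and \<open>z\<close> is the finite
  sum of its pieces over the edges, to which the preceding lemma applies. An edge may carry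
  simplices of \<open>z\<close> and yet have class zero; it is missing from the sum that defines
  the cosheaf boundary, but its term is zero.\<close>

lemma cosheaf_boundary_class_chain:
  assumes z: "z \<in> fiberwise_cycles 1 q"
  shows "lbd q (Suc 0) (class_chain 1 q z) = class_chain 0 q (edge_bd q z)"
proof -
  let ?D = "lchains q 0" and ?E = "simplices Y 1" and ?c = "class_chain 1 q z"
  interpret D: Module.module K ?D by (rule module_cosheaf_chains)
  note zc = fiberwise_cyclesD(1,2)[OF z]
  have zc': "z \<in> carrier (Ch (Suc q))" "z \<in> carrier (Ch_dim 1 (Suc q))"
    using zc by simp_all
  let ?T = "(\<lambda>\<sigma>. f ` \<sigma>) ` {\<sigma>. z \<sigma> \<noteq> \<zero>}"
  have T: "finite ?T" "?T \<subseteq> ?E" using free_spaceD(2,3)[OF zc(1)] over_dim_image by blast+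
  have rz: "res e z \<in> fiberwise_cycles 1 q" "res e z \<in> carrier (Ch_over e (Suc q))" if e: "e \<in> ?E" for e
  proof -
    show r: "res e z \<in> carrier (Ch_over e (Suc q))" by (rule res_closed[OF zc'(1) subset_refl])
    have "res \<tau> (res e z) \<in> fiber_cycles \<tau> q" if "\<tau> \<in> ?E" for \<tau>
      using fiberwise_cyclesD(3)[OF z that] res_other[OF r, of \<tau>] zero_fiber_cycle
      by (cases "\<tau> = e") (simp_all add: res_res)
    then show "res e z \<in> fiberwise_cycles 1 q"
      using free_space_mono[OF over_subset_over_dim[OF base_dim[OF e]] r] by (simp add: fiberwise_cycles_def)
  qed
  have term_eq: "edge_term q e (?c e) = class_chain 0 q (edge_bd q (res e z))" if e: "e \<in> ?E" for e
  proof -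
    have "signed_res e (res e z) = signed_res e z" by (simp add: signed_res_def res_res)
    then show ?thesis using edge_term_class[OF e rz[OF e]] e by (simp add: class_chain_def)
  qed
  have h0: "class_chain 0 q (edge_bd q zero_chain) = \<zero>\<^bsub>?D\<^esub>"
    using linear_map_zero[OF module_cycle_space module_cosheaf_chains linear_map_class_edge_bd]
    by (simp add: free_space_simps)
  have outside: "?c e = \<zero>\<^bsub>cobj (leray q) e\<^esub>" if e: "e \<in> ?E" "e \<notin> ?T" for e
  proof -
    have "signed_res e z = zero_chain"
      using that by (auto simp: signed_res_def res_def restrict_chain_def fun_eq_iff)
    then show ?thesis using fiber_class_zero e(1) by (simp add: class_chain_def)
  qed
  have null: "edge_term q e (?c e) = \<zero>\<^bsub>?D\<^esub>" if e: "e \<in> ?E" "?c e = \<zero>\<^bsub>cobj (leray q) e\<^esub>" for e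
  proof -
    have zm: "zero_chain \<in> fiberwise_cycles 1 q"
      using submodule_zero[OF submodule_fiberwise_cycles, of 1 q] by (simp add: free_space_simps)
    have zo: "zero_chain \<in> carrier (Ch_over e (Suc q))" by (rule free_spaceI[where A = "{}"]) simp_all
    have sr: "signed_res e zero_chain = zero_chain" by (simp add: signed_res_def res_zero)
    then show ?thesis using edge_term_class[OF e(1) zm zo] e(2) h0 fiber_class_zero by (simp add: sr)
  qed
  have tc: "edge_term q e (?c e) \<in> carrier ?D" if "e \<in> ?E" for e
    unfolding term_eq[OF that] by (rule linear_map_closed[OF linear_map_class_edge_bd]) (use rz[OF that] in simp)
  have "lbd q (Suc 0) ?c =
      (\<Oplus>\<^bsub>?D\<^esub>e\<in>{e \<in> ?E. ?c e \<noteq> \<zero>\<^bsub>cobj (leray q) e\<^esub>}. edge_term q e (?c e))"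
    unfolding cosheaf_boundary_def edge_term_def by simp
  also have "\<dots> = (\<Oplus>\<^bsub>?D\<^esub>e\<in>?T. edge_term q e (?c e))"
  proof (rule D.add.finprod_mono_neutral_cong_left)
    show "finite ?T" by (rule T(1))
    show "{e \<in> ?E. ?c e \<noteq> \<zero>\<^bsub>cobj (leray q) e\<^esub>} \<subseteq> ?T"
    proof
      fix e assume "e \<in> {e \<in> ?E. ?c e \<noteq> \<zero>\<^bsub>cobj (leray q) e\<^esub>}"
      then have "e \<in> ?E" and c: "?c e \<noteq> \<zero>\<^bsub>cobj (leray q) e\<^esub>" by simp_all
      show "e \<in> ?T"
      proof (rule ccontr)
        assume "e \<notin> ?T"
        with outside[OF \<open>e \<in> ?E\<close>] c show False by simp
      qed
    qed
    show "edge_term q e (?c e) = \<zero>\<^bsub>?D\<^esub>" if "e \<in> ?T - {e \<in> ?E. ?c e \<noteq> \<zero>\<^bsub>cobj (leray q) e\<^esub>}" for e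
    proof (rule null)
      show "e \<in> ?E" using that T(2) by blast
      then show "?c e = \<zero>\<^bsub>cobj (leray q) e\<^esub>" using that by simp
    qed
    show "(\<lambda>e. edge_term q e (?c e)) \<in> ?T \<rightarrow> carrier ?D" using tc T(2) by blast
  qed simp
  also have "\<dots> = (\<Oplus>\<^bsub>?D\<^esub>e\<in>?T. class_chain 0 q (edge_bd q (res e z)))"
    by (rule D.finsum_cong') (use term_eq tc T(2) in auto)
  also have "\<dots> = class_chain 0 q (edge_bd q (\<Oplus>\<^bsub>cycle_space 1 q\<^esub>e\<in>?T. res e z))"
    by (rule linear_map_finsum[OF module_cycle_space module_cosheaf_chains linear_map_class_edge_bd T(1), symmetric])
      (use rz T(2) in auto)
  also have "(\<Oplus>\<^bsub>cycle_space 1 q\<^esub>e\<in>?T. res e z) = z"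
  proof -
    have inc: "linear_map K (cycle_space 1 q) (Ch_dim 1 (1 + q)) (\<lambda>x. x)"
      by (rule linear_mapI) (use fiberwise_cyclesD(1)[where p = 1 and q = q] in simp_all)
    have "(\<Oplus>\<^bsub>cycle_space 1 q\<^esub>e\<in>?T. res e z) = (\<Oplus>\<^bsub>Ch_dim 1 (1 + q)\<^esub>e\<in>?T. res e z)"
      by (rule linear_map_finsum[OF module_cycle_space module_free_space inc T(1)]) (use rz T(2) in auto)
    also have "\<dots> = z"
    proof
      fix \<sigma>
      have zk: "z \<sigma> \<in> carrier K" using free_spaceD(1)[OF zc(1)] .
      have "(\<Oplus>\<^bsub>Ch_dim 1 (1 + q)\<^esub>e\<in>?T. res e z) \<sigma> = (\<Oplus>e\<in>?T. res e z \<sigma>)"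
        by (rule finsum_free_space[OF T(1)]) (use rz T(2) fiberwise_cyclesD(1) in blast)
      also have "\<dots> = (\<Oplus>e\<in>?T. if f ` \<sigma> = e then z \<sigma> else \<zero>)"
        by (rule finsum_cong') (use zk in \<open>auto simp: res_def restrict_chain_def\<close>)
      also have "\<dots> = z \<sigma>"
      proof (cases "f ` \<sigma> \<in> ?T")
        case True
        then show ?thesis using add.finprod_singleton[OF True T(1), of "\<lambda>_. z \<sigma>"] zk by simp
      next
        case False
        then have "(\<Oplus>e\<in>?T. if f ` \<sigma> = e then z \<sigma> else \<zero>) = (\<Oplus>e\<in>?T. \<zero>)"
          by (intro finsum_cong') auto
        moreover have "z \<sigma> = \<zero>" using False by blast
        ultimately show ?thesis by simp
      qed
      finally show "(\<Oplus>\<^bsub>Ch_dim 1 (1 + q)\<^esub>e\<in>?T. res e z) \<sigma> = z \<sigma>" .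
    qed
    finally show ?thesis .
  qed
  finally show ?thesis .
qed

end

section \<open>Homology of a complex over a graph\<close>

context fibered_graph
begin

lemma simplices_above_1: "simplices Y (Suc (Suc p)) = {}"
  using base_graph by (force simp: simplices_def)

lemma cosheaf_chains_above_1: "carrier (lchains q (Suc (Suc p))) = {\<lambda>_. undefined}"
  by (simp add: cosheaf_chains_def direct_sum_def simplices_above_1)

lemma cosheaf_boundary_above_1:
  "lbd q (Suc (Suc p)) c = \<zero>\<^bsub>lchains q (Suc p)\<^esub>"
proof -
  interpret D: Module.module K "lchains q (Suc p)" by (rule module_cosheaf_chains)
  show ?thesis by (simp add: cosheaf_boundary_def simplices_above_1)
qed

text \<open>The cosheaf boundary sums over the support of its argument, which changes under
  addition. Every chain over the edges has the form \<open>class_chain 1 q z\<close>, and on such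
  chains the boundary is already known to be linear in \<open>z\<close>.\<close>

lemma linear_map_cosheaf_boundary:
  "linear_map K (lchains q 1) (lchains q 0)
    (lbd q (Suc 0))"
proof (rule linear_mapI)
  note cc = linear_map_class_chain[where p = 1 and q = q]
  note h = linear_map_class_edge_bd[of q]
  interpret Z: Module.module K "cycle_space 1 q" by (rule module_cycle_space)
  fix x assume "x \<in> carrier (lchains q 1)"
  then obtain z where z: "z \<in> fiberwise_cycles 1 q" "class_chain 1 q z = x" by (rule class_chain_surj)
  then have zc: "z \<in> carrier (cycle_space 1 q)" by simp
  show "lbd q (Suc 0) x \<in> carrier (lchains q 0)"
    unfolding z(2)[symmetric] cosheaf_boundary_class_chain[OF z(1)] by (rule linear_map_closed[OF h zc])
  show "lbd q (Suc 0) (x \<oplus>\<^bsub>lchains q 1\<^esub> y) =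
      lbd q (Suc 0) x \<oplus>\<^bsub>lchains q 0\<^esub>
      lbd q (Suc 0) y" if y: "y \<in> carrier (lchains q 1)" for y
  proof -
    obtain w where w: "w \<in> fiberwise_cycles 1 q" "class_chain 1 q w = y" using y by (rule class_chain_surj)
    then have wc: "w \<in> carrier (cycle_space 1 q)" by simp
    have "z \<oplus>\<^bsub>cycle_space 1 q\<^esub> w \<in> fiberwise_cycles 1 q" using Z.a_closed[OF zc wc] by simp
    note cosheaf_boundary_class_chain[OF this]
    then show ?thesis
      unfolding z(2)[symmetric] w(2)[symmetric] cosheaf_boundary_class_chain[OF z(1)]
        cosheaf_boundary_class_chain[OF w(1)] linear_map_add[OF cc zc wc] linear_map_add[OF h zc wc] .
  qed
  show "lbd q (Suc 0) (a \<odot>\<^bsub>lchains q 1\<^esub> x) =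
      a \<odot>\<^bsub>lchains q 0\<^esub> lbd q (Suc 0) x" if a: "a \<in> carrier K" for a
  proof -
    have "a \<odot>\<^bsub>cycle_space 1 q\<^esub> z \<in> fiberwise_cycles 1 q" using Z.smult_closed[OF a zc] by simp
    note cosheaf_boundary_class_chain[OF this]
    then show ?thesis
      unfolding z(2)[symmetric] cosheaf_boundary_class_chain[OF z(1)]
        linear_map_smult[OF cc a zc] linear_map_smult[OF h a zc] .
  qed
qed

lemma chain_complex_cosheaf:
  "chain_complex K (lchains q) (lbd q)"
  unfolding chain_complex_def
proof (intro conjI allI ballI)
  show "Module.module K (lchains q n)" for n by (rule module_cosheaf_chains)
  show lin: "linear_map K (lchains q (Suc n)) (lchains q n)
      (lbd q (Suc n))" for n
  proof (cases n)
    case 0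
    then show ?thesis using linear_map_cosheaf_boundary by simp
  next
    case (Suc p)
    interpret D: Module.module K "lchains q (Suc p)" by (rule module_cosheaf_chains)
    show ?thesis unfolding Suc cosheaf_boundary_above_1[abs_def] by (rule linear_mapI) simp_all
  qed
  show "lbd q (Suc n) (lbd q (Suc (Suc n)) x) =
      \<zero>\<^bsub>lchains q n\<^esub>" for n x
    unfolding cosheaf_boundary_above_1
    by (rule linear_map_zero[OF module_cosheaf_chains module_cosheaf_chains lin])
qed

lemma trivial_cosheaf_homology:
  "carrier (lhom (Suc (Suc p)) q) = {\<zero>\<^bsub>lhom (Suc (Suc p)) q\<^esub>}"
proof -
  let ?C = "lchains q" and ?d = "lbd q"
  note cx = chain_complex_cosheaf[of q]
  have sub: "cycles ?C ?d (Suc (Suc p)) \<subseteq> {\<zero>\<^bsub>?C (Suc (Suc p))\<^esub>}"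
    using cosheaf_chains_above_1[of q p] submodule_subset[OF submodule_cycles[OF cx, of "Suc (Suc p)"]]
      submodule_subset[OF submodule_carrier[OF module_cosheaf_chains] submodule_zero[OF submodule_carrier[OF module_cosheaf_chains]], of q "Suc (Suc p)"]
    by auto
  interpret H: Module.module K "homology ?C ?d (Suc (Suc p))" by (rule module_homology[OF cx])
  have "x = \<zero>\<^bsub>homology ?C ?d (Suc (Suc p))\<^esub>" if x: "x \<in> carrier (homology ?C ?d (Suc (Suc p)))" for x
  proof -
    obtain z where z: "z \<in> cycles ?C ?d (Suc (Suc p))" "x = boundaries ?C ?d (Suc (Suc p)) +>\<^bsub>?C (Suc (Suc p))\<^esub> z"
      using x unfolding carrier_homology by blast
    have "z = \<zero>\<^bsub>?C (Suc (Suc p))\<^esub>" using z(1) sub by blast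
    then have "z \<in> boundaries ?C ?d (Suc (Suc p))" using submodule_zero[OF submodule_boundaries[OF cx]] by simp
    then show ?thesis unfolding z(2)
      using class_zero_iff[OF cx submodule_subset[OF submodule_cycles[OF cx] z(1)]] by simp
  qed
  then show ?thesis unfolding cosheaf_homology_def using H.zero_closed by blast
qed

lemma sign_negate_zero_sum:
  assumes "Module.module K M" "x \<in> carrier M" "y \<in> carrier M" "x \<oplus>\<^bsub>M\<^esub> y = \<zero>\<^bsub>M\<^esub>"
  shows "y = (\<ominus> \<one>) \<odot>\<^bsub>M\<^esub> x"
proof -
  interpret M: Module.module K M by fact
  have "\<ominus>\<^bsub>M\<^esub> x = y" using M.minus_equality[of y x] assms M.a_comm by simp
  then show ?thesis using minus_one_smult[OF assms(1,2)] by simp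
qed

lemma chain_split: "c \<in> carrier (Ch n) \<Longrightarrow> c = (\<lambda>\<sigma>. part 0 c \<sigma> \<oplus> part 1 c \<sigma>)"
  using split_chain[of c n] by (simp add: free_space_simps)

lemma bd_add: "x \<in> carrier (Ch (Suc n)) \<Longrightarrow> y \<in> carrier (Ch (Suc n)) \<Longrightarrow>
    bd (Suc n) (\<lambda>\<sigma>. x \<sigma> \<oplus> y \<sigma>) = (\<lambda>\<sigma>. bd (Suc n) x \<sigma> \<oplus> bd (Suc n) y \<sigma>)"
  using linear_map_add[OF linear_map_bd, of x n y] by (simp add: free_space_simps)

lemma bd_smult: "a \<in> carrier K \<Longrightarrow> x \<in> carrier (Ch (Suc n)) \<Longrightarrow>
    bd (Suc n) (\<lambda>\<sigma>. a \<otimes> x \<sigma>) = (\<lambda>\<sigma>. a \<otimes> bd (Suc n) x \<sigma>)"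
  using linear_map_smult[OF linear_map_bd, of a x n] by (simp add: free_space_simps)

lemma part_add: "part p (\<lambda>\<sigma>. x \<sigma> \<oplus> y \<sigma>) = (\<lambda>\<sigma>. part p x \<sigma> \<oplus> part p y \<sigma>)"
  by (auto simp: part_def restrict_chain_def)

lemma chain_add:
  assumes "x \<in> carrier (free_space K S)" "y \<in> carrier (free_space K S)"
  shows "(\<lambda>\<sigma>. x \<sigma> \<oplus> y \<sigma>) \<in> carrier (free_space K S)"
  using submodule_add[OF submodule_carrier[OF module_free_space] assms] by (simp add: free_space_simps)

lemma chain_smult:
  assumes "a \<in> carrier K" "x \<in> carrier (free_space K S)"
  shows "(\<lambda>\<sigma>. a \<otimes> x \<sigma>) \<in> carrier (free_space K S)"
  using submodule_smult[OF submodule_carrier[OF module_free_space] assms] by (simp add: free_space_simps)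

lemma parts_closed:
  assumes "c \<in> carrier (Ch n)"
  shows "part 0 c \<in> carrier (Ch_dim 0 n)" "part 1 c \<in> carrier (Ch_dim 1 n)"
    "part 0 c \<in> carrier (Ch n)" "part 1 c \<in> carrier (Ch n)"
  using part_closed[OF assms subset_refl] free_space_mono[OF over_subset(2)] by blast+

lemma Ch_dim_Ch: "c \<in> carrier (Ch_dim p n) \<Longrightarrow> c \<in> carrier (Ch n)"
  by (rule free_space_mono[OF over_subset(2)])

text \<open>Faces of simplices over a vertex lie over that vertex, so only the edge part of a chain
  contributes to the edge part of its boundary.\<close>

lemma edge_part_bd:
  assumes c: "c \<in> carrier (Ch (Suc n))"
  shows "part 1 (bd (Suc n) c) = part 1 (bd (Suc n) (part 1 c))"
proof -
  have "bd (Suc n) c = (\<lambda>\<sigma>. bd (Suc n) (part 0 c) \<sigma> \<oplus> bd (Suc n) (part 1 c) \<sigma>)"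
    using bd_add[OF parts_closed(3,4)[OF c]] chain_split[OF c] by simp
  moreover have "part 1 (bd (Suc n) (part 0 c)) = zero_chain"
    using part_other[OF bd_over_vertices[OF parts_closed(1)[OF c]]] by simp
  moreover have "part 1 (bd (Suc n) (part 1 c)) \<sigma> \<in> carrier K" for \<sigma>
    using free_spaceD(1)[OF parts_closed(2)[OF bd_closed[OF parts_closed(2)[OF c] over_subset(2)]]] .
  ultimately show ?thesis by (simp add: part_add)
qed

lemma edge_part_cycle:
  assumes c: "c \<in> carrier (Ch (Suc q))" and z: "part 1 (bd (Suc q) c) = zero_chain"
  shows "part 1 c \<in> fiberwise_cycles 1 q"
  unfolding fiberwise_cycles_def
proof (intro CollectI conjI ballI)
  show "part 1 c \<in> carrier (Ch_dim 1 (1 + q))" using parts_closed(2)[OF c] by simp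
  fix e assume e: "e \<in> simplices Y 1"
  have "res e (bd (Suc q) (res e (part 1 c))) = res e (bd (Suc q) (part 1 c))"
    using res_bd_same_dim[OF parts_closed(2)[OF c] e] by simp
  also have "\<dots> = res e (part 1 (bd (Suc q) (part 1 c)))" unfolding res_part[OF base_dim[OF e]] ..
  also have "\<dots> = zero_chain" unfolding edge_part_bd[OF c, symmetric] z by (rule res_zero)
  finally show "res e (part 1 c) \<in> fiber_cycles e q"
    using res_closed[OF parts_closed(4)[OF c] subset_refl, of e] base_dim[OF e] by (simp add: fiber_cycle_iff)
qed

abbreviation total_cycles :: "nat \<Rightarrow> ('v set \<Rightarrow> 'k) set" where
  "total_cycles \<equiv> cycles (chains K X) bd"

abbreviation total_boundaries :: "nat \<Rightarrow> ('v set \<Rightarrow> 'k) set" where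
  "total_boundaries \<equiv> boundaries (chains K X) bd"

abbreviation total_space :: "nat \<Rightarrow> ('k, 'v set \<Rightarrow> 'k) module" where
  "total_space k \<equiv> (Ch k)\<lparr>carrier := total_cycles k\<rparr>"

lemma total_cycle_iff:
  "z \<in> total_cycles k \<longleftrightarrow> z \<in> carrier (Ch k) \<and> (k = 0 \<or> bd k z = zero_chain)"
  by (cases k) (auto simp: cycles_def chains_def free_space_simps)

lemma total_boundary_iff:
  "z \<in> total_boundaries k \<longleftrightarrow> (\<exists>c\<in>carrier (Ch (Suc k)). z = bd (Suc k) c)"
  by (auto simp: boundaries_def chains_def)

lemma module_total_space: "Module.module K (total_space k)"
  using module_cycles[OF chain_complex_simplicial] by (simp add: chains_def)

lemma submodule_total_boundaries: "submodule (total_boundaries k) K (total_space k)"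
  using submodule_boundaries_cycles[OF chain_complex_simplicial] by (simp add: chains_def)

lemma simplicial_homology_eq:
  "simplicial_homology K X ori k = quotient_space (total_space k) (total_boundaries k)"
  by (simp add: simplicial_homology_def homology_def chains_def)

lemma module_lhom: "Module.module K (lhom p q)"
  unfolding cosheaf_homology_def by (rule module_homology[OF chain_complex_cosheaf])

lemma fiberwise_cycles_0_iff:
  "z \<in> fiberwise_cycles 0 k \<longleftrightarrow> z \<in> carrier (Ch_dim 0 k) \<and> z \<in> total_cycles k"
  unfolding fiberwise_cycles_vertices total_cycle_iff using Ch_dim_Ch by blast

lemma submodule_vertex_cycles: "submodule (fiberwise_cycles 0 k) K (total_space k)"
proof (rule submodule_criterion[OF module_total_space])
  note sub = submodule_fiberwise_cycles[of 0 k]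
  show "fiberwise_cycles 0 k \<subseteq> carrier (total_space k)" using fiberwise_cycles_0_iff by auto
  show "\<zero>\<^bsub>total_space k\<^esub> \<in> fiberwise_cycles 0 k" using submodule_zero[OF sub] by (simp add: free_space_simps)
  show "x \<oplus>\<^bsub>total_space k\<^esub> y \<in> fiberwise_cycles 0 k"
    if "x \<in> fiberwise_cycles 0 k" "y \<in> fiberwise_cycles 0 k" for x y
    using submodule_add[OF sub that] by (simp add: free_space_simps)
  show "a \<odot>\<^bsub>total_space k\<^esub> x \<in> fiberwise_cycles 0 k" if "a \<in> carrier K" "x \<in> fiberwise_cycles 0 k" for a x
    using submodule_smult[OF sub that] by (simp add: free_space_simps)
qed

lemma total_space_restrict: "total_space k\<lparr>carrier := fiberwise_cycles 0 k\<rparr> = cycle_space 0 k"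
  by (simp add: free_space_def)

lemma edge_bd_eq: "w \<in> fiberwise_cycles 1 q \<Longrightarrow> edge_bd q w = bd (Suc q) (\<lambda>\<sigma>. degree_sign q \<otimes> w \<sigma>)"
  using bd_smult[OF degree_sign_closed, of w q] fiberwise_cyclesD(2)[of w 1 q] by (simp add: edge_bd_def)

lemma class_chain_vertices_zero_iff:
  assumes "z \<in> fiberwise_cycles 0 q"
  shows "class_chain 0 q z = \<zero>\<^bsub>lchains q 0\<^esub> \<longleftrightarrow> (\<exists>a\<in>carrier (Ch_dim 0 (Suc q)). z = bd (Suc q) a)"
proof -
  have "part 0 (bd (Suc q) a) = bd (Suc q) a" if "a \<in> carrier (Ch_dim 0 (Suc q))" for a
    by (rule part_id[OF bd_over_vertices[OF that]])
  then show ?thesis using class_chain_zero_iff[OF assms] by simp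
qed

text \<open>Therefore a cosheaf class over the vertices bounds if and only if it comes from the
  boundary in \<open>X\<close> of a fiberwise cycle over the edges.\<close>

lemma cosheaf_boundaries_0:
  "boundaries (lchains q) (lbd q) 0 = (\<lambda>w. class_chain 0 q (edge_bd q w)) ` fiberwise_cycles 1 q"
proof
  show "boundaries (lchains q) (lbd q) 0 \<subseteq> (\<lambda>w. class_chain 0 q (edge_bd q w)) ` fiberwise_cycles 1 q"
  proof
    fix x assume "x \<in> boundaries (lchains q) (lbd q) 0"
    then obtain c where c: "c \<in> carrier (lchains q 1)" "x = lbd q (Suc 0) c" by (auto simp: boundaries_def)
    obtain w where w: "w \<in> fiberwise_cycles 1 q" "class_chain 1 q w = c" using c(1) by (rule class_chain_surj)
    then show "x \<in> (\<lambda>w. class_chain 0 q (edge_bd q w)) ` fiberwise_cycles 1 q"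
      using c(2) cosheaf_boundary_class_chain[OF w(1)] by blast
  qed
  show "(\<lambda>w. class_chain 0 q (edge_bd q w)) ` fiberwise_cycles 1 q \<subseteq> boundaries (lchains q) (lbd q) 0"
  proof
    fix x assume "x \<in> (\<lambda>w. class_chain 0 q (edge_bd q w)) ` fiberwise_cycles 1 q"
    then obtain w where w: "w \<in> fiberwise_cycles 1 q" "x = class_chain 0 q (edge_bd q w)" by blast
    have "class_chain 1 q w \<in> carrier (lchains q 1)" using linear_map_closed[OF linear_map_class_chain] w(1) by simp
    then show "x \<in> boundaries (lchains q) (lbd q) 0"
      unfolding boundaries_def w(2) cosheaf_boundary_class_chain[OF w(1), symmetric] by simp
  qed
qed

subsection \<open>The class of a cycle over the vertices\<close>

definition vertex_class :: "nat \<Rightarrow> ('v set \<Rightarrow> 'k) \<Rightarrow> ('w set \<Rightarrow> ('v set \<Rightarrow> 'k) set) set" where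
  "vertex_class k z = boundaries (lchains k) (lbd k) 0 +>\<^bsub>lchains k 0\<^esub> class_chain 0 k z"

lemma linear_map_vertex_class:
  "linear_map K (total_space k\<lparr>carrier := fiberwise_cycles 0 k\<rparr>) (lhom 0 k) (vertex_class k)"
proof -
  have "(lchains k 0)\<lparr>carrier := cycles (lchains k) (lbd k) 0\<rparr> = lchains k 0" by (simp add: cycles_def)
  note linear_map_class[OF chain_complex_cosheaf[of k], where n = 0, unfolded this]
  from linear_map_comp[OF linear_map_class_chain this] show ?thesis
    unfolding total_space_restrict vertex_class_def[abs_def] cosheaf_homology_def .
qed

lemma vertex_class_surj:
  assumes "x \<in> carrier (lhom 0 k)"
  shows "\<exists>z\<in>fiberwise_cycles 0 k. vertex_class k z = x"
proof -
  have "cycles (lchains k) (lbd k) 0 = carrier (lchains k 0)" by (simp add: cycles_def)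
  then obtain c where c: "c \<in> carrier (lchains k 0)" "x = boundaries (lchains k) (lbd k) 0 +>\<^bsub>lchains k 0\<^esub> c"
    using assms unfolding cosheaf_homology_def carrier_homology by blast
  obtain z where "z \<in> fiberwise_cycles 0 k" "class_chain 0 k z = c" using c(1) by (rule class_chain_surj)
  then show ?thesis using c(2) by (auto simp: vertex_class_def)
qed

text \<open>Split a chain of \<open>X\<close> into its part over the edges and its part over the
  vertices. If \<open>z\<close> is its boundary, the part over the edges is a fiberwise cycle
  whose cosheaf boundary is, up to sign, the class chain of \<open>z\<close>; the part over the
  vertices contributes a fiberwise boundary. Conversely, if a fiberwise cycle over the edges
  accounts for the class chain of \<open>z\<close>, what is left of \<open>z\<close> bounds over
  the vertices.\<close>

lemma vertex_class_zero_iff: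
  assumes z: "z \<in> fiberwise_cycles 0 k"
  shows "vertex_class k z = \<zero>\<^bsub>lhom 0 k\<^esub> \<longleftrightarrow> z \<in> total_boundaries k"
proof -
  note cc0_add = linear_map_add[OF linear_map_class_chain[where p = 0], simplified, unfolded free_space_simps]
  note cc0_smult = linear_map_smult[OF linear_map_class_chain[where p = 0], simplified, unfolded free_space_simps]
  have zC: "z \<in> carrier (Ch_dim 0 k)" using z fiberwise_cycles_0_iff by blast
  have cz: "class_chain 0 k z \<in> carrier (lchains k 0)" using linear_map_closed[OF linear_map_class_chain] z by simp
  interpret D: Module.module K "lchains k 0" by (rule module_cosheaf_chains)
  have "vertex_class k z = \<zero>\<^bsub>lhom 0 k\<^esub> \<longleftrightarrow> class_chain 0 k z \<in> boundaries (lchains k) (lbd k) 0"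
    unfolding vertex_class_def cosheaf_homology_def by (rule class_zero_iff[OF chain_complex_cosheaf cz])
  also have "\<dots> \<longleftrightarrow> z \<in> total_boundaries k"
  proof
    assume "class_chain 0 k z \<in> boundaries (lchains k) (lbd k) 0"
    then obtain w where w: "w \<in> fiberwise_cycles 1 k" "class_chain 0 k z = class_chain 0 k (edge_bd k w)"
      unfolding cosheaf_boundaries_0 by blast
    have wC: "w \<in> carrier (Ch (Suc k))" using fiberwise_cyclesD(2)[OF w(1)] by simp
    have e: "edge_bd k w \<in> fiberwise_cycles 0 k" by (rule edge_bd_cycles[OF w(1)])
    have me: "(\<lambda>\<sigma>. \<ominus> \<one> \<otimes> edge_bd k w \<sigma>) \<in> fiberwise_cycles 0 k"
      using submodule_smult[OF submodule_vertex_cycles, of "\<ominus> \<one>", OF _ e] by (simp add: free_space_simps)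
    let ?x = "\<lambda>\<sigma>. z \<sigma> \<oplus> \<ominus> \<one> \<otimes> edge_bd k w \<sigma>"
    have x: "?x \<in> fiberwise_cycles 0 k" using submodule_add[OF submodule_vertex_cycles z me] by (simp add: free_space_simps)
    have "class_chain 0 k ?x = class_chain 0 k z \<oplus>\<^bsub>lchains k 0\<^esub> (\<ominus> \<one>) \<odot>\<^bsub>lchains k 0\<^esub> class_chain 0 k (edge_bd k w)"
      using cc0_add[OF z me] cc0_smult[OF _ e, of "\<ominus> \<one>"] by simp
    also have "\<dots> = \<zero>\<^bsub>lchains k 0\<^esub>"
      unfolding w(2)[symmetric] using cz minus_one_smult[OF module_cosheaf_chains cz] by (simp add: D.r_neg)
    finally obtain a where a: "a \<in> carrier (Ch_dim 0 (Suc k))" "?x = bd (Suc k) a"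
      using class_chain_vertices_zero_iff[OF x] by blast
    have ek: "edge_bd k w \<sigma> \<in> carrier K" for \<sigma> using free_spaceD(1)[OF fiberwise_cyclesD(1)[OF e]] .
    have zk: "z \<sigma> \<in> carrier K" for \<sigma> using free_spaceD(1)[OF zC] .
    have "z = (\<lambda>\<sigma>. ?x \<sigma> \<oplus> edge_bd k w \<sigma>)"
      using ek zk by (simp add: l_minus a_assoc l_neg)
    also have "\<dots> = (\<lambda>\<sigma>. bd (Suc k) a \<sigma> \<oplus> bd (Suc k) (\<lambda>\<sigma>. degree_sign k \<otimes> w \<sigma>) \<sigma>)"
      by (intro ext arg_cong2[where f = "add K"] fun_cong[OF a(2)] fun_cong[OF edge_bd_eq[OF w(1)]])
    also have "\<dots> = bd (Suc k) (\<lambda>\<sigma>. a \<sigma> \<oplus> degree_sign k \<otimes> w \<sigma>)"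
      by (rule bd_add[OF Ch_dim_Ch[OF a(1)] chain_smult[OF degree_sign_closed wC], symmetric])
    finally show "z \<in> total_boundaries k" unfolding total_boundary_iff
      using chain_add[OF Ch_dim_Ch[OF a(1)] chain_smult[OF degree_sign_closed wC]] by blast
  next
    assume "z \<in> total_boundaries k"
    then obtain c where c: "c \<in> carrier (Ch (Suc k))" "z = bd (Suc k) c" unfolding total_boundary_iff by blast
    have "part 1 z = zero_chain" by (rule part_other[OF zC]) simp
    then have c1: "part 1 c \<in> fiberwise_cycles 1 k" using edge_part_cycle[OF c(1)] c(2) by simp
    let ?w = "\<lambda>\<sigma>. degree_sign k \<otimes> part 1 c \<sigma>"
    have w: "?w \<in> fiberwise_cycles 1 k"
      using submodule_smult[OF submodule_fiberwise_cycles degree_sign_closed c1] by (simp add: free_space_simps)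
    have c1k: "part 1 c \<sigma> \<in> carrier K" for \<sigma> using free_spaceD(1)[OF parts_closed(2)[OF c(1)]] .
    have ew: "edge_bd k ?w = bd (Suc k) (part 1 c)"
      unfolding edge_bd_eq[OF w] using c1k by (simp add: m_assoc[symmetric] degree_sign_square)
    have b1: "bd (Suc k) (part 1 c) \<in> fiberwise_cycles 0 k" "class_chain 0 k (bd (Suc k) (part 1 c)) \<in> boundaries (lchains k) (lbd k) 0"
      unfolding ew[symmetric] cosheaf_boundaries_0 by (rule edge_bd_cycles[OF w], rule imageI[OF w])
    have b0c: "bd (Suc k) (part 0 c) \<in> carrier (Ch_dim 0 k)"
      by (rule bd_over_vertices[OF parts_closed(1)[OF c(1)]])
    have "bd (Suc k) (part 0 c) \<in> total_cycles k"
      unfolding total_cycle_iff using Ch_dim_Ch[OF b0c] bd_bd parts_closed(3)[OF c(1)] by (cases k) auto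
    then have b0: "bd (Suc k) (part 0 c) \<in> fiberwise_cycles 0 k" using b0c fiberwise_cycles_0_iff by blast
    have "class_chain 0 k (bd (Suc k) (part 0 c)) = \<zero>\<^bsub>lchains k 0\<^esub>"
      unfolding class_chain_vertices_zero_iff[OF b0] using parts_closed(1)[OF c(1)] by blast
    moreover have "z = (\<lambda>\<sigma>. bd (Suc k) (part 0 c) \<sigma> \<oplus> bd (Suc k) (part 1 c) \<sigma>)"
      unfolding c(2) using bd_add[OF parts_closed(3,4)[OF c(1)]] chain_split[OF c(1)] by simp
    ultimately have "class_chain 0 k z = class_chain 0 k (bd (Suc k) (part 1 c))"
      using cc0_add[OF b0 b1(1)] linear_map_closed[OF linear_map_class_chain[where p = 0 and q = k]] b1(1) by simp
    then show "class_chain 0 k z \<in> boundaries (lchains k) (lbd k) 0" using b1(2) by simp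
  qed
  finally show ?thesis .
qed

subsection \<open>The class of the edge part of a cycle\<close>

definition edge_class :: "nat \<Rightarrow> ('v set \<Rightarrow> 'k) \<Rightarrow> ('w set \<Rightarrow> ('v set \<Rightarrow> 'k) set) set" where
  "edge_class q z = boundaries (lchains q) (lbd q) 1 +>\<^bsub>lchains q 1\<^esub> class_chain 1 q (part 1 z)"

lemma total_cycleD:
  assumes "v \<in> total_cycles (Suc q)"
  shows "v \<in> carrier (Ch (Suc q))" "bd (Suc q) v = zero_chain"
  using assms by (simp_all add: total_cycle_iff)

lemma edge_part_total_cycle:
  assumes v: "v \<in> total_cycles (Suc q)"
  shows "part 1 v \<in> fiberwise_cycles 1 q"
  by (rule edge_part_cycle[OF total_cycleD(1)[OF v]])
    (simp add: total_cycleD(2)[OF v] part_def restrict_chain_def)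

text \<open>In a cycle of \<open>X\<close> the boundary of the edge part is minus the boundary of
  the part over the vertices, so it is zero in the homology of the fibres over the
  vertices.\<close>

lemma edge_class_chain_cycle:
  assumes v: "v \<in> total_cycles (Suc q)"
  shows "class_chain 1 q (part 1 v) \<in> cycles (lchains q) (lbd q) 1"
proof -
  note vc = total_cycleD[OF v]
  have "class_chain 0 q (edge_bd q (part 1 v)) = \<zero>\<^bsub>lchains q 0\<^esub>"
    unfolding class_chain_vertices_zero_iff[OF edge_bd_cycles[OF edge_part_total_cycle[OF v]]]
  proof (rule bexI)
    let ?a = "\<lambda>\<sigma>. degree_sign q \<otimes> (\<ominus> \<one> \<otimes> part 0 v \<sigma>)"
    show "?a \<in> carrier (Ch_dim 0 (Suc q))"
      using chain_smult[OF degree_sign_closed chain_smult[OF _ parts_closed(1)[OF vc(1)], of "\<ominus> \<one>"]] by simp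
    have b: "bd (Suc q) (part 0 v) \<in> carrier (Ch q)" "bd (Suc q) (part 1 v) \<in> carrier (Ch q)"
      using linear_map_closed[OF linear_map_bd] parts_closed(3,4)[OF vc(1)] by blast+
    have "bd (Suc q) (part 0 v) \<oplus>\<^bsub>Ch q\<^esub> bd (Suc q) (part 1 v) = \<zero>\<^bsub>Ch q\<^esub>"
      using bd_add[OF parts_closed(3,4)[OF vc(1)]] chain_split[OF vc(1)] vc(2) by (simp add: free_space_simps)
    from sign_negate_zero_sum[OF module_free_space b this]
    have "bd (Suc q) (part 1 v) = (\<lambda>\<sigma>. \<ominus> \<one> \<otimes> bd (Suc q) (part 0 v) \<sigma>)" by (simp add: free_space_simps)
    then show "edge_bd q (part 1 v) = bd (Suc q) ?a"
      using bd_smult[OF degree_sign_closed chain_smult[OF _ parts_closed(3)[OF vc(1)], of "\<ominus> \<one>"]]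
        bd_smult[OF _ parts_closed(3)[OF vc(1)], of "\<ominus> \<one>"]
      by (simp add: edge_bd_def)
  qed
  then show ?thesis
    using linear_map_closed[OF linear_map_class_chain, of "part 1 v" 1 q] edge_part_total_cycle[OF v] cosheaf_boundary_class_chain[OF edge_part_total_cycle[OF v]]
    by (simp add: cycles_def)
qed

lemma linear_map_edge_part: "linear_map K (total_space (Suc q)) (cycle_space 1 q) (part 1)"
  by (rule linear_mapI)
    (use edge_part_total_cycle in \<open>auto simp: free_space_simps part_add part_def restrict_chain_def\<close>)

lemma linear_map_edge_class: "linear_map K (total_space (Suc q)) (lhom 1 q) (edge_class q)"
proof -
  have "linear_map K (total_space (Suc q)) ((lchains q 1)\<lparr>carrier := cycles (lchains q) (lbd q) 1\<rparr>)
      (\<lambda>z. class_chain 1 q (part 1 z))"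
    by (rule linear_map_corestrict[OF linear_map_comp[OF linear_map_edge_part linear_map_class_chain]])
      (simp add: edge_class_chain_cycle del: One_nat_def)
  from linear_map_comp[OF this linear_map_class[OF chain_complex_cosheaf]] show ?thesis
    unfolding edge_class_def[abs_def] cosheaf_homology_def .
qed

lemma cosheaf_boundaries_1: "boundaries (lchains q) (lbd q) 1 = {\<zero>\<^bsub>lchains q 1\<^esub>}"
  using submodule_carrier[OF module_cosheaf_chains, THEN submodule_zero, of q "Suc (Suc 0)"]
  by (auto simp: boundaries_def cosheaf_boundary_above_1)

text \<open>If the cosheaf boundary of a class vanishes, the boundary in \<open>X\<close> of a
  representing chain over the edges also bounds a chain over the vertices. Subtracting the latter
  chain produces a cycle of \<open>X\<close>.\<close>

lemma edge_class_surj: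
  assumes x: "x \<in> carrier (lhom 1 q)"
  shows "\<exists>v\<in>total_cycles (Suc q). edge_class q v = x"
proof -
  obtain c where c: "c \<in> cycles (lchains q) (lbd q) 1" "x = boundaries (lchains q) (lbd q) 1 +>\<^bsub>lchains q 1\<^esub> c"
    using x unfolding cosheaf_homology_def carrier_homology by blast
  have c': "c \<in> carrier (lchains q 1)" "lbd q (Suc 0) c = \<zero>\<^bsub>lchains q 0\<^esub>" using c(1) by (simp_all add: cycles_def)
  obtain w where w: "w \<in> fiberwise_cycles 1 q" "class_chain 1 q w = c" using c'(1) by (rule class_chain_surj)
  have wc: "w \<in> carrier (Ch_dim 1 (Suc q))" using fiberwise_cyclesD(1)[OF w(1)] by simp
  have "class_chain 0 q (edge_bd q w) = \<zero>\<^bsub>lchains q 0\<^esub>"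
    using cosheaf_boundary_class_chain[OF w(1)] w(2) c'(2) by simp
  then obtain a where a: "a \<in> carrier (Ch_dim 0 (Suc q))" "edge_bd q w = bd (Suc q) a"
    unfolding class_chain_vertices_zero_iff[OF edge_bd_cycles[OF w(1)]] by blast
  let ?a = "\<lambda>\<sigma>. degree_sign q \<otimes> (\<ominus> \<one> \<otimes> a \<sigma>)"
  have ac: "?a \<in> carrier (Ch_dim 0 (Suc q))"
    using chain_smult[OF degree_sign_closed chain_smult[OF _ a(1), of "\<ominus> \<one>"]] by simp
  let ?v = "\<lambda>\<sigma>. ?a \<sigma> \<oplus> w \<sigma>"
  have bw: "bd (Suc q) w \<sigma> \<in> carrier K" for \<sigma> using free_spaceD(1)[OF bd_closed[OF wc over_subset(2)]] .
  have "bd (Suc q) ?v = (\<lambda>\<sigma>. degree_sign q \<otimes> (\<ominus> \<one> \<otimes> bd (Suc q) a \<sigma>) \<oplus> bd (Suc q) w \<sigma>)"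
    using bd_add[OF Ch_dim_Ch[OF ac] Ch_dim_Ch[OF wc]] bd_smult[OF degree_sign_closed chain_smult[OF _ Ch_dim_Ch[OF a(1)], of "\<ominus> \<one>"]]
      bd_smult[OF _ Ch_dim_Ch[OF a(1)], of "\<ominus> \<one>"] by simp
  also have "\<dots> = zero_chain"
  proof
    fix \<sigma>
    have "degree_sign q \<otimes> (\<ominus> \<one> \<otimes> (degree_sign q \<otimes> bd (Suc q) w \<sigma>)) =
        \<ominus> (degree_sign q \<otimes> degree_sign q \<otimes> bd (Suc q) w \<sigma>)"
      using bw[of \<sigma>] by (simp add: l_minus r_minus m_assoc)
    then show "degree_sign q \<otimes> (\<ominus> \<one> \<otimes> bd (Suc q) a \<sigma>) \<oplus> bd (Suc q) w \<sigma> = \<zero>"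
      using bw[of \<sigma>] by (simp add: a(2)[symmetric] edge_bd_def degree_sign_square l_neg)
  qed
  finally have v: "?v \<in> total_cycles (Suc q)"
    using chain_add[OF Ch_dim_Ch[OF ac] Ch_dim_Ch[OF wc]] by (simp add: total_cycle_iff)
  have "part 1 ?a = zero_chain" by (rule part_other[OF ac]) simp
  then have "part 1 ?v = w"
    unfolding part_add part_id[OF wc]
    using free_spaceD(1)[OF wc] by simp
  then have "edge_class q ?v = x" using c(2) w(2) by (simp add: edge_class_def)
  with v show ?thesis by blast
qed

text \<open>There are no boundaries in \<open>C\<^sub>1(Y; L\<^sub>q)\<close>, so the class
  vanishes only if the edge part of \<open>v\<close> bounds in the fibres over the edges.
  Subtracting from \<open>v\<close> the boundary in \<open>X\<close> of the bounding chain leaves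
  a cycle over the vertices.\<close>

lemma edge_class_zero_iff:
  assumes v: "v \<in> total_cycles (Suc q)"
  shows "edge_class q v = \<zero>\<^bsub>lhom 1 q\<^esub> \<longleftrightarrow>
    (\<exists>z\<in>fiberwise_cycles 0 (Suc q). \<exists>b\<in>total_boundaries (Suc q). v = z \<oplus>\<^bsub>total_space (Suc q)\<^esub> b)"
proof -
  let ?V = "total_space (Suc q)"
  interpret V: Module.module K ?V by (rule module_total_space)
  have vV: "v \<in> carrier ?V" using v by simp
  have "edge_class q v = \<zero>\<^bsub>lhom 1 q\<^esub> \<longleftrightarrow> class_chain 1 q (part 1 v) = \<zero>\<^bsub>lchains q 1\<^esub>"
    unfolding edge_class_def cosheaf_homology_def
    using class_zero_iff[OF chain_complex_cosheaf submodule_subset[OF submodule_cycles[OF chain_complex_cosheaf] edge_class_chain_cycle[OF v]]] cosheaf_boundaries_1 by simp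
  also have "\<dots> \<longleftrightarrow> (\<exists>a\<in>carrier (Ch_dim 1 (Suc (Suc q))). part 1 v = part 1 (bd (Suc (Suc q)) a))"
    using class_chain_zero_iff[OF edge_part_total_cycle[OF v]] by simp
  also have "\<dots> \<longleftrightarrow> (\<exists>z\<in>fiberwise_cycles 0 (Suc q). \<exists>b\<in>total_boundaries (Suc q). v = z \<oplus>\<^bsub>?V\<^esub> b)"
  proof
    assume "\<exists>a\<in>carrier (Ch_dim 1 (Suc (Suc q))). part 1 v = part 1 (bd (Suc (Suc q)) a)"
    then obtain a where a: "a \<in> carrier (Ch_dim 1 (Suc (Suc q)))"
      "part 1 v = part 1 (bd (Suc (Suc q)) a)" by blast
    let ?b = "bd (Suc (Suc q)) a"
    have b: "?b \<in> total_boundaries (Suc q)" unfolding total_boundary_iff using Ch_dim_Ch[OF a(1)] by blast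
    then have bV: "?b \<in> total_cycles (Suc q)" using boundaries_subset_cycles[OF chain_complex_simplicial] by blast
    let ?z = "v \<oplus>\<^bsub>?V\<^esub> \<ominus>\<^bsub>?V\<^esub> ?b"
    have bV': "?b \<in> carrier ?V" using bV by simp
    have z: "?z \<in> carrier ?V" by (rule V.a_closed[OF vV V.a_inv_closed[OF bV']])
    have "part 1 ?z = part 1 v \<oplus>\<^bsub>cycle_space 1 q\<^esub> \<ominus>\<^bsub>cycle_space 1 q\<^esub> part 1 ?b"
      using linear_map_add[OF linear_map_edge_part vV V.a_inv_closed[OF bV']]
        linear_map_minus[OF module_total_space module_cycle_space linear_map_edge_part bV'] by simp
    also have "\<dots> = \<zero>\<^bsub>cycle_space 1 q\<^esub>"
      unfolding a(2) using abelian_group.r_neg[OF Module.module.axioms(2)[OF module_cycle_space]]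
        linear_map_closed[OF linear_map_edge_part bV'] by blast
    finally have z1: "part 1 ?z = zero_chain" by (simp add: free_space_simps)
    have zC: "?z \<in> carrier (Ch (Suc q))" using z total_cycleD(1) by simp
    have "?z \<sigma> = part 0 ?z \<sigma>" for \<sigma>
    proof -
      have "?z \<sigma> = part 0 ?z \<sigma> \<oplus> part 1 ?z \<sigma>" using fun_cong[OF chain_split[OF zC], of \<sigma>] .
      also have "\<dots> = part 0 ?z \<sigma>" unfolding z1 using free_spaceD(1)[OF parts_closed(1)[OF zC]] by simp
      finally show ?thesis .
    qed
    then have "?z = part 0 ?z" by (rule ext)
    then have "?z \<in> carrier (Ch_dim 0 (Suc q))" using parts_closed(1)[OF zC] by simp
    then have "?z \<in> fiberwise_cycles 0 (Suc q)" using z fiberwise_cycles_0_iff by simp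
    moreover have "v = ?z \<oplus>\<^bsub>?V\<^esub> ?b"
      by (simp only: V.a_assoc[OF vV V.a_inv_closed[OF bV'] bV'] V.l_neg[OF bV'] V.r_zero[OF vV])
    ultimately show "\<exists>z\<in>fiberwise_cycles 0 (Suc q). \<exists>b\<in>total_boundaries (Suc q). v = z \<oplus>\<^bsub>?V\<^esub> b" using b by blast
  next
    assume "\<exists>z\<in>fiberwise_cycles 0 (Suc q). \<exists>b\<in>total_boundaries (Suc q). v = z \<oplus>\<^bsub>?V\<^esub> b"
    then obtain z b where z: "z \<in> fiberwise_cycles 0 (Suc q)" and b: "b \<in> total_boundaries (Suc q)" "v = z \<oplus>\<^bsub>?V\<^esub> b" by blast
    obtain c where c: "c \<in> carrier (Ch (Suc (Suc q)))" "b = bd (Suc (Suc q)) c" using b(1) unfolding total_boundary_iff by blast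
    have zc: "z \<in> carrier (Ch_dim 0 (Suc q))" using z fiberwise_cycles_0_iff by blast
    have pz: "part 1 z = zero_chain" by (rule part_other[OF zc]) simp
    have "part 1 v = (\<lambda>\<sigma>. \<zero> \<oplus> part 1 (bd (Suc (Suc q)) (part 1 c)) \<sigma>)"
      using part_add[of 1 z "bd (Suc (Suc q)) c"]
      unfolding b(2) c(2) edge_part_bd[OF c(1)] pz by (simp add: free_space_simps del: One_nat_def)
    also have "\<dots> = part 1 (bd (Suc (Suc q)) (part 1 c))"
      using free_spaceD(1)[OF parts_closed(2)[OF bd_closed[OF parts_closed(2)[OF c(1)] over_subset(2)]]] by simp
    finally show "\<exists>a\<in>carrier (Ch_dim 1 (Suc (Suc q))). part 1 v = part 1 (bd (Suc (Suc q)) a)"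
      using parts_closed(2)[OF c(1)] by auto
  qed
  finally show ?thesis .
qed

text \<open>Classes of cycles over the vertices form a copy of \<open>H\<^sub>0(Y;
  L\<^sub>k)\<close> in \<open>H\<^sub>k(X)\<close>, and the edge part of a cycle maps the
  quotient isomorphically to \<open>H\<^sub>1(Y; L\<^sub>q)\<close> with \<open>q = k - 1\<close>.
  The extension splits over a field. All other summands vanish because \<open>Y\<close> has no
  simplex of dimension above 1. For \<open>k = 0\<close> every simplex of \<open>X\<close> in
  question is a vertex and lies over a vertex.\<close>

theorem homology_over_graph:
  "vs_iso K (simplicial_homology K X ori k) (direct_sum {(p, q). p + q = k} (\<lambda>(p, q). lhom p q))"
proof (cases k)
  case 0
  have "over_dim 0 k = simplices X k"
  proof -
    have "sdim (f ` \<sigma>) = 0" if "\<sigma> \<in> simplices X 0" for \<sigma>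
    proof (rule ccontr)
      assume "sdim (f ` \<sigma>) \<noteq> 0"
      then have "\<sigma> \<in> over_dim 1 0" using base_graph[OF image_in_base[OF that]] that by (simp add: over_dim_def)
      then show False using over_dim_1_0 by simp
    qed
    then show ?thesis using 0 by (auto simp: over_dim_def)
  qed
  then have ZV: "fiberwise_cycles 0 k = total_cycles k" using fiberwise_cycles_0_iff total_cycle_iff 0 by auto
  then have VV: "total_space k\<lparr>carrier := fiberwise_cycles 0 k\<rparr> = total_space k" by simp
  have I: "{(p, q). p + q = k} = {(0, 0)}" using 0 by auto
  show ?thesis unfolding simplicial_homology_eq I
  proof (rule vs_iso_finite_direct_sum[where h = "\<lambda>_. vertex_class k"])
    show "linear_map K (total_space k) (case i of (p, q) \<Rightarrow> lhom p q) (vertex_class k)" if "i \<in> {(0, 0)}" for i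
      using that linear_map_vertex_class[of k] VV 0 by simp
    show "(\<forall>i\<in>{(0, 0)}. vertex_class k v = \<zero>\<^bsub>case i of (p, q) \<Rightarrow> lhom p q\<^esub>) = (v \<in> total_boundaries k)" if "v \<in> carrier (total_space k)" for v
      using vertex_class_zero_iff[of v] that ZV 0 by simp
    show "\<exists>v\<in>carrier (total_space k). \<forall>i\<in>{(0, 0)}. vertex_class k v = x i"
      if "\<And>i. i \<in> {(0, 0)} \<Longrightarrow> x i \<in> carrier (case i of (p, q) \<Rightarrow> lhom p q)" for x
      using vertex_class_surj[of "x (0, 0)" k] that[of "(0, 0)"] ZV 0 by simp
  qed (use module_total_space submodule_total_boundaries module_lhom in auto)
next
  case (Suc q)
  obtain \<gamma> where \<gamma>: "linear_map K (total_space k) (lhom 0 k) \<gamma>"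
    "\<forall>v\<in>carrier (total_space k). \<gamma> v = \<zero>\<^bsub>lhom 0 k\<^esub> \<and> edge_class q v = \<zero>\<^bsub>lhom 1 q\<^esub> \<longleftrightarrow> v \<in> total_boundaries k"
    "\<forall>x\<in>carrier (lhom 0 k). \<forall>y\<in>carrier (lhom 1 q). \<exists>v\<in>carrier (total_space k). \<gamma> v = x \<and> edge_class q v = y"
  proof (rule split_quotient[OF module_total_space module_lhom module_lhom submodule_vertex_cycles
        submodule_total_boundaries linear_map_vertex_class vertex_class_surj vertex_class_zero_iff
        linear_map_edge_class[of q, folded Suc]])
    show "\<exists>v\<in>carrier (total_space k). edge_class q v = x" if "x \<in> carrier (lhom 1 q)" for x
      using edge_class_surj[OF that] Suc by simp
    show "edge_class q v = \<zero>\<^bsub>lhom 1 q\<^esub> \<longleftrightarrow>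
        (\<exists>z\<in>fiberwise_cycles 0 k. \<exists>b\<in>total_boundaries k. v = z \<oplus>\<^bsub>total_space k\<^esub> b)"
      if "v \<in> carrier (total_space k)" for v
      using edge_class_zero_iff[of v q] that Suc by simp
  qed assumption+
  let ?I = "{(p, q). p + q = k}"
  let ?h = "\<lambda>(p, r) v. if p = 0 then \<gamma> v else if p = 1 then edge_class q v else \<zero>\<^bsub>lhom p r\<^esub>"
  have fin: "finite ?I"
    by (rule finite_subset[of _ "{..k} \<times> {..k}"]) auto
  have triv: "carrier (lhom p r) = {\<zero>\<^bsub>lhom p r\<^esub>}" if "p \<noteq> 0" "p \<noteq> 1" for p r
  proof -
    have "p = Suc (Suc (p - 2))" using that by arith
    then show ?thesis using trivial_cosheaf_homology[of r "p - 2"] by simp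
  qed
  have I: "(0, k) \<in> ?I" "(1, q) \<in> ?I" using Suc by auto
  have Icases: "(p = 0 \<and> r = k) \<or> (p = 1 \<and> r = q) \<or> (p \<noteq> 0 \<and> p \<noteq> 1)" if "(p, r) \<in> ?I" for p r
    using that Suc by auto
  show ?thesis unfolding simplicial_homology_eq
  proof (rule vs_iso_finite_direct_sum[where h = ?h])
    show "linear_map K (total_space k) (case i of (p, q) \<Rightarrow> lhom p q) (?h i)" if "i \<in> ?I" for i
    proof -
      obtain p r where i: "i = (p, r)" by (cases i)
      interpret H: Module.module K "lhom p r" by (rule module_lhom)
      have "linear_map K (total_space k) (lhom p r) (\<lambda>v. \<zero>\<^bsub>lhom p r\<^esub>)" by (rule linear_mapI) simp_all
      then show ?thesis using Icases[of p r] that \<gamma>(1) linear_map_edge_class[of q, folded Suc] unfolding i by auto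
    qed
    show "(\<forall>i\<in>?I. ?h i v = \<zero>\<^bsub>case i of (p, q) \<Rightarrow> lhom p q\<^esub>) = (v \<in> total_boundaries k)" if v: "v \<in> carrier (total_space k)" for v
    proof -
      have "(\<forall>i\<in>?I. ?h i v = \<zero>\<^bsub>case i of (p, q) \<Rightarrow> lhom p q\<^esub>) \<longleftrightarrow> \<gamma> v = \<zero>\<^bsub>lhom 0 k\<^esub> \<and> edge_class q v = \<zero>\<^bsub>lhom 1 q\<^esub>"
      proof
        assume *: "\<forall>i\<in>?I. ?h i v = \<zero>\<^bsub>case i of (p, q) \<Rightarrow> lhom p q\<^esub>"
        show "\<gamma> v = \<zero>\<^bsub>lhom 0 k\<^esub> \<and> edge_class q v = \<zero>\<^bsub>lhom 1 q\<^esub>"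
          using bspec[OF * I(1)] bspec[OF * I(2)] by simp
      next
        assume *: "\<gamma> v = \<zero>\<^bsub>lhom 0 k\<^esub> \<and> edge_class q v = \<zero>\<^bsub>lhom 1 q\<^esub>"
        show "\<forall>i\<in>?I. ?h i v = \<zero>\<^bsub>case i of (p, q) \<Rightarrow> lhom p q\<^esub>"
        proof
          fix i assume i: "i \<in> ?I"
          obtain p r where pr: "i = (p, r)" by (cases i)
          from Icases[OF i[unfolded pr]] * show "?h i v = \<zero>\<^bsub>case i of (p, q) \<Rightarrow> lhom p q\<^esub>"
            unfolding pr by auto
        qed
      qed
      with bspec[OF \<gamma>(2) v] show ?thesis by simp
    qed
    show "\<exists>v\<in>carrier (total_space k). \<forall>i\<in>?I. ?h i v = x i"
      if x: "\<And>i. i \<in> ?I \<Longrightarrow> x i \<in> carrier (case i of (p, q) \<Rightarrow> lhom p q)" for x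
    proof -
      obtain v where v: "v \<in> carrier (total_space k)" "\<gamma> v = x (0, k)" "edge_class q v = x (1, q)"
        using \<gamma>(3)[rule_format, of "x (0, k)" "x (1, q)"] x[OF I(1)] x[OF I(2)] by auto
      have "?h i v = x i" if i: "i \<in> ?I" for i
      proof -
        obtain p r where pr: "i = (p, r)" by (cases i)
        show ?thesis
          using Icases[OF i[unfolded pr]] v(2,3) x[OF i] triv[of p r] unfolding pr by auto
      qed
      with v(1) show ?thesis by blast
    qed
  qed (use module_total_space submodule_total_boundaries fin module_lhom in auto)
qed

end

section \<open>Triangulations of the real line\<close>

definition vertex_point :: "'w \<Rightarrow> 'w \<Rightarrow> real" where
  "vertex_point v = (\<lambda>w. if w = v then 1 else 0)"

lemma vertex_point_support: "{w. vertex_point v w \<noteq> 0} = {v}"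
  by (auto simp: vertex_point_def)

lemma vertex_point_closed_simplex:
  "{v} \<in> Y \<Longrightarrow> v \<in> \<tau> \<Longrightarrow> vertex_point v \<in> closed_simplex Y \<tau>"
  unfolding closed_simplex_def mem_Collect_eq vertex_point_support
  by (simp add: vertex_point_def)

lemma closed_simplex_eq_vertex_point:
  assumes x: "x \<in> closed_simplex Y \<tau>" and fin: "finite \<tau>" and v: "x v = 1"
  shows "x = vertex_point v"
proof
  fix w
  let ?S = "{v. x v \<noteq> 0}"
  have S: "finite ?S" "sum x ?S = 1" "\<And>u. 0 \<le> x u" "v \<in> ?S"
    using x fin v unfolding closed_simplex_def by (auto intro: finite_subset)
  have "sum x (?S - {v}) = 0" using S(1,2,4) v by (simp add: sum_diff1)
  then have "\<forall>u\<in>?S - {v}. x u = 0" using S(1,3) by (subst (asm) sum_nonneg_eq_0_iff) auto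
  then show "x w = vertex_point v w" using v by (auto simp: vertex_point_def)
qed

lemma topspace_realization: "topspace (realization Y) = (\<Union>\<tau>\<in>Y. closed_simplex Y \<tau>)"
proof -
  have "openin (realization Y) (\<Union>\<tau>\<in>Y. closed_simplex Y \<tau>)"
    unfolding openin_realization
  proof (intro conjI ballI)
    fix \<tau> assume "\<tau> \<in> Y"
    then have "(\<Union>\<tau>\<in>Y. closed_simplex Y \<tau>) \<inter> closed_simplex Y \<tau> = closed_simplex Y \<tau>" by blast
    then show "openin (top_of_set (closed_simplex Y \<tau>)) ((\<Union>\<tau>\<in>Y. closed_simplex Y \<tau>) \<inter> closed_simplex Y \<tau>)"
      by simp
  qed simp
  moreover have "topspace (realization Y) \<subseteq> (\<Union>\<tau>\<in>Y. closed_simplex Y \<tau>)"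
    using openin_topspace[of "realization Y"] unfolding openin_realization by blast
  ultimately show ?thesis by (intro subset_antisym openin_subset)
qed

text \<open>In the weak topology closedness can be tested on closed simplices, and each of these
  contains only finitely many vertices.\<close>

lemma closed_vertex_sets:
  assumes Y: "is_complex Y" and S: "\<And>v. v \<in> S \<Longrightarrow> {v} \<in> Y"
  shows "closedin (realization Y) (vertex_point ` S)"
  unfolding closedin_def
proof
  show "vertex_point ` S \<subseteq> topspace (realization Y)"
    unfolding topspace_realization
  proof (rule image_subsetI)
    fix v assume "v \<in> S"
    then show "vertex_point v \<in> (\<Union>\<tau>\<in>Y. closed_simplex Y \<tau>)"
      by (intro UN_I[of "{v}"] vertex_point_closed_simplex S) simp_all
  qed
  show "openin (realization Y) (topspace (realization Y) - vertex_point ` S)"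
    unfolding openin_realization topspace_realization
  proof (intro conjI ballI)
    fix \<tau> assume \<tau>: "\<tau> \<in> Y"
    let ?T = "closed_simplex Y \<tau>"
    have fin: "finite \<tau>" using Y \<tau> by (auto simp: is_complex_def)
    have eq: "((\<Union>\<tau>\<in>Y. closed_simplex Y \<tau>) - vertex_point ` S) \<inter> ?T = ?T \<inter> (\<Inter>v\<in>\<tau> \<inter> S. {x. x v \<noteq> 1})"
    proof (rule equalityI; rule subsetI)
      fix x assume "x \<in> ((\<Union>\<tau>\<in>Y. closed_simplex Y \<tau>) - vertex_point ` S) \<inter> ?T"
      then have x: "x \<in> ?T" "x \<notin> vertex_point ` S" by blast+
      have "x v \<noteq> 1" if "v \<in> \<tau> \<inter> S" for v
        using closed_simplex_eq_vertex_point[OF x(1) fin, of v] x(2) that by blast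
      then show "x \<in> ?T \<inter> (\<Inter>v\<in>\<tau> \<inter> S. {x. x v \<noteq> 1})" using x(1) by blast
    next
      fix x assume "x \<in> ?T \<inter> (\<Inter>v\<in>\<tau> \<inter> S. {x. x v \<noteq> 1})"
      then have x: "x \<in> ?T" "\<And>v. v \<in> \<tau> \<inter> S \<Longrightarrow> x v \<noteq> 1" by auto
      have "x \<noteq> vertex_point v" if "v \<in> S" for v
      proof
        assume e: "x = vertex_point v"
        then have "v \<in> \<tau>" using x(1) vertex_point_support[of v] unfolding closed_simplex_def by auto
        then show False using x(2)[of v] that e by (simp add: vertex_point_def)
      qed
      then show "x \<in> ((\<Union>\<tau>\<in>Y. closed_simplex Y \<tau>) - vertex_point ` S) \<inter> ?T" using x(1) \<tau> by blast
    qed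
    have "open {x :: 'a \<Rightarrow> real. x v \<noteq> 1}" for v
    proof -
      have "continuous_on UNIV (\<lambda>x :: 'a \<Rightarrow> real. x v)" by (rule continuous_on_product_coordinates)
      then have "open ((\<lambda>x :: 'a \<Rightarrow> real. x v) -` (- {1}))" by (intro open_vimage) auto
      then show ?thesis by (simp add: vimage_def)
    qed
    then have "open (\<Inter>v\<in>\<tau> \<inter> S. {x :: 'a \<Rightarrow> real. x v \<noteq> 1})" using fin by (intro open_INT) auto
    then show "openin (top_of_set ?T) (((\<Union>\<tau>\<in>Y. closed_simplex Y \<tau>) - vertex_point ` S) \<inter> ?T)"
      unfolding eq by (rule openin_open_Int)
  qed blast
qed

text \<open>A bounded infinite set has a limit point, and the set without this point is not
  closed.\<close>

lemma finite_of_closed_subsets: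
  fixes A :: "real set"
  assumes "A \<subseteq> {x..y}" "\<And>B. B \<subseteq> A \<Longrightarrow> closed B"
  shows "finite A"
proof (rule ccontr)
  assume "infinite A"
  then obtain l where "l islimpt A"
    using compact_eq_Bolzano_Weierstrass[of "{x..y}"] assms(1) by auto
  then have "l islimpt (A - {l})" using islimpt_punctured by blast
  moreover have "closed (A - {l})" by (rule assms(2)) blast
  ultimately have "l \<in> A - {l}" unfolding closed_limpt by blast
  then show False by simp
qed

locale line_triangulation =
  fixes Y :: "'w set set" and h :: "('w \<Rightarrow> real) \<Rightarrow> real"
  assumes Y: "is_complex Y" and h: "homeomorphic_map (realization Y) euclideanreal h"
begin

definition pos :: "'w \<Rightarrow> real" where
  "pos v = h (vertex_point v)"

definition vertices :: "'w set" where
  "vertices = {v. {v} \<in> Y}"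

lemma vertex_of_simplex: "\<tau> \<in> Y \<Longrightarrow> v \<in> \<tau> \<Longrightarrow> v \<in> vertices"
  using face_in_complex[OF Y, of \<tau> "{v}"] by (simp add: vertices_def)

lemma vertex_point_topspace: "v \<in> vertices \<Longrightarrow> vertex_point v \<in> topspace (realization Y)"
  unfolding topspace_realization vertices_def
  by (rule UN_I[of "{v}"]) (simp_all add: vertex_point_closed_simplex)

lemma h_inj: "inj_on h (topspace (realization Y))"
  using h homeomorphic_eq_everything_map by blast

lemma pos_inj: "inj_on pos vertices"
proof (rule inj_onI)
  fix v w assume "v \<in> vertices" "w \<in> vertices" "pos v = pos w"
  then have "vertex_point v = vertex_point w"
    using h_inj vertex_point_topspace unfolding pos_def inj_on_def by blast
  from fun_cong[OF this, of v] show "v = w" by (simp add: vertex_point_def split: if_splits)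
qed

text \<open>By the intermediate value theorem some point of the edge takes the position of
  \<open>w\<close>. Since \<open>h\<close> is injective, this point is the vertex
  \<open>w\<close>, but the only vertices on the edge are its ends.\<close>

lemma no_vertex_inside_edge:
  assumes ab: "{a, b} \<in> Y" and w: "w \<in> vertices" and lt: "pos a < pos w" "pos w < pos b"
  shows False
proof -
  let ?\<tau> = "{a, b}"
  define \<gamma> :: "real \<Rightarrow> 'w \<Rightarrow> real" where
    "\<gamma> t = (\<lambda>u. (1 - t) * vertex_point a u + t * vertex_point b u)" for t
  have "a \<noteq> b" using lt by auto
  have v: "{a} \<in> Y" "{b} \<in> Y" using vertex_of_simplex[OF ab] by (auto simp: vertices_def)
  have mem: "\<gamma> t \<in> closed_simplex Y ?\<tau>" if t: "t \<in> {0..1}" for t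
  proof (cases "t = 0 \<or> t = 1")
    case True
    then have "\<gamma> t = vertex_point a \<or> \<gamma> t = vertex_point b" by (auto simp: \<gamma>_def)
    then show ?thesis using vertex_point_closed_simplex[of _ Y ?\<tau>] v by auto
  next
    case False
    have "{u. \<gamma> t u \<noteq> 0} = {a, b}" using False \<open>a \<noteq> b\<close> by (auto simp: \<gamma>_def vertex_point_def)
    moreover have "sum (\<gamma> t) {a, b} = 1" using \<open>a \<noteq> b\<close> by (simp add: \<gamma>_def vertex_point_def)
    moreover have "0 \<le> \<gamma> t u" for u using t by (simp add: \<gamma>_def vertex_point_def)
    ultimately show ?thesis using ab by (simp add: closed_simplex_def)
  qed
  have "continuous_on {0..1} \<gamma>"
    unfolding \<gamma>_def by (intro continuous_on_coordinatewise_then_product continuous_intros)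
  then have "continuous_map (top_of_set {0..1}) (top_of_set (closed_simplex Y ?\<tau>)) \<gamma>"
    using mem by (simp add: continuous_map_in_subtopology image_subset_iff)
  moreover have "continuous_map (top_of_set (closed_simplex Y ?\<tau>)) (realization Y) id"
    unfolding continuous_map_def
  proof (intro conjI allI impI)
    show "id \<in> topspace (top_of_set (closed_simplex Y ?\<tau>)) \<rightarrow> topspace (realization Y)"
      using ab by (auto simp: topspace_realization)
    fix U assume "openin (realization Y) U"
    then have "openin (top_of_set (closed_simplex Y ?\<tau>)) (U \<inter> closed_simplex Y ?\<tau>)"
      using ab by (simp add: openin_realization)
    moreover have "{x \<in> topspace (top_of_set (closed_simplex Y ?\<tau>)). id x \<in> U} = U \<inter> closed_simplex Y ?\<tau>"
      by auto
    ultimately show "openin (top_of_set (closed_simplex Y ?\<tau>)) {x \<in> topspace (top_of_set (closed_simplex Y ?\<tau>)). id x \<in> U}"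
      by simp
  qed
  moreover have "continuous_map (realization Y) euclideanreal h"
    using h by (rule homeomorphic_imp_continuous_map)
  ultimately have "continuous_map (top_of_set {0..1}) euclideanreal (h \<circ> (id \<circ> \<gamma>))"
    by (intro continuous_map_compose)
  then have cont: "continuous_on {0..1} (\<lambda>t. h (\<gamma> t))" by (simp add: o_def)
  have ends: "\<gamma> 0 = vertex_point a" "\<gamma> 1 = vertex_point b" by (simp_all add: \<gamma>_def)
  obtain t where t: "0 \<le> t" "t \<le> 1" "h (\<gamma> t) = pos w"
    using IVT'[of "\<lambda>t. h (\<gamma> t)" 0 "pos w" 1] cont lt ends by (auto simp: pos_def)
  have "\<gamma> t \<in> topspace (realization Y)" unfolding topspace_realization using mem[of t] t ab by auto
  then have "\<gamma> t = vertex_point w"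
    using t(3) h_inj vertex_point_topspace[OF w] unfolding pos_def inj_on_def by blast
  from fun_cong[OF this, of w] have "w = a \<or> w = b"
    by (auto simp: \<gamma>_def vertex_point_def split: if_splits)
  then show False using lt by auto
qed

text \<open>Among three vertices of a simplex one would lie between the other two, which span an
  edge.\<close>

lemma dimension_le_1:
  assumes "\<tau> \<in> Y"
  shows "sdim \<tau> \<le> 1"
proof (rule ccontr)
  assume "\<not> sdim \<tau> \<le> 1"
  then have "3 \<le> card \<tau>" by (simp add: sdim_def)
  then obtain T where T: "T \<subseteq> \<tau>" "card T = 3" "finite T" by (rule obtain_subset_with_card_n)
  from T(2) obtain a b c where abc: "T = {a, b, c}" "a \<noteq> b" "b \<noteq> c" "a \<noteq> c"
    by (auto simp: card_3_iff)
  have edge: "{u, v} \<in> Y" if "u \<in> T" "v \<in> T" for u v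
    using face_in_complex[OF Y assms, of "{u, v}"] T(1) that by auto
  have vert: "u \<in> vertices" if "u \<in> T" for u using vertex_of_simplex[OF assms] T(1) that by blast
  have not: "\<not> (pos u < pos v \<and> pos v < pos w)" if "u \<in> T" "v \<in> T" "w \<in> T" for u v w
    using no_vertex_inside_edge[OF edge[OF that(1,3)] vert[OF that(2)]] by blast
  have "pos a \<noteq> pos b" "pos b \<noteq> pos c" "pos a \<noteq> pos c"
    using pos_inj vert abc unfolding inj_on_def by blast+
  then show False
    using not[of a b c] not[of a c b] not[of b a c] not[of b c a] not[of c a b] not[of c b a]
    unfolding abc(1) by simp argo
qed

text \<open>All sets of vertices are closed, so vertices do not accumulate on the line.\<close>

lemma finite_vertices_between: "finite {v \<in> vertices. x \<le> pos v \<and> pos v \<le> y}"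
proof (rule finite_imageD)
  show "inj_on pos {v \<in> vertices. x \<le> pos v \<and> pos v \<le> y}"
    by (rule inj_on_subset[OF pos_inj]) blast
  show "finite (pos ` {v \<in> vertices. x \<le> pos v \<and> pos v \<le> y})"
  proof (rule finite_of_closed_subsets)
    fix B assume "B \<subseteq> pos ` {v \<in> vertices. x \<le> pos v \<and> pos v \<le> y}"
    then obtain S where S: "S \<subseteq> vertices" "B = pos ` S" by (auto simp: subset_image_iff)
    have "closedin (realization Y) (vertex_point ` S)"
      by (rule closed_vertex_sets[OF Y]) (use S(1) in \<open>auto simp: vertices_def\<close>)
    then have "closedin euclideanreal (h ` vertex_point ` S)"
      using h homeomorphic_map_closedness_eq[of "realization Y" euclideanreal h] by blast
    then show "closed B" unfolding S(2) pos_def image_image by simp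
  qed auto
qed

text \<open>The vertices are numbered along the line, and an edge joins consecutive ones. The parity of
  the number of vertices between a fixed point and a vertex is therefore a 2-colouring.\<close>

definition vertex_parity :: "'w \<Rightarrow> bool" where
  "vertex_parity v = even (card {w \<in> vertices. 0 \<le> pos w \<and> pos w < pos v} +
     card {w \<in> vertices. pos v \<le> pos w \<and> pos w < 0})"

lemma vertex_parity_consecutive:
  assumes ab: "{a, b} \<in> Y" and lt: "pos a < pos b"
  shows "vertex_parity a \<noteq> vertex_parity b"
proof -
  have av: "a \<in> vertices" using vertex_of_simplex[OF ab] by blast
  have gap: "pos w \<le> pos a \<or> pos b \<le> pos w" if "w \<in> vertices" for w
    using no_vertex_inside_edge[OF ab that] by argo
  have eq: "w = a" if "w \<in> vertices" "pos w = pos a" for w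
    using pos_inj av that unfolding inj_on_def by blast
  let ?R = "\<lambda>v. {w \<in> vertices. 0 \<le> pos w \<and> pos w < pos v}"
  let ?L = "\<lambda>v. {w \<in> vertices. pos v \<le> pos w \<and> pos w < 0}"
  have fR: "finite (?R v)" and fL: "finite (?L v)" for v
    by (rule finite_subset[OF _ finite_vertices_between[of 0 "pos v"]], force,
        rule finite_subset[OF _ finite_vertices_between[of "pos v" 0]], force)
  consider "0 \<le> pos a" | "pos a < 0" "pos b \<le> 0" | "pos a < 0" "0 < pos b" by argo
  then show ?thesis
  proof cases
    case 1
    have "?R b = insert a (?R a)"
    proof (rule equalityI; rule subsetI)
      fix w assume w: "w \<in> ?R b"
      then have "pos w \<le> pos a" using gap[of w] by auto
      then show "w \<in> insert a (?R a)" using w eq[of w] by (cases "pos w = pos a") auto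
    qed (use av lt 1 in auto)
    then have R: "card (?R b) = Suc (card (?R a))" using fR[of a] by simp
    have L: "?L a = {}" "?L b = {}" using 1 lt by auto
    show ?thesis unfolding vertex_parity_def R L by simp
  next
    case 2
    have "?L a = insert a (?L b)"
    proof (rule equalityI; rule subsetI)
      fix w assume w: "w \<in> ?L a"
      then show "w \<in> insert a (?L b)" using gap[of w] eq[of w] by (cases "pos w = pos a") auto
    qed (use av lt 2 in auto)
    then have L: "card (?L a) = Suc (card (?L b))" using fL[of b] lt by simp
    have R: "?R a = {}" "?R b = {}" using 2 lt by auto
    show ?thesis unfolding vertex_parity_def L R by simp
  next
    case 3
    have La: "?L a = {a}"
    proof (rule equalityI; rule subsetI)
      fix w assume w: "w \<in> ?L a"
      then show "w \<in> {a}" using gap[of w] eq[of w] 3 by auto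
    qed (use av 3 in auto)
    have Rb: "?R b = {}"
    proof -
      have False if "w \<in> ?R b" for w using that gap[of w] 3 by auto
      then show ?thesis by blast
    qed
    have none: "?R a = {}" "?L b = {}" using 3 by auto
    show ?thesis unfolding vertex_parity_def La Rb none by simp
  qed
qed

lemma vertex_parity_edge:
  assumes "{a, b} \<in> Y" "a \<noteq> b"
  shows "vertex_parity a \<noteq> vertex_parity b"
proof -
  have "a \<in> vertices" "b \<in> vertices" using vertex_of_simplex[OF assms(1)] by blast+
  then have "pos a \<noteq> pos b" using pos_inj assms(2) unfolding inj_on_def by blast
  then consider "pos a < pos b" | "pos b < pos a" by argo
  then show ?thesis
  proof cases
    case 1
    then show ?thesis by (rule vertex_parity_consecutive[OF assms(1)])
  next
    case 2
    have "{b, a} \<in> Y" using assms(1) by (simp add: insert_commute)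
    from vertex_parity_consecutive[OF this 2] show ?thesis by simp
  qed
qed

end

section \<open>The Leray cosheaves over the real line\<close>

theorem corollary4p1:
  fixes K :: "('k, 'r) ring_scheme"
    and X :: "'v set set" and Y :: "'w set set" and f :: "'v \<Rightarrow> 'w"
    and oriX :: "'v set \<Rightarrow> 'v list" and oriY :: "'w set \<Rightarrow> 'w list"
    and k :: nat
  assumes "field K"
    and "is_complex X"
    and "triangulates_real_line Y"
    and "simplicial_map X Y f"
    and "orientation X oriX"
    and "orientation Y oriY"
  shows "vs_iso K
    (simplicial_homology K X oriX k)
    (direct_sum {(p, q). p + q = k}
      (\<lambda>(p, q). cosheaf_homology Y oriY (leray_cosheaf K X oriX f q) p))"
proof -
  interpret K: field K by fact
  have Y: "is_complex Y" using assms(3) by (simp add: triangulates_real_line_def)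
  obtain h where "homeomorphic_map (realization Y) euclideanreal h"
    using assms(3) unfolding triangulates_real_line_def homeomorphic_space by blast
  then interpret Y: line_triangulation Y h by unfold_locales (rule Y)
  \<comment> \<open>The sign of a vertex is its colour and the sign of an edge is the colour of its head, the last
    entry of its reference orientation. The last entry of the orientation of a vertex is the
    vertex.\<close>
  define s where "s \<tau> = (if Y.vertex_parity (last (oriY \<tau>)) then \<one>\<^bsub>K\<^esub> else \<ominus>\<^bsub>K\<^esub> \<one>\<^bsub>K\<^esub>)" for \<tau>
  interpret G: fibered_graph K X oriX Y f s oriY
  proof unfold_locales
    show "s \<tau> \<in> carrier K" for \<tau> by (simp add: s_def)
    show "s \<tau> \<otimes>\<^bsub>K\<^esub> s \<tau> = \<one>\<^bsub>K\<^esub>" for \<tau> by (simp add: s_def K.l_minus K.r_minus)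
    show "sdim \<tau> \<le> 1" if "\<tau> \<in> Y" for \<tau> by (rule Y.dimension_le_1[OF that])
    fix e a b assume e: "e \<in> simplices Y 1" and ab: "oriY e = [a, b]"
    have eY: "e \<in> Y" using e by (simp add: simplices_def)
    note o = ori_props[OF Y assms(6) eY]
    have e_eq: "e = {a, b}" "a \<noteq> b" using o(1,2) ab by auto
    have single: "last (oriY {v}) = v" if "v \<in> e" for v
    proof -
      have "{v} \<in> Y" using face_in_complex[OF Y eY, of "{v}"] that by simp
      note o = ori_props[OF Y assms(6) this]
      have "oriY {v} \<noteq> []" using o(2) by auto
      then show ?thesis using o(2) last_in_set[of "oriY {v}"] by auto
    qed
    have "Y.vertex_parity a \<noteq> Y.vertex_parity b"
      by (rule Y.vertex_parity_edge) (use eY e_eq in simp_all)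
    then show "s {b} = s e \<and> s {a} = \<ominus>\<^bsub>K\<^esub> s e"
      using single[of a] single[of b] e_eq(1) ab by (auto simp: s_def)
  qed (use assms Y in auto)
  show ?thesis by (rule G.homology_over_graph)
qed

end
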